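(* The universal enveloping functor $\mathcal{F}^{\mathrm{properads}}_{\mathrm{dioperads}}$ from dg dioperads to dg properads (the left adjoint of the forgetful functor from properads to dioperads) is not exact, i.e. it does not send all quasi-isomorphisms to quasi-isomorphisms.
   Context: Work over a field $\mathbb{K}$ of characteristic $0$. An $\mathbb{S}$-bimodule is a family $\mathcal{P}(m,n)$ of dg $\mathbb{K}$-modules with commuting left $\mathbb{S}_m$- and right $\mathbb{S}_n$-actions. The product $\boxtimes_c$ is spanned by connected 2-levelled directed graphs with labelled inputs and outputs and vertices decorated by elements of the two $\mathbb{S}$-bimodules, modulo equivariance; $\Box$ is its restriction to graphs of genus $0$ (first Betti number $0$). A properad is a monoid for $(\boxtimes_c,I)$ and a dioperad is a monoid for $(\Box,I)$, where $I(1,1)=\mathbb{K}$ and $I(m,n)=0$ otherwise. The forgetful functor sends a properad to the same $\mathbb{S}$-bimodule, keeping only compositions along genus $0$ connected graphs. Its left adjoint sends a dioperad $(\mathcal{D},\mu_{\mathcal{D}})$ to $\mathcal{F}(\mathcal{D})/J$, where $\mathcal{F}(\mathcal{D})$ is the free properad (connected directed graphs without oriented cycles, decorated by $\mathcal{D}$) and $J$ is the properadic ideal generated by the image under $\mu_{\mathcal{D}}-\mathrm{Id}$ of the genus $0$ connected graphs with two vertices decorated by $\mathcal{D}$. A functor is called exact if the image of a quasi-isomorphism is a quasi-isomorphism. *)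

theory Defs
  imports
    Complex_Main
    "HOL-Algebra.AbelCoset"
    "HOL-Algebra.Module"
    "HOL-Combinatorics.Permutations"
    "HOL-Library.Poly_Mapping"
begin

section \<open>Differential graded S-bimodules\<close>

text \<open>
  The ground field is the type \<open>'k :: field_char_0\<close>; \<open>scalars\<close> is this field as a ring record.
  An S-bimodule is given by an ambient vector space together with subspaces \<open>part P m n d\<close>, the
  elements of homological degree \<open>d\<close> with \<open>m\<close> outputs and \<open>n\<close> inputs.  Only these subspaces
  matter.  (The fields \<open>mult\<close> and \<open>one\<close> inherited from the library's module records play no role.)
\<close>

definition scalars :: "'k::field ring" where
  "scalars = \<lparr>carrier = UNIV, monoid.mult = (*), one = 1, zero = 0, add = (+)\<rparr>"

record ('k, 'a) sbimod = "('k, 'a) module" +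
  part :: "nat \<Rightarrow> nat \<Rightarrow> int \<Rightarrow> 'a set"
  diff :: "'a \<Rightarrow> 'a"
  lact :: "(nat \<Rightarrow> nat) \<Rightarrow> 'a \<Rightarrow> 'a"
  ract :: "'a \<Rightarrow> (nat \<Rightarrow> nat) \<Rightarrow> 'a"

definition linear_on_part ::
  "('k::field, 'a, 'm) sbimod_scheme \<Rightarrow> ('k, 'b, 'n) sbimod_scheme \<Rightarrow> ('a \<Rightarrow> 'b) \<Rightarrow> 'a set \<Rightarrow> bool" where
  "linear_on_part P Q f V \<longleftrightarrow>
     (\<forall>x\<in>V. \<forall>y\<in>V. f (x \<oplus>\<^bsub>P\<^esub> y) = f x \<oplus>\<^bsub>Q\<^esub> f y) \<and>
     (\<forall>c. \<forall>x\<in>V. f (c \<odot>\<^bsub>P\<^esub> x) = c \<odot>\<^bsub>Q\<^esub> f x)"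

definition dg_sbimodule :: "('k::field, 'a, 'm) sbimod_scheme \<Rightarrow> bool" where
  "dg_sbimodule P \<longleftrightarrow>
     Module.module scalars P \<and>
     (\<forall>m n d. submodule (part P m n d) scalars P) \<and>
     (\<forall>m n d. linear_on_part P P (diff P) (part P m n d) \<and>
        diff P ` part P m n d \<subseteq> part P m n (d - 1) \<and>
        (\<forall>x\<in>part P m n d. diff P (diff P x) = \<zero>\<^bsub>P\<^esub>)) \<and>
     (\<forall>m n d \<sigma>. \<sigma> permutes {..<m} \<longrightarrow>
        linear_on_part P P (lact P \<sigma>) (part P m n d) \<and>
        lact P \<sigma> ` part P m n d \<subseteq> part P m n d \<and>
        (\<forall>x\<in>part P m n d. diff P (lact P \<sigma> x) = lact P \<sigma> (diff P x))) \<and>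
     (\<forall>m n d \<tau>. \<tau> permutes {..<n} \<longrightarrow>
        linear_on_part P P (\<lambda>x. ract P x \<tau>) (part P m n d) \<and>
        (\<lambda>x. ract P x \<tau>) ` part P m n d \<subseteq> part P m n d \<and>
        (\<forall>x\<in>part P m n d. diff P (ract P x \<tau>) = ract P (diff P x) \<tau>)) \<and>
     (\<forall>m n d. \<forall>x\<in>part P m n d.
        lact P id x = x \<and> ract P x id = x \<and>
        (\<forall>\<sigma> \<sigma>'. \<sigma> permutes {..<m} \<longrightarrow> \<sigma>' permutes {..<m} \<longrightarrow>
           lact P (\<sigma> \<circ> \<sigma>') x = lact P \<sigma> (lact P \<sigma>' x)) \<and>
        (\<forall>\<tau> \<tau>'. \<tau> permutes {..<n} \<longrightarrow> \<tau>' permutes {..<n} \<longrightarrow>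
           ract P x (\<tau> \<circ> \<tau>') = ract P (ract P x \<tau>) \<tau>') \<and>
        (\<forall>\<sigma> \<tau>. \<sigma> permutes {..<m} \<longrightarrow> \<tau> permutes {..<n} \<longrightarrow>
           ract P (lact P \<sigma> x) \<tau> = lact P \<sigma> (ract P x \<tau>)))"

definition sbimod_hom ::
  "('k::field, 'a, 'm) sbimod_scheme \<Rightarrow> ('k, 'b, 'n) sbimod_scheme \<Rightarrow> ('a \<Rightarrow> 'b) \<Rightarrow> bool" where
  "sbimod_hom P Q f \<longleftrightarrow>
     (\<forall>m n d. f ` part P m n d \<subseteq> part Q m n d \<and> linear_on_part P Q f (part P m n d) \<and>
        (\<forall>x\<in>part P m n d.
           f (diff P x) = diff Q (f x) \<and>
           (\<forall>\<sigma>. \<sigma> permutes {..<m} \<longrightarrow> f (lact P \<sigma> x) = lact Q \<sigma> (f x)) \<and>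
           (\<forall>\<tau>. \<tau> permutes {..<n} \<longrightarrow> f (ract P x \<tau>) = ract Q (f x) \<tau>)))"


subsection \<open>Quotients, homology, quasi-isomorphisms\<close>

text \<open>
  If \<open>f\<close> is linear and maps the subspace \<open>M\<close> into \<open>N\<close>, then \<open>coset_map Q N f\<close> is the induced
  map: it sends the coset of \<open>x\<close> modulo \<open>M\<close> to the coset of \<open>f x\<close> modulo \<open>N\<close>.
\<close>

definition coset_map ::
  "('k, 'b, 'n) module_scheme \<Rightarrow> 'b set \<Rightarrow> ('a \<Rightarrow> 'b) \<Rightarrow> 'a set \<Rightarrow> 'b set" where
  "coset_map Q N f X = N <+>\<^bsub>Q\<^esub> (f ` X)"

definition quot_sbimod :: "('k, 'a, 'm) sbimod_scheme \<Rightarrow> 'a set \<Rightarrow> ('k, 'a set) sbimod" where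
  "quot_sbimod P N =
     \<lparr>carrier = a_rcosets\<^bsub>P\<^esub> N, monoid.mult = undefined, one = undefined,
      zero = N, add = (<+>\<^bsub>P\<^esub>),
      smult = (\<lambda>c. coset_map P N (\<lambda>x. c \<odot>\<^bsub>P\<^esub> x)),
      part = (\<lambda>m n d. (\<lambda>x. N +>\<^bsub>P\<^esub> x) ` part P m n d),
      diff = coset_map P N (diff P),
      lact = (\<lambda>\<sigma>. coset_map P N (lact P \<sigma>)),
      ract = (\<lambda>X \<tau>. coset_map P N (\<lambda>x. ract P x \<tau>) X)\<rparr>"

definition cycles :: "('k, 'a, 'm) sbimod_scheme \<Rightarrow> nat \<Rightarrow> nat \<Rightarrow> int \<Rightarrow> 'a set" where
  "cycles P m n d = {x \<in> part P m n d. diff P x = \<zero>\<^bsub>P\<^esub>}"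

definition boundaries :: "('k, 'a, 'm) sbimod_scheme \<Rightarrow> nat \<Rightarrow> nat \<Rightarrow> int \<Rightarrow> 'a set" where
  "boundaries P m n d = diff P ` part P m n (d + 1)"

definition homology :: "('k, 'a, 'm) sbimod_scheme \<Rightarrow> nat \<Rightarrow> nat \<Rightarrow> int \<Rightarrow> 'a set set" where
  "homology P m n d = (\<lambda>x. boundaries P m n d +>\<^bsub>P\<^esub> x) ` cycles P m n d"

definition quasi_iso ::
  "('k, 'a, 'm) sbimod_scheme \<Rightarrow> ('k, 'b, 'n) sbimod_scheme \<Rightarrow> ('a \<Rightarrow> 'b) \<Rightarrow> bool" where
  "quasi_iso P Q f \<longleftrightarrow>
     (\<forall>m n d. bij_betw (coset_map Q (boundaries Q m n d) f) (homology P m n d) (homology Q m n d))"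


section \<open>Decorated directed graphs\<close>

text \<open>
  The edges and legs of a graph are wires named by natural numbers.  A vertex lists the wires
  at its output slots and at its input slots, together with its decoration, the degree of the
  decoration and the level of the vertex (0 if the graph carries no levels).  A graph lists the
  wires at its global outputs and inputs, i.e. legs are labelled by their positions.  The order of
  the list of vertices is the order of the factors in the tensor product of the decorations.  The graph
  without vertices whose only wire is both input and output is the trivial graph.
\<close>

datatype 'a vert =
  Vert (elt: 'a) (vdeg: int) (level: nat) (outs: "nat list") (ins: "nat list")

datatype 'a dgraph =
  DGraph (gouts: "nat list") (verts: "'a vert list") (gins: "nat list")

definition gdeg :: "'a dgraph \<Rightarrow> int" where
  "gdeg G = sum_list (map vdeg (verts G))"

primrec rename_vert :: "(nat \<Rightarrow> nat) \<Rightarrow> 'a vert \<Rightarrow> 'a vert" where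
  "rename_vert f (Vert x d l os is) = Vert x d l (map f os) (map f is)"

primrec rename_wires :: "(nat \<Rightarrow> nat) \<Rightarrow> 'a dgraph \<Rightarrow> 'a dgraph" where
  "rename_wires f (DGraph os vs is) = DGraph (map f os) (map (rename_vert f) vs) (map f is)"

primrec set_level :: "nat \<Rightarrow> 'a vert \<Rightarrow> 'a vert" where
  "set_level l' (Vert x d l os is) = Vert x d l' os is"

text \<open>Every wire has exactly one source and exactly one target.\<close>

definition wired :: "'a dgraph \<Rightarrow> bool" where
  "wired G \<longleftrightarrow>
     distinct (gins G @ concat (map outs (verts G))) \<and>
     distinct (gouts G @ concat (map ins (verts G))) \<and>
     set (gins G @ concat (map outs (verts G))) = set (gouts G @ concat (map ins (verts G)))"

definition arrows :: "'a dgraph \<Rightarrow> (nat \<times> nat) set" where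
  "arrows G = {(i, j). i < length (verts G) \<and> j < length (verts G) \<and>
     set (outs (verts G ! i)) \<inter> set (ins (verts G ! j)) \<noteq> {}}"

text \<open>
  A connected graph with at least one vertex has no wire running directly from a global input to
  a global output.
\<close>

definition connected_graph :: "'a dgraph \<Rightarrow> bool" where
  "connected_graph G \<longleftrightarrow>
     (if verts G = [] then length (gins G) = 1
      else set (gins G) \<inter> set (gouts G) = {} \<and>
           (\<forall>i<length (verts G). \<forall>j<length (verts G). (i, j) \<in> (arrows G \<union> (arrows G)\<inverse>)\<^sup>*))"

definition inner_wires :: "'a dgraph \<Rightarrow> nat set" where
  "inner_wires G = (\<Union>v\<in>set (verts G). set (outs v)) \<inter> (\<Union>v\<in>set (verts G). set (ins v))"

text \<open>The first Betti number of a connected graph; the trivial graph is contractible.\<close>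

definition genus :: "'a dgraph \<Rightarrow> int" where
  "genus G = (if verts G = [] then 0
              else int (card (inner_wires G)) - int (length (verts G)) + 1)"

text \<open>
  2-levelled graphs: every global input enters level 1, every output of level 1 enters level 2
  (by \<open>wired\<close>), and every output of level 2 is a global output.
\<close>

definition two_levelled :: "'a dgraph \<Rightarrow> bool" where
  "two_levelled G \<longleftrightarrow>
     (\<forall>v\<in>set (verts G). level v = 1 \<or> level v = 2) \<and>
     set (gins G) = (\<Union>v\<in>{v \<in> set (verts G). level v = 1}. set (ins v)) \<and>
     set (gouts G) = (\<Union>v\<in>{v \<in> set (verts G). level v = 2}. set (outs v))"

definition conn2 :: "'a dgraph \<Rightarrow> bool" where
  "conn2 G \<longleftrightarrow> two_levelled G \<and> connected_graph G"

definition tree2 :: "'a dgraph \<Rightarrow> bool" where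
  "tree2 G \<longleftrightarrow> two_levelled G \<and> connected_graph G \<and> genus G = 0"

definition flow :: "'a dgraph \<Rightarrow> bool" where
  "flow G \<longleftrightarrow> (\<forall>v\<in>set (verts G). level v = 0) \<and> connected_graph G \<and> acyclic (arrows G)"

text \<open>Graphs of shape \<open>S\<close> whose vertices of level \<open>l\<close> are decorated by the S-bimodule \<open>B l\<close>.\<close>

definition graphs ::
  "(nat \<Rightarrow> ('k, 'a, 'm) sbimod_scheme) \<Rightarrow> ('a dgraph \<Rightarrow> bool) \<Rightarrow> 'a dgraph set" where
  "graphs B S = {G. wired G \<and> S G \<and>
     (\<forall>v\<in>set (verts G). elt v \<in> part (B (level v)) (length (outs v)) (length (ins v)) (vdeg v))}"


section \<open>The S-bimodule spanned by decorated graphs\<close>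

definition fscale :: "'k \<Rightarrow> ('g \<Rightarrow>\<^sub>0 'k) \<Rightarrow> ('g \<Rightarrow>\<^sub>0 'k::field)" where
  "fscale c = Poly_Mapping.map ((*) c)"

interpretation formal: vector_space "fscale :: 'k::field \<Rightarrow> ('g \<Rightarrow>\<^sub>0 'k) \<Rightarrow> ('g \<Rightarrow>\<^sub>0 'k)"
proof
  have lk: "Poly_Mapping.lookup (fscale c x) g = c * Poly_Mapping.lookup x g"
    for c :: 'k and x :: "'g \<Rightarrow>\<^sub>0 'k" and g
    by (simp add: fscale_def Poly_Mapping.map.rep_eq when_def)
  fix a b :: 'k and x y :: "'g \<Rightarrow>\<^sub>0 'k"
  show "fscale a (x + y) = fscale a x + fscale a y"
    by (rule poly_mapping_eqI) (simp add: lk lookup_add algebra_simps)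
  show "fscale (a + b) x = fscale a x + fscale b x"
    by (rule poly_mapping_eqI) (simp add: lk lookup_add algebra_simps)
  show "fscale a (fscale b x) = fscale (a * b) x"
    by (rule poly_mapping_eqI) (simp add: lk)
  show "fscale 1 x = x"
    by (rule poly_mapping_eqI) (simp add: lk)
qed

abbreviation gen :: "'g \<Rightarrow> ('g \<Rightarrow>\<^sub>0 'k::field)" where
  "gen G \<equiv> Poly_Mapping.single G 1"

definition lin_ext :: "('g \<Rightarrow> 'h \<Rightarrow>\<^sub>0 'k) \<Rightarrow> ('g \<Rightarrow>\<^sub>0 'k) \<Rightarrow> ('h \<Rightarrow>\<^sub>0 'k::field)" where
  "lin_ext f x = (\<Sum>g\<in>Poly_Mapping.keys x. fscale (Poly_Mapping.lookup x g) (f g))"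

definition sgn_deg :: "int \<Rightarrow> 'k::field" where
  "sgn_deg d = (if even d then 1 else -1)"

definition graph_diff ::
  "(nat \<Rightarrow> ('k::field, 'a, 'm) sbimod_scheme) \<Rightarrow> 'a dgraph \<Rightarrow> ('a dgraph \<Rightarrow>\<^sub>0 'k)" where
  "graph_diff B G =
     (\<Sum>i<length (verts G).
        fscale (sgn_deg (sum_list (map vdeg (take i (verts G)))))
          (gen (DGraph (gouts G)
             ((verts G)[i := (case verts G ! i of Vert x d l os is \<Rightarrow>
                                 Vert (diff (B l) x) (d - 1) l os is)])
             (gins G))))"

text \<open>
  Slot \<open>\<sigma> i\<close> of \<open>\<sigma> \<cdot> G\<close> is output slot \<open>i\<close> of \<open>G\<close>, and input slot \<open>i\<close> of \<open>G \<cdot> \<tau>\<close>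
  is input slot \<open>\<tau> i\<close> of \<open>G\<close>.  A permutation which is not one of the slots of \<open>G\<close> acts trivially, so that
  the action is defined on formal sums of graphs of different arities.
\<close>

definition graph_lact :: "(nat \<Rightarrow> nat) \<Rightarrow> 'a dgraph \<Rightarrow> 'a dgraph" where
  "graph_lact \<sigma> G = (if \<sigma> permutes {..<length (gouts G)}
     then DGraph (permute_list (inv_into UNIV \<sigma>) (gouts G)) (verts G) (gins G) else G)"

definition graph_ract :: "'a dgraph \<Rightarrow> (nat \<Rightarrow> nat) \<Rightarrow> 'a dgraph" where
  "graph_ract G \<tau> = (if \<tau> permutes {..<length (gins G)}
     then DGraph (gouts G) (verts G) (permute_list \<tau> (gins G)) else G)"

text \<open>
  The free vector space on decorated graphs.  It is only a stage on the way to its quotient below: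
  the square of \<open>diff\<close> vanishes only modulo linearity in the decorations.
\<close>

definition graph_span ::
  "(nat \<Rightarrow> ('k::field, 'a, 'm) sbimod_scheme) \<Rightarrow> ('a dgraph \<Rightarrow> bool) \<Rightarrow> ('k, 'a dgraph \<Rightarrow>\<^sub>0 'k) sbimod" where
  "graph_span B S =
     \<lparr>carrier = formal.span (gen ` graphs B S), monoid.mult = undefined, one = undefined,
      zero = 0, add = (+), smult = fscale,
      part = (\<lambda>m n d. formal.span (gen `
        {G \<in> graphs B S. length (gouts G) = m \<and> length (gins G) = n \<and> gdeg G = d})),
      diff = lin_ext (graph_diff B),
      lact = (\<lambda>\<sigma>. lin_ext (\<lambda>G. gen (graph_lact \<sigma> G))),
      ract = (\<lambda>x \<tau>. lin_ext (\<lambda>G. gen (graph_ract G \<tau>)) x)\<rparr>"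

text \<open>
  Defining relations: multilinearity in the decorations, equivariance at each vertex, graph
  isomorphisms (renaming of wires and Koszul-signed reordering of vertices).
\<close>

inductive_set graph_rels ::
  "(nat \<Rightarrow> ('k::field, 'a, 'm) sbimod_scheme) \<Rightarrow> ('a dgraph \<Rightarrow> bool) \<Rightarrow> ('a dgraph \<Rightarrow>\<^sub>0 'k) set"
  for B :: "nat \<Rightarrow> ('k::field, 'a, 'm) sbimod_scheme" and S :: "'a dgraph \<Rightarrow> bool" where
  add: "DGraph gos (vs @ Vert x d l os is # ws) gis \<in> graphs B S \<Longrightarrow>
        DGraph gos (vs @ Vert y d l os is # ws) gis \<in> graphs B S \<Longrightarrow>
        gen (DGraph gos (vs @ Vert (x \<oplus>\<^bsub>B l\<^esub> y) d l os is # ws) gis)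
        - gen (DGraph gos (vs @ Vert x d l os is # ws) gis)
        - gen (DGraph gos (vs @ Vert y d l os is # ws) gis) \<in> graph_rels B S"
| smult: "DGraph gos (vs @ Vert x d l os is # ws) gis \<in> graphs B S \<Longrightarrow>
        gen (DGraph gos (vs @ Vert (c \<odot>\<^bsub>B l\<^esub> x) d l os is # ws) gis)
        - fscale c (gen (DGraph gos (vs @ Vert x d l os is # ws) gis)) \<in> graph_rels B S"
| lact: "DGraph gos (vs @ Vert x d l os is # ws) gis \<in> graphs B S \<Longrightarrow>
        \<sigma> permutes {..<length os} \<Longrightarrow>
        gen (DGraph gos (vs @ Vert (lact (B l) \<sigma> x) d l os is # ws) gis)
        - gen (DGraph gos (vs @ Vert x d l (permute_list \<sigma> os) is # ws) gis) \<in> graph_rels B S"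
| ract: "DGraph gos (vs @ Vert x d l os is # ws) gis \<in> graphs B S \<Longrightarrow>
        \<tau> permutes {..<length is} \<Longrightarrow>
        gen (DGraph gos (vs @ Vert (ract (B l) x \<tau>) d l os (permute_list \<tau> is) # ws) gis)
        - gen (DGraph gos (vs @ Vert x d l os is # ws) gis) \<in> graph_rels B S"
| rename: "G \<in> graphs B S \<Longrightarrow> inj f \<Longrightarrow>
        gen (rename_wires f G) - gen G \<in> graph_rels B S"
| swap: "DGraph gos (vs @ v # w # ws) gis \<in> graphs B S \<Longrightarrow>
        gen (DGraph gos (vs @ v # w # ws) gis)
        - fscale (sgn_deg (vdeg v * vdeg w)) (gen (DGraph gos (vs @ w # v # ws) gis))
        \<in> graph_rels B S"

definition graph_null ::
  "(nat \<Rightarrow> ('k::field, 'a, 'm) sbimod_scheme) \<Rightarrow> ('a dgraph \<Rightarrow> bool) \<Rightarrow> ('a dgraph \<Rightarrow>\<^sub>0 'k) set" where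
  "graph_null B S = formal.span (graph_rels B S)"

definition graph_sbimod ::
  "(nat \<Rightarrow> ('k::field, 'a, 'm) sbimod_scheme) \<Rightarrow> ('a dgraph \<Rightarrow> bool) \<Rightarrow> ('k, ('a dgraph \<Rightarrow>\<^sub>0 'k) set) sbimod" where
  "graph_sbimod B S = quot_sbimod (graph_span B S) (graph_null B S)"

definition graph_class ::
  "(nat \<Rightarrow> ('k::field, 'a, 'm) sbimod_scheme) \<Rightarrow> ('a dgraph \<Rightarrow> bool) \<Rightarrow>
   ('a dgraph \<Rightarrow>\<^sub>0 'k) \<Rightarrow> ('a dgraph \<Rightarrow>\<^sub>0 'k) set" where
  "graph_class B S x = graph_null B S +>\<^bsub>graph_span B S\<^esub> x"


section \<open>Properads and dioperads\<close>

text \<open>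
  \<open>box conn2 P Q\<close> is the product of \<open>P\<close> and \<open>Q\<close> along connected 2-levelled graphs, with \<open>Q\<close> on
  level 1 and \<open>P\<close> on level 2; \<open>box tree2 P Q\<close> is its genus 0 restriction.
\<close>

definition box ::
  "('a dgraph \<Rightarrow> bool) \<Rightarrow> ('k::field, 'a, 'm) sbimod_scheme \<Rightarrow> ('k, 'a, 'm) sbimod_scheme \<Rightarrow>
   ('k, ('a dgraph \<Rightarrow>\<^sub>0 'k) set) sbimod" where
  "box S P Q = graph_sbimod (\<lambda>l. if l = 1 then Q else P) S"

text \<open>
  Properads and dioperads have the same data: an S-bimodule, a composition, given by its values
  on decorated 2-levelled graphs, and a unit.  The forgetful functor from properads to dioperads
  is the identity on records, since \<open>dioperad\<close> looks at the composition along genus 0 graphs only.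
\<close>

record ('k, 'a) properad = "('k, 'a) sbimod" +
  compose :: "'a dgraph \<Rightarrow> 'a"
  ident :: 'a

text \<open>\<open>reorder vs c ws\<close>: reordering the tensor factors \<open>vs\<close> into \<open>ws\<close> has Koszul sign \<open>c\<close>.\<close>

inductive reorder :: "'a vert list \<Rightarrow> 'k::field \<Rightarrow> 'a vert list \<Rightarrow> bool" where
  refl: "reorder vs 1 vs"
| swap: "reorder us c (vs @ v # w # ws) \<Longrightarrow>
         reorder us (c * sgn_deg (vdeg v * vdeg w)) (vs @ w # v # ws)"

definition composite_vert :: "('k, 'a, 'm) properad_scheme \<Rightarrow> nat \<Rightarrow> 'a dgraph \<Rightarrow> 'a vert" where
  "composite_vert P l G = Vert (compose P G) (gdeg G) l (gouts G) (gins G)"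

abbreviation raise :: "'a vert \<Rightarrow> 'a vert" where
  "raise v \<equiv> set_level (Suc (level v)) v"

text \<open>
  Monoids for the product \<open>box S\<close>.  The composition is induced by a morphism of dg S-bimodules
  from \<open>box S P P\<close> to \<open>P\<close>.  Associativity compares the two ways of composing a 3-levelled graph:
  either levels 1 and 2 form the connected graphs \<open>Gs\<close>, whose composites are composed with \<open>ws\<close> on
  level 3, or levels 2 and 3 form \<open>Hs\<close>, whose composites are composed with \<open>us\<close> on level 1.
\<close>

definition graph_monoid ::
  "('a dgraph \<Rightarrow> bool) \<Rightarrow> ('k::field, 'a, 'm) properad_scheme \<Rightarrow> bool" where
  "graph_monoid S P \<longleftrightarrow>
     dg_sbimodule P \<and>
     ident P \<in> part P 1 1 0 \<and> diff P (ident P) = \<zero>\<^bsub>P\<^esub> \<and>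
     (\<exists>h. sbimod_hom (box S P P) P h \<and>
        (\<forall>G\<in>graphs (\<lambda>_. P) S. h (graph_class (\<lambda>_. P) S (gen G)) = compose P G)) \<and>
     (\<forall>p d os ws is. let G = DGraph os (Vert p d 1 ws is #
            map2 (\<lambda>out w. Vert (ident P) 0 2 [out] [w]) os ws) is in
        length os = length ws \<and> wired G \<and> p \<in> part P (length ws) (length is) d \<longrightarrow>
        compose P G = p) \<and>
     (\<forall>p d os ws is. let G = DGraph os (Vert p d 2 os ws #
            map2 (\<lambda>w inp. Vert (ident P) 0 1 [w] [inp]) ws is) is in
        length ws = length is \<and> wired G \<and> p \<in> part P (length os) (length ws) d \<longrightarrow>
        compose P G = p) \<and>
     (\<forall>os is ws us Gs Hs c.
        let G = DGraph os (ws @ map (composite_vert P 1) Gs) is;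
            H = DGraph os (map (composite_vert P 2) Hs @ us) is;
            flat = map raise ws @ concat (map verts Gs)
        in (\<forall>v\<in>set ws. level v = 2) \<and> (\<forall>v\<in>set us. level v = 1) \<and>
           set Gs \<subseteq> graphs (\<lambda>_. P) S \<and> set Hs \<subseteq> graphs (\<lambda>_. P) S \<and>
           G \<in> graphs (\<lambda>_. P) S \<and> H \<in> graphs (\<lambda>_. P) S \<and>
           wired (DGraph os flat is) \<and>
           reorder flat c (concat (map (\<lambda>K. map raise (verts K)) Hs) @ us) \<longrightarrow>
           compose P G = c \<odot>\<^bsub>P\<^esub> compose P H)"

definition properad :: "('k::field, 'a, 'm) properad_scheme \<Rightarrow> bool" where
  "properad P \<longleftrightarrow> graph_monoid conn2 P"

definition dioperad :: "('k::field, 'a, 'm) properad_scheme \<Rightarrow> bool" where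
  "dioperad D \<longleftrightarrow> graph_monoid tree2 D"

definition dioperad_hom ::
  "('k::field, 'a, 'm) properad_scheme \<Rightarrow> ('k, 'b, 'n) properad_scheme \<Rightarrow> ('a \<Rightarrow> 'b) \<Rightarrow> bool" where
  "dioperad_hom D E f \<longleftrightarrow>
     sbimod_hom D E f \<and> f (ident D) = ident E \<and>
     (\<forall>G\<in>graphs (\<lambda>_. D) tree2. f (compose D G) = compose E (map_dgraph f G))"


section \<open>The free properad\<close>

text \<open>
  \<open>G'\<close> is the result of substituting the graphs \<open>Gs\<close> for the vertices of \<open>G\<close>: the legs of the
  \<open>i\<close>-th graph are glued to the wires at the \<open>i\<close>-th vertex.  A trivial graph merges the two
  wires at its vertex, hence the renaming \<open>\<phi>\<close> of the wires of \<open>G\<close>, which need not be injective.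
  Since \<open>G'\<close> is required to be wired, no other identifications can occur, so \<open>G'\<close> is unique
  up to renaming of wires.
\<close>

definition substitutes :: "'b dgraph \<Rightarrow> 'a dgraph list \<Rightarrow> 'a dgraph \<Rightarrow> bool" where
  "substitutes G Gs G' \<longleftrightarrow>
     length Gs = length (verts G) \<and> wired G' \<and>
     (\<exists>\<phi> \<psi>.
        (\<forall>i<length Gs.
           map \<phi> (outs (verts G ! i)) = map (\<psi> i) (gouts (Gs ! i)) \<and>
           map \<phi> (ins (verts G ! i)) = map (\<psi> i) (gins (Gs ! i))) \<and>
        G' = DGraph (map \<phi> (gouts G))
               (concat (map (\<lambda>i. map (rename_vert (\<psi> i)) (verts (Gs ! i))) [0..<length Gs]))
               (map \<phi> (gins G)))"

definition substitution :: "'b dgraph \<Rightarrow> 'a dgraph list \<Rightarrow> 'a dgraph" where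
  "substitution G Gs = (SOME G'. substitutes G Gs G')"

text \<open>A representative, in the space \<open>P\<close>, of the coset decorating a vertex.\<close>

definition rep :: "('k, 'a, 'm) sbimod_scheme \<Rightarrow> 'a set vert \<Rightarrow> 'a" where
  "rep P v = (SOME x. x \<in> elt v \<and> x \<in> part P (length (outs v)) (length (ins v)) (vdeg v))"

abbreviation flow_class ::
  "('k::field, 'a, 'm) sbimod_scheme \<Rightarrow> ('a dgraph \<Rightarrow>\<^sub>0 'k) \<Rightarrow> ('a dgraph \<Rightarrow>\<^sub>0 'k) set" where
  "flow_class P \<equiv> graph_class (\<lambda>_. P) flow"

text \<open>
  Composition in the free properad is the multilinear extension of substitution of graphs.
\<close>

definition free_compose ::
  "('k::field, 'a, 'm) sbimod_scheme \<Rightarrow> ('a dgraph \<Rightarrow>\<^sub>0 'k) set dgraph \<Rightarrow> ('a dgraph \<Rightarrow>\<^sub>0 'k) set" where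
  "free_compose P G =
     (let xs = map (rep (graph_span (\<lambda>_. P) flow)) (verts G) in
      flow_class P
        (\<Sum>Gs\<in>listset (map Poly_Mapping.keys xs).
           fscale (prod_list (map2 Poly_Mapping.lookup xs Gs)) (gen (substitution G Gs))))"

definition free_properad ::
  "('k::field, 'a, 'm) sbimod_scheme \<Rightarrow> ('k, ('a dgraph \<Rightarrow>\<^sub>0 'k) set) properad" where
  "free_properad P =
     sbimod.extend (graph_sbimod (\<lambda>_. P) flow)
       \<lparr>compose = free_compose P, ident = flow_class P (gen (DGraph [0] [] [0]))\<rparr>"


section \<open>The universal enveloping properad of a dioperad\<close>

text \<open>
  The properadic ideal generated by a set of homogeneous elements, as the sum of all its arity
  and degree components.
\<close>

inductive_set properadic_ideal ::
  "('k::field, 'a, 'm) properad_scheme \<Rightarrow> 'a set \<Rightarrow> 'a set"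
  for P :: "('k::field, 'a, 'm) properad_scheme" and X :: "'a set" where
  zero: "\<zero>\<^bsub>P\<^esub> \<in> properadic_ideal P X"
| base: "x \<in> X \<Longrightarrow> x \<in> properadic_ideal P X"
| add: "x \<in> properadic_ideal P X \<Longrightarrow> y \<in> properadic_ideal P X \<Longrightarrow>
        x \<oplus>\<^bsub>P\<^esub> y \<in> properadic_ideal P X"
| smult: "x \<in> properadic_ideal P X \<Longrightarrow> c \<odot>\<^bsub>P\<^esub> x \<in> properadic_ideal P X"
| lact: "x \<in> properadic_ideal P X \<Longrightarrow> x \<in> part P m n d \<Longrightarrow> \<sigma> permutes {..<m} \<Longrightarrow>
        lact P \<sigma> x \<in> properadic_ideal P X"
| ract: "x \<in> properadic_ideal P X \<Longrightarrow> x \<in> part P m n d \<Longrightarrow> \<tau> permutes {..<n} \<Longrightarrow>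
        ract P x \<tau> \<in> properadic_ideal P X"
| compose: "G \<in> graphs (\<lambda>_. P) conn2 \<Longrightarrow> v \<in> set (verts G) \<Longrightarrow>
        elt v \<in> properadic_ideal P X \<Longrightarrow> compose P G \<in> properadic_ideal P X"

definition quot_properad ::
  "('k::field, 'a, 'm) properad_scheme \<Rightarrow> 'a set \<Rightarrow> ('k, 'a set) properad" where
  "quot_properad P N =
     sbimod.extend (quot_sbimod P N)
       \<lparr>compose = (\<lambda>G. N +>\<^bsub>P\<^esub> compose P
          (DGraph (gouts G)
             (map (\<lambda>v. Vert (rep P v) (vdeg v) (level v) (outs v) (ins v)) (verts G)) (gins G))),
        ident = N +>\<^bsub>P\<^esub> ident P\<rparr>"

definition corolla :: "'a \<Rightarrow> int \<Rightarrow> nat \<Rightarrow> nat \<Rightarrow> 'a dgraph" where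
  "corolla x d m n = DGraph [0..<m] [Vert x d 0 [0..<m] [m..<m + n]] [m..<m + n]"

definition forget_levels :: "'a dgraph \<Rightarrow> 'a dgraph" where
  "forget_levels G = DGraph (gouts G) (map (set_level 0) (verts G)) (gins G)"

text \<open>
  The generators identify a genus 0 graph with two vertices with its composite in \<open>D\<close>.  As a
  2-levelled graph, such a graph is completed by further vertices decorated by the unit of \<open>D\<close>.
  These may be erased because the unit of \<open>D\<close> is identified with the trivial graph, the unit of the
  free properad.  The ideal is stable under the differential, since composition in \<open>D\<close> is a chain map.
\<close>

definition enveloping_relations ::
  "('k::field, 'a, 'm) properad_scheme \<Rightarrow> ('a dgraph \<Rightarrow>\<^sub>0 'k) set set" where
  "enveloping_relations D =
     insert (flow_class D (gen (corolla (ident D) 0 1 1) - gen (DGraph [0] [] [0])))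
       {flow_class D
          (gen (corolla (compose D G) (gdeg G) (length (gouts G)) (length (gins G)))
           - gen (forget_levels G)) | G.
        G \<in> graphs (\<lambda>_. D) tree2 \<and>
        (\<exists>v w vs. verts G = v # w # vs \<and> (\<forall>u\<in>set vs. elt u = ident D \<and> vdeg u = 0))}"

definition enveloping_ideal ::
  "('k::field, 'a, 'm) properad_scheme \<Rightarrow> ('a dgraph \<Rightarrow>\<^sub>0 'k) set set" where
  "enveloping_ideal D = properadic_ideal (free_properad D) (enveloping_relations D)"

definition enveloping ::
  "('k::field, 'a, 'm) properad_scheme \<Rightarrow> ('k, ('a dgraph \<Rightarrow>\<^sub>0 'k) set set) properad" where
  "enveloping D = quot_properad (free_properad D) (enveloping_ideal D)"

text \<open>The value of the functor on morphisms: apply the morphism to all decorations.\<close>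

definition enveloping_map ::
  "('k::field, 'b, 'n) properad_scheme \<Rightarrow> ('a \<Rightarrow> 'b) \<Rightarrow>
   ('a dgraph \<Rightarrow>\<^sub>0 'k) set set \<Rightarrow> ('b dgraph \<Rightarrow>\<^sub>0 'k) set set" where
  "enveloping_map E f =
     coset_map (free_properad E) (enveloping_ideal E)
       (coset_map (graph_span (\<lambda>_. E) flow) (graph_null (\<lambda>_. E) flow)
          (lin_ext (\<lambda>G. gen (map_dgraph f G))))"

end

(*
A dioperad only sees genus 0 compositions, so its enveloping properad contains, along two parallel
edges, a tensor product that is computed underived; such tensor products do not preserve
quasi-isomorphisms.  Take operations b of arity (1,1), m of arity (2,0) and n of arity (0,2), in
even degrees, all of whose compositions other than those with the unit vanish, and add to them
operations q, r of arity (2,0) with dq = r and b q = m.  The inclusion of the small dioperad into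
the large one is a quasi-isomorphism.  Joining m to n by two edges gives a genus 1 element; it
vanishes for the large dioperad, since it equals q followed by b and n, and b kills n.  It does
not vanish for the small one: a linear functional detects it.  The degrees are chosen such that a
composite of basis elements is nonzero if and only if its arity and degree are those of a basis
element.  So compositions are products of coefficients, and associativity is a count of vertices.
*)

theory Submission
  imports Defs "HOL-Library.Set_Algebras" "HOL-Library.Nat_Bijection"
begin

text \<open>The degrees are 0 for \<open>q\<close>, -1 for \<open>r\<close>, -2 for \<open>m\<close>
  and \<open>b\<close>, and -4 for \<open>n\<close>; since \<open>b q = m\<close>, that of
  \<open>b\<close> is the difference of those of \<open>m\<close> and \<open>q\<close>. The other
  composites of two of these along one edge then miss all slots: \<open>b b\<close> and
  \<open>b m\<close> have degree -4, \<open>b r\<close> -3, \<open>n b\<close> -6, and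
  \<open>q\<close>, \<open>r\<close>, \<open>m\<close> glued to \<open>n\<close> give arity (1,1) in
  degrees -4, -5, -6. Only \<open>r\<close> is odd, and no nonzero value involves it twice, so the
  Koszul signs that matter are 1. The functional multiplies coefficients of the unit,
  \<open>m\<close> and \<open>n\<close>. It cannot vanish on the whole ideal: \<open>m\<close> glued
  to \<open>n\<close> by one edge is zero in the dioperad but has value 1. So it is restricted to
  types whose composites have no block of type (1,1,-6). \<open>free_compose\<close> and
  \<open>substitution\<close> make choices. Nonvanishing sees only arities, degrees and decorations,
  which all choices share. Vanishing needs independence of choices modulo the graph relations; this
  is shown where it is used, for gluing along two edges. The small enveloping properad has zero
  differential, so a nonzero element is a nonzero homology class.\<close>

section \<open>Formal sums\<close>

lemma lookup_fscale [simp]: "Poly_Mapping.lookup (fscale c x) g = c * Poly_Mapping.lookup x g"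
  by (simp add: fscale_def Poly_Mapping.map.rep_eq when_def)

lemma fscale_single [simp]: "fscale c (Poly_Mapping.single i a) = Poly_Mapping.single i (c * a)"
  by (rule poly_mapping_eqI) (simp add: lookup_single when_def)

lemma fscale_minus_one: "fscale (- 1) x = - x"
  by (rule poly_mapping_eqI) simp

lemma sum_keys_superset:
  assumes "finite S" "Poly_Mapping.keys x \<subseteq> S" "\<And>g. h g 0 = 0"
  shows "(\<Sum>g\<in>Poly_Mapping.keys x. h g (Poly_Mapping.lookup x g)) = (\<Sum>g\<in>S. h g (Poly_Mapping.lookup x g))"
  by (rule sum.mono_neutral_left) (use assms in \<open>auto simp: in_keys_iff\<close>)

definition lin_form :: "('g \<Rightarrow> 'k::field) \<Rightarrow> ('g \<Rightarrow>\<^sub>0 'k) \<Rightarrow> 'k" where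
  "lin_form h x = (\<Sum>g\<in>Poly_Mapping.keys x. Poly_Mapping.lookup x g * h g)"

lemma lin_form_superset:
  "finite S \<Longrightarrow> Poly_Mapping.keys x \<subseteq> S \<Longrightarrow> lin_form h x = (\<Sum>g\<in>S. Poly_Mapping.lookup x g * h g)"
  unfolding lin_form_def by (rule sum_keys_superset[where h = "\<lambda>g c. c * h g"]) auto

lemma lin_form_add: "lin_form h (x + y) = lin_form h x + lin_form h y"
proof -
  let ?S = "Poly_Mapping.keys x \<union> Poly_Mapping.keys y"
  have "lin_form h (x + y) = (\<Sum>g\<in>?S. Poly_Mapping.lookup (x + y) g * h g)"
    by (rule lin_form_superset) (auto simp: Poly_Mapping.keys_add)
  moreover have "lin_form h x = (\<Sum>g\<in>?S. Poly_Mapping.lookup x g * h g)"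
    by (rule lin_form_superset) auto
  moreover have "lin_form h y = (\<Sum>g\<in>?S. Poly_Mapping.lookup y g * h g)"
    by (rule lin_form_superset) auto
  ultimately show ?thesis
    by (simp add: lookup_add algebra_simps sum.distrib)
qed

lemma lin_form_zero [simp]: "lin_form h 0 = 0"
  by (simp add: lin_form_def)

lemma lin_form_fscale: "lin_form h (fscale c x) = c * lin_form h x"
proof -
  have "lin_form h (fscale c x) = (\<Sum>g\<in>Poly_Mapping.keys x. Poly_Mapping.lookup (fscale c x) g * h g)"
    by (rule lin_form_superset) (auto simp: in_keys_iff)
  then show ?thesis
    by (simp add: lin_form_def sum_distrib_left mult.assoc)
qed

lemma lin_form_minus: "lin_form h (- x) = - lin_form h x"
  using lin_form_fscale[of h "- 1" x] by (simp add: fscale_minus_one)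

lemma lin_form_diff: "lin_form h (x - y) = lin_form h x - lin_form h y"
  using lin_form_add[of h x "- y"] by (simp add: lin_form_minus)

lemma lin_form_single [simp]: "lin_form h (Poly_Mapping.single g c) = c * h g"
  by (simp add: lin_form_def)

lemma lin_form_sum: "lin_form h (\<Sum>i\<in>I. f i) = (\<Sum>i\<in>I. lin_form h (f i))"
  by (induction I rule: infinite_finite_induct) (auto simp: lin_form_add)

lemma lin_form_lin_ext: "lin_form h (lin_ext f x) = lin_form (\<lambda>g. lin_form h (f g)) x"
  by (simp add: lin_ext_def lin_form_sum lin_form_fscale) (simp add: lin_form_def)

lemma lookup_sum_pm: "Poly_Mapping.lookup (\<Sum>i\<in>I. f i) g = (\<Sum>i\<in>I. Poly_Mapping.lookup (f i) g)"
  by (induction I rule: infinite_finite_induct) (auto simp: lookup_add)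

lemma lookup_lin_ext: "Poly_Mapping.lookup (lin_ext f x) g = lin_form (\<lambda>i. Poly_Mapping.lookup (f i) g) x"
  by (simp add: lin_ext_def lookup_sum_pm lin_form_def)

lemma lin_ext_add: "lin_ext f (x + y) = lin_ext f x + lin_ext f y"
  by (rule poly_mapping_eqI) (simp add: lookup_lin_ext lookup_add lin_form_add)

lemma lin_ext_fscale: "lin_ext f (fscale c x) = fscale c (lin_ext f x)"
  by (rule poly_mapping_eqI) (simp add: lookup_lin_ext lin_form_fscale)

lemma lin_ext_zero [simp]: "lin_ext f 0 = 0"
  by (simp add: lin_ext_def)

lemma lin_ext_diff: "lin_ext f (x - y) = lin_ext f x - lin_ext f y"
  by (rule poly_mapping_eqI) (simp add: lookup_lin_ext lin_form_diff lookup_minus)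

lemma lin_ext_single [simp]: "lin_ext f (Poly_Mapping.single g c) = fscale c (f g)"
  by (rule poly_mapping_eqI) (simp add: lookup_lin_ext)

lemma fscale_one [simp]: "fscale 1 x = x"
  by (rule poly_mapping_eqI) simp

lemma fscale_zero [simp]: "fscale c 0 = 0"
  by (rule poly_mapping_eqI) simp

lemma fscale_zero_left [simp]: "fscale 0 x = 0"
  by (rule poly_mapping_eqI) simp

lemma lin_ext_sum: "lin_ext f (\<Sum>i\<in>I. h i) = (\<Sum>i\<in>I. lin_ext f (h i))"
  by (induction I rule: infinite_finite_induct) (auto simp: lin_ext_add)

lemma lin_ext_gen [simp]: "lin_ext (\<lambda>g. gen g) x = x"
  by (rule poly_mapping_eqI)
    (simp add: lookup_lin_ext lin_form_def lookup_single when_def in_keys_iff if_distrib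
      sum.delta' cong: if_cong)

lemma lin_ext_cong: "(\<And>g. g \<in> Poly_Mapping.keys x \<Longrightarrow> f g = f' g) \<Longrightarrow> lin_ext f x = lin_ext f' x"
  by (simp add: lin_ext_def)

lemma lin_form_cong: "(\<And>g. g \<in> Poly_Mapping.keys x \<Longrightarrow> f g = f' g) \<Longrightarrow> lin_form f x = lin_form f' x"
  by (simp add: lin_form_def)

lemma span_lin_ext_induct:
  assumes "x \<in> formal.span S" "P 0" "\<And>x y. P x \<Longrightarrow> P y \<Longrightarrow> P (x + y)"
    "\<And>c x. P x \<Longrightarrow> P (fscale c x)" "\<And>x. x \<in> S \<Longrightarrow> P x"
  shows "P x"
  using assms(1) by (rule formal.span_induct) (use assms in \<open>auto simp: formal.subspace_def\<close>)

lemma lin_ext_in_span: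
  assumes "x \<in> formal.span S" "\<And>g. g \<in> S \<Longrightarrow> lin_ext f g \<in> formal.span V"
  shows "lin_ext f x \<in> formal.span V"
  using assms(1)
  by (rule span_lin_ext_induct)
    (use assms(2) in \<open>auto simp: lin_ext_add lin_ext_fscale intro: formal.span_add formal.span_scale formal.span_zero\<close>)

lemma keys_span_gen: "x \<in> formal.span (gen ` A) \<Longrightarrow> Poly_Mapping.keys x \<subseteq> A"
proof (erule span_lin_ext_induct)
  fix x y :: "'a \<Rightarrow>\<^sub>0 'b" assume "Poly_Mapping.keys x \<subseteq> A" "Poly_Mapping.keys y \<subseteq> A"
  then show "Poly_Mapping.keys (x + y) \<subseteq> A" using Poly_Mapping.keys_add[of x y] by auto
qed (auto simp: in_keys_iff subset_iff lookup_single when_def split: if_splits)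

section \<open>Wires\<close>

text \<open>Disjointness holds because a wire has one target. Connectedness excludes wires from a
  global input straight to a global output, so every global output leaves a vertex.\<close>

lemma set_outs_inner:
  "wired G \<Longrightarrow> connected_graph G \<Longrightarrow> verts G \<noteq> [] \<Longrightarrow>
   (\<Union>v\<in>set (verts G). set (outs v)) = set (gouts G) \<union> inner_wires G \<and> set (gouts G) \<inter> inner_wires G = {}"
  by (auto simp: wired_def connected_graph_def inner_wires_def)

text \<open>Both sides count all wires, once by their sources and once by their targets.\<close>

lemma wired_length:
  assumes "wired G"
  shows "length (gins G) + sum_list (map (length \<circ> outs) (verts G)) =
    length (gouts G) + sum_list (map (length \<circ> ins) (verts G))"
proof -
  have "length (gins G @ concat (map outs (verts G))) = length (gouts G @ concat (map ins (verts G)))"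
    using assms unfolding wired_def by (metis distinct_card)
  then show ?thesis by (simp add: length_concat comp_def)
qed

text \<open>An output slot of a vertex carries a global output or an inner edge, and genus 0 means
  that there is one inner edge less than there are vertices.\<close>

lemma tree_length:
  assumes "wired G" "connected_graph G" "genus G = 0" "verts G \<noteq> []"
  shows "sum_list (map (length \<circ> outs) (verts G)) + 1 = length (gouts G) + length (verts G)"
proof -
  let ?O = "\<Union>v\<in>set (verts G). set (outs v)"
  have "sum_list (map (length \<circ> outs) (verts G)) = card (set (concat (map outs (verts G))))"
    using assms(1) by (subst distinct_card) (auto simp: wired_def length_concat comp_def)
  also have "set (concat (map outs (verts G))) = ?O" by auto
  also have "card ?O = card (set (gouts G)) + card (inner_wires G)"
    using set_outs_inner[OF assms(1,2,4)]
    by (metis card_Un_disjoint finite_UN finite_Un List.finite_set)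
  also have "card (set (gouts G)) = length (gouts G)"
    using assms(1) by (simp add: wired_def distinct_card)
  finally show ?thesis using assms(3,4) by (simp add: genus_def comp_def)
qed

section \<open>The small and the large dioperad\<close>

text \<open>
  The slot is the index of the basis vector spanning the component of the given arity and degree:
  the unit, \<open>m\<close> and \<open>n\<close> share the vector 0, \<open>q\<close> is the vector 1, and \<open>b\<close> and \<open>r\<close> share the
  vector 2.  Sharing vectors lets linear functionals on the ambient space play the role of
  functionals on all components at once.  The flag tells whether \<open>q\<close> and \<open>r\<close> are present.
\<close>

definition slot :: "bool \<Rightarrow> nat \<Rightarrow> nat \<Rightarrow> int \<Rightarrow> nat option" where
  "slot s m n d =
    (if (m, n, d) \<in> {(1, 1, 0), (2, 0, -2), (0, 2, -4)} then Some 0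
     else if (m, n, d) = (1, 1, -2) then Some 2
     else if s \<and> (m, n, d) = (2, 0, 0) then Some 1
     else if s \<and> (m, n, d) = (2, 0, -1) then Some 2 else None)"

definition slot_space :: "bool \<Rightarrow> nat \<Rightarrow> nat \<Rightarrow> int \<Rightarrow> (nat \<Rightarrow>\<^sub>0 'k::field) set" where
  "slot_space s m n d = (case slot s m n d of None \<Rightarrow> {0} | Some i \<Rightarrow> range (Poly_Mapping.single i))"

text \<open>In each component at most one coordinate can be nonzero, so the sum reads it off without
  knowing the slot, and it is linear on the whole ambient space.\<close>

definition coef :: "(nat \<Rightarrow>\<^sub>0 'k::field) \<Rightarrow> 'k" where
  "coef x = Poly_Mapping.lookup x 0 + Poly_Mapping.lookup x 1 + Poly_Mapping.lookup x 2"

definition coefs :: "(nat \<Rightarrow>\<^sub>0 'k::field) vert list \<Rightarrow> 'k" where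
  "coefs vs = prod_list (map (coef \<circ> elt) vs)"

definition slot_elt :: "bool \<Rightarrow> nat \<Rightarrow> nat \<Rightarrow> int \<Rightarrow> 'k \<Rightarrow> (nat \<Rightarrow>\<^sub>0 'k::field)" where
  "slot_elt s m n d c = (case slot s m n d of None \<Rightarrow> 0 | Some i \<Rightarrow> Poly_Mapping.single i c)"

definition model_compose :: "bool \<Rightarrow> (nat \<Rightarrow>\<^sub>0 'k::field) dgraph \<Rightarrow> (nat \<Rightarrow>\<^sub>0 'k)" where
  "model_compose s G = slot_elt s (length (gouts G)) (length (gins G)) (gdeg G) (coefs (verts G))"

text \<open>Only \<open>q\<close> involves vector 1, so this is \<open>dq = r\<close> and zero on
  all other basis elements, including \<open>b\<close>, which shares vector 2 with
  \<open>r\<close>.\<close>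

definition model_diff :: "(nat \<Rightarrow>\<^sub>0 'k::field) \<Rightarrow> (nat \<Rightarrow>\<^sub>0 'k)" where
  "model_diff x = Poly_Mapping.single 2 (Poly_Mapping.lookup x 1)"

text \<open>All permutations act trivially; this is compatible with composition because
  \<open>model_compose\<close> sees the slots only through their number.\<close>

definition model :: "bool \<Rightarrow> ('k::field, nat \<Rightarrow>\<^sub>0 'k) properad" where
  "model s = \<lparr>carrier = UNIV, monoid.mult = undefined, one = undefined, zero = 0, add = (+),
     smult = fscale, part = slot_space s, diff = model_diff, lact = (\<lambda>\<sigma> x. x), ract = (\<lambda>x \<tau>. x),
     compose = model_compose s, ident = gen 0\<rparr>"

lemma model_simps [simp]:
  "carrier (model s) = UNIV" "zero (model s) = 0" "add (model s) = (+)" "smult (model s) = fscale"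
  "part (model s) = slot_space s" "diff (model s) = model_diff" "lact (model s) \<sigma> x = x"
  "ract (model s) x \<tau> = x" "compose (model s) = model_compose s" "ident (model s) = gen 0"
  by (simp_all add: model_def)

definition decorated :: "bool \<Rightarrow> (nat \<Rightarrow>\<^sub>0 'k::field) vert \<Rightarrow> bool" where
  "decorated s v \<longleftrightarrow> elt v \<in> slot_space s (length (outs v)) (length (ins v)) (vdeg v)"

lemma graphs_model:
  "G \<in> graphs (\<lambda>_. model s) S \<longleftrightarrow> wired G \<and> S G \<and> (\<forall>v\<in>set (verts G). decorated s v)"
  by (simp add: graphs_def decorated_def)

lemma slot_le_2: "slot s m n d = Some i \<Longrightarrow> i = 0 \<or> i = 1 \<or> i = 2"
  by (auto simp: slot_def split: if_splits)

lemma coef_add: "coef (x + y) = coef x + coef y"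
  and coef_fscale: "coef (fscale c x) = c * coef x"
  and coef_zero [simp]: "coef 0 = 0"
  by (simp_all add: coef_def lookup_add algebra_simps)

lemma slot_elt_coef: "x \<in> slot_space s m n d \<Longrightarrow> slot_elt s m n d (coef x) = x"
  by (auto simp: slot_space_def slot_elt_def coef_def lookup_single split: option.splits
      dest!: slot_le_2)

lemma coef_slot_elt: "coef (slot_elt s m n d c) = (if slot s m n d = None then 0 else c)"
  by (auto simp: slot_elt_def coef_def lookup_single split: option.splits dest!: slot_le_2)

lemma slot_elt_in: "slot_elt s m n d c \<in> slot_space s m n d"
  by (auto simp: slot_space_def slot_elt_def split: option.splits)

lemma slot_elt_zero [simp]: "slot_elt s m n d 0 = 0"
  by (auto simp: slot_elt_def split: option.splits)

lemma slot_elt_add: "slot_elt s m n d (a + b) = slot_elt s m n d a + slot_elt s m n d b"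
  by (auto simp: slot_elt_def Poly_Mapping.single_add split: option.splits)

lemma slot_elt_fscale: "slot_elt s m n d (a * b) = fscale a (slot_elt s m n d b)"
  by (auto simp: slot_elt_def split: option.splits)

lemma coef_eq_0: "x \<in> slot_space s m n d \<Longrightarrow> coef x = 0 \<longleftrightarrow> x = 0"
  by (metis slot_elt_coef slot_elt_zero coef_zero)

lemma slot_space_closed:
  "0 \<in> slot_space s m n d"
  "x \<in> slot_space s m n d \<Longrightarrow> y \<in> slot_space s m n d \<Longrightarrow> x + y \<in> slot_space s m n d"
  "x \<in> slot_space s m n d \<Longrightarrow> fscale c x \<in> slot_space s m n d"
    apply (metis slot_elt_in slot_elt_zero)
   apply (metis slot_elt_in slot_elt_add slot_elt_coef)
  apply (metis slot_elt_in slot_elt_fscale slot_elt_coef)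
  done

lemma slot_eq_1: "slot s m n d = Some 1 \<longleftrightarrow> s \<and> m = 2 \<and> n = 0 \<and> d = 0"
  by (simp add: slot_def)

lemma lookup_slot_space:
  "x \<in> slot_space s m n d \<Longrightarrow> Poly_Mapping.lookup x i = (if slot s m n d = Some i then coef x else 0)"
  by (drule slot_elt_coef[symmetric], erule ssubst)
    (auto simp: slot_elt_def lookup_single coef_def when_def split: option.splits dest!: slot_le_2)

lemma model_diff_slot:
  "x \<in> slot_space s m n d \<Longrightarrow>
   model_diff x = (if s \<and> m = 2 \<and> n = 0 \<and> d = 0 then Poly_Mapping.single 2 (coef x) else 0)"
  using slot_eq_1[of s m n d] by (auto simp: model_diff_def lookup_slot_space)

lemma model_diff_in: "x \<in> slot_space s m n d \<Longrightarrow> model_diff x \<in> slot_space s m n (d - 1)"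
  by (simp add: model_diff_slot slot_space_closed(1)) (simp add: slot_space_def slot_def)

lemma model_diff_add: "model_diff (x + y) = model_diff x + model_diff y"
  and model_diff_fscale: "model_diff (fscale c x) = fscale c (model_diff x)"
  and model_diff_diff: "model_diff (model_diff x) = 0"
  and model_diff_zero [simp]: "model_diff 0 = 0"
  by (simp_all add: model_diff_def lookup_add single_add lookup_single)

section \<open>Counting vertices\<close>

text \<open>
  For a vertex decorated by a basis element, \<open>nb\<close> detects \<open>b\<close> and \<open>m = b q\<close>, \<open>nr\<close> detects \<open>r\<close>,
  \<open>nc\<close> detects \<open>n\<close>, and \<open>na\<close> detects \<open>m\<close>, \<open>q\<close> and \<open>r\<close>.
\<close>

definition nb :: "'a vert \<Rightarrow> nat" where "nb v = of_bool (vdeg v = -2)"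
definition nr :: "'a vert \<Rightarrow> nat" where "nr v = of_bool (odd (vdeg v))"
definition nc :: "'a vert \<Rightarrow> nat" where "nc v = of_bool (length (ins v) = 2)"
definition na :: "'a vert \<Rightarrow> nat" where "na v = of_bool (length (outs v) = 2)"

abbreviation total :: "('a vert \<Rightarrow> nat) \<Rightarrow> 'a vert list \<Rightarrow> nat" where
  "total f vs \<equiv> sum_list (map f vs)"

abbreviation vsdeg :: "'a vert list \<Rightarrow> int" where
  "vsdeg vs \<equiv> sum_list (map vdeg vs)"

text \<open>Additive constraints obeyed by every basis element, hence by every list of them: net
  arity, two slots per operation, degree. As to the inequalities, each \<open>r\<close> is also
  counted by \<open>na\<close>, and in the small dioperad the only operation of arity (2,0) is
  \<open>m\<close>, which \<open>nb\<close> counts as well.\<close>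

definition balanced :: "bool \<Rightarrow> nat \<Rightarrow> nat \<Rightarrow> nat \<Rightarrow> int \<Rightarrow> nat \<Rightarrow> nat \<Rightarrow> nat \<Rightarrow> nat \<Rightarrow> bool" where
  "balanced s m n k d j r c a \<longleftrightarrow>
    int m - int n = 2 * (int a - int c) \<and> m + n = 2 * k \<and>
    d = - 2 * int j - int r - 4 * int c \<and> r \<le> a \<and> (s \<or> a \<le> j)"

definition numerics :: "bool \<Rightarrow> 'a vert list \<Rightarrow> bool" where
  "numerics s vs \<longleftrightarrow>
    balanced s (total (length \<circ> outs) vs) (total (length \<circ> ins) vs) (length vs) (vsdeg vs)
      (total nb vs) (total nr vs) (total nc vs) (total na vs)"

lemma balanced_add:
  assumes "balanced s m n k d j r c a" "balanced s m' n' k' d' j' r' c' a'"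
  shows "balanced s (m + m') (n + n') (k + k') (d + d') (j + j') (r + r') (c + c') (a + a')"
  using assms unfolding balanced_def by (cases s) simp_all

lemma numerics_append: "numerics s us \<Longrightarrow> numerics s vs \<Longrightarrow> numerics s (us @ vs)"
  unfolding numerics_def map_append sum_list_append length_append by (rule balanced_add)

lemma decorated_slot: "decorated s v \<Longrightarrow> coef (elt v) \<noteq> 0 \<Longrightarrow> slot s (length (outs v)) (length (ins v)) (vdeg v) \<noteq> None"
  by (auto simp: decorated_def slot_space_def split: option.splits)

lemma numerics_single:
  assumes "decorated s v" "coef (elt v) \<noteq> 0"
  shows "numerics s [v]"
proof -
  obtain m n d where mnd: "length (outs v) = m" "length (ins v) = n" "vdeg v = d" by blast
  then have "slot s m n d \<noteq> None" using decorated_slot[OF assms] by simp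
  then have "balanced s m n 1 d (of_bool (d = -2)) (of_bool (odd d)) (of_bool (n = 2)) (of_bool (m = 2))"
    by (auto simp: slot_def balanced_def split: if_split_asm)
  then show ?thesis by (simp add: numerics_def nb_def nr_def nc_def na_def mnd)
qed

lemma coefs_simps [simp]: "coefs [] = 1" "coefs (v # vs) = coef (elt v) * coefs vs"
  "coefs (us @ vs) = coefs us * coefs vs"
  by (simp_all add: coefs_def)

lemma numerics_coefs: "\<forall>v\<in>set vs. decorated s v \<Longrightarrow> coefs vs \<noteq> 0 \<Longrightarrow> numerics s vs"
proof (induction vs)
  case Nil then show ?case by (simp add: numerics_def balanced_def)
next
  case (Cons v vs)
  then have "numerics s ([v] @ vs)" by (intro numerics_append numerics_single) auto
  then show ?case by simp
qed

text \<open>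
  The vertex counts of the trees whose composite can be nonzero.  Under the constraints on \<open>r\<close> and
  \<open>a\<close> in \<open>balanced\<close> they are closed under passing to subtrees, which yields associativity.
\<close>

definition admissible :: "bool \<Rightarrow> nat \<Rightarrow> nat \<Rightarrow> nat \<Rightarrow> nat \<Rightarrow> bool" where
  "admissible s j r c a \<longleftrightarrow>
     c = 0 \<and> a = 0 \<and> r = 0 \<and> j \<le> 1 \<or>
     c = 0 \<and> a = 1 \<and> j + r \<le> 1 \<and> (s \<or> j = 1) \<or>
     c = 1 \<and> a = 0 \<and> j = 0 \<and> r = 0"

text \<open>The arity gives \<open>a - c\<close>. In arities (1,1) and (2,0) the degree exceeds -4,
  so there is no \<open>n\<close>; in arity (0,2) one \<open>n\<close> already uses up the degree
  -4. What remains of the degree fixes the other counts.\<close>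

lemma slot_admissible:
  assumes "slot s m n d \<noteq> None" "int m - int n = 2 * (int a - int c)"
    "d = - 2 * int j - int r - 4 * int c" "r \<le> a" "s \<or> a \<le> j"
  shows "admissible s j r c a"
proof -
  have "(m = 1 \<and> n = 1 \<and> (d = 0 \<or> d = -2)) \<or> (m = 2 \<and> n = 0 \<and> (d = -2 \<or> s \<and> (d = 0 \<or> d = -1))) \<or> (m = 0 \<and> n = 2 \<and> d = -4)"
    using assms(1) by (auto simp: slot_def split: if_splits)
  then consider "m = 1" "n = 1" "d = 0 \<or> d = -2" | "m = 2" "n = 0" "d = -2 \<or> s \<and> (d = 0 \<or> d = -1)" | "m = 0" "n = 2" "d = -4"
    by blast
  then show ?thesis
  proof cases
    case 1
    then have "a = c" using assms(2) by simp
    moreover have "c = 0" using 1 assms(3) by linarith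
    ultimately show ?thesis using 1 assms(3,4) by (auto simp: admissible_def)
  next
    case 2
    then have "a = c + 1" using assms(2) by simp
    moreover have "c = 0" using 2 assms(3) by linarith
    ultimately show ?thesis using 2 assms(3,4,5) by (auto simp: admissible_def)
  next
    case 3
    then have "c = a + 1" using assms(2) by simp
    moreover from this have "a = 0" using 3 assms(3) by linarith
    ultimately show ?thesis using 3 assms(3,4,5) by (auto simp: admissible_def)
  qed
qed
text \<open>The counts alone give only the difference of outputs and inputs;
  \<open>m + n = 2\<close>, which holds for trees, pins down the arity.\<close>

lemma admissible_slot:
  assumes "admissible s j r c a" "int m - int n = 2 * (int a - int c)" "m + n = 2"
    "d = - 2 * int j - int r - 4 * int c"
  shows "slot s m n d \<noteq> None"
proof -
  have "(c = 0 \<and> a = 0 \<and> m = 1 \<and> n = 1) \<or> (c = 0 \<and> a = 1 \<and> m = 2 \<and> n = 0) \<or> (c = 1 \<and> a = 0 \<and> m = 0 \<and> n = 2)"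
    using assms by (auto simp: admissible_def)
  then show ?thesis using assms(1,4)
    by (elim disjE) (auto simp: admissible_def slot_def le_Suc_eq add_eq_if split: if_splits)
qed

lemma admissible_mono:
  assumes "admissible s j r c a" "j' \<le> j" "r' \<le> r" "c' \<le> c" "a' \<le> a" "r' \<le> a'" "s \<or> a' \<le> j'"
  shows "admissible s j' r' c' a'"
  using assms unfolding admissible_def by (elim disjE conjE) (simp_all, linarith+)

section \<open>The model as a dg S-bimodule\<close>

lemma field_scalars: "cring (scalars :: 'k::field ring)"
  by unfold_locales
    (auto simp: scalars_def algebra_simps Units_def intro: exI[of _ "- x" for x])

lemma scalars_simps [simp]: "carrier (scalars :: 'k::field ring) = UNIV"
  "monoid.mult (scalars :: 'k::field ring) = (*)" "one (scalars :: 'k::field ring) = 1"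
  "zero (scalars :: 'k::field ring) = 0" "add (scalars :: 'k::field ring) = (+)"
  by (simp_all add: scalars_def)

lemma fscale_algebra: "fscale (a + b) x = fscale a x + fscale b x" "fscale (a * b) x = fscale a (fscale b x)"
  "fscale a (x + y) = fscale a x + fscale a y"
  by (rule poly_mapping_eqI; simp add: lookup_add algebra_simps)+

lemma abelian_group_model: "abelian_group (model s)"
proof (rule abelian_groupI)
  fix x assume "x \<in> carrier (model s :: ('a, nat \<Rightarrow>\<^sub>0 'a) properad)"
  have "- x + x = 0" by simp
  then show "\<exists>y\<in>carrier (model s). y \<oplus>\<^bsub>model s\<^esub> x = \<zero>\<^bsub>model s\<^esub>"
    by (intro bexI[of _ "- x"]) auto
qed (auto simp: algebra_simps)

lemma module_model: "Module.module scalars (model s)"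
  by (rule Module.moduleI[OF field_scalars abelian_group_model])
    (simp_all only: model_simps scalars_simps UNIV_I fscale_algebra fscale_one)

lemma submodule_model: "submodule (slot_space s m n d) scalars (model s)"
proof -
  \<comment> \<open>\<open>submodule\<close> speaks of the inverse in the additive group of the
    record, which has to be identified with the unary minus.\<close>
  have inv: "m_inv (add_monoid (model s)) x = - x" for x :: "nat \<Rightarrow>\<^sub>0 'a"
  proof -
    interpret abelian_group "model s :: ('a, nat \<Rightarrow>\<^sub>0 'a) properad" by (rule abelian_group_model)
    have "\<ominus>\<^bsub>model s\<^esub> x = - x"
      by (rule minus_equality) auto
    then show ?thesis by (simp add: a_inv_def)
  qed
  have "- x \<in> slot_space s m n d" if "x \<in> slot_space s m n d" for x :: "nat \<Rightarrow>\<^sub>0 'a"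
    using slot_space_closed(3)[OF that, of "- 1"] by (simp add: fscale_minus_one)
  then show ?thesis
    by (auto simp: submodule_def submodule_axioms_def subgroup_def slot_space_closed inv[simplified])
qed

lemma dg_sbimodule_model: "dg_sbimodule (model s)"
  unfolding dg_sbimodule_def linear_on_part_def
  by (auto simp: module_model submodule_model model_diff_add model_diff_fscale model_diff_diff model_diff_in)

section \<open>Functionals on decorated graphs\<close>

text \<open>In terms of multisets, invariance under reordering slots and vertices is
  immediate.\<close>

lemma wired_iff_mset:
  "wired G \<longleftrightarrow> distinct (gins G @ concat (map outs (verts G))) \<and>
     mset (gins G @ concat (map outs (verts G))) = mset (gouts G @ concat (map ins (verts G)))"
  unfolding wired_def using mset_eq_imp_distinct_iff set_eq_iff_mset_eq_distinct by metis

lemma wired_mset_cong: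
  assumes "mset (gins G) = mset (gins G')" "mset (gouts G) = mset (gouts G')"
    "mset (concat (map outs (verts G))) = mset (concat (map outs (verts G')))"
    "mset (concat (map ins (verts G))) = mset (concat (map ins (verts G')))"
  shows "wired G \<longleftrightarrow> wired G'"
proof -
  have "mset (gins G @ concat (map outs (verts G))) = mset (gins G' @ concat (map outs (verts G')))"
    using assms by simp
  then have "distinct (gins G @ concat (map outs (verts G))) \<longleftrightarrow> distinct (gins G' @ concat (map outs (verts G')))"
    by (rule mset_eq_imp_distinct_iff)
  then show ?thesis unfolding wired_iff_mset using assms by simp
qed

lemma rename_simps [simp]: "gouts (rename_wires f G) = map f (gouts G)"
  "gins (rename_wires f G) = map f (gins G)" "verts (rename_wires f G) = map (rename_vert f) (verts G)"
  "outs (rename_vert f v) = map f (outs v)" "ins (rename_vert f v) = map f (ins v)"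
  "elt (rename_vert f v) = elt v" "vdeg (rename_vert f v) = vdeg v" "level (rename_vert f v) = level v"
  by (cases G; cases v; simp)+

lemma set_level_simps [simp]: "outs (set_level l v) = outs v" "ins (set_level l v) = ins v"
  "elt (set_level l v) = elt v" "vdeg (set_level l v) = vdeg v" "level (set_level l v) = l"
  by (cases v; simp)+

lemma concat_map_rename:
  "concat (map (outs \<circ> rename_vert f) vs) = map f (concat (map outs vs))"
  "concat (map (ins \<circ> rename_vert f) vs) = map f (concat (map ins vs))"
  by (induction vs) auto

lemma wired_rename:
  assumes "wired G" "inj f"
  shows "wired (rename_wires f G)"
proof -
  have "distinct (map f xs) = distinct xs" for xs using \<open>inj f\<close>
    by (simp add: distinct_map inj_on_subset[OF _ subset_UNIV])
  then have "distinct (map f (gins G @ concat (map outs (verts G))))"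
    using assms(1) by (simp only: wired_iff_mset)
  moreover have "image_mset f (mset (gins G @ concat (map outs (verts G)))) =
      image_mset f (mset (gouts G @ concat (map ins (verts G))))"
    using assms(1) by (simp only: wired_iff_mset)
  ultimately show ?thesis
    unfolding wired_iff_mset by (simp add: concat_map_rename del: mset_concat)
qed

text \<open>Closure of a shape under the moves of \<open>graph_rels\<close>: renaming, swapping
  vertices, and changing a decoration or the order of slots. It keeps both sides of each relation
  among the graphs of that shape.\<close>

definition stable :: "('a dgraph \<Rightarrow> bool) \<Rightarrow> bool" where
  "stable S \<longleftrightarrow>
    (\<forall>f G. inj f \<longrightarrow> wired G \<longrightarrow> S G \<longrightarrow> S (rename_wires f G)) \<and>
    (\<forall>gos vs v w ws gis. wired (DGraph gos (vs @ v # w # ws) gis) \<longrightarrow> S (DGraph gos (vs @ v # w # ws) gis) \<longrightarrow>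
      S (DGraph gos (vs @ w # v # ws) gis)) \<and>
    (\<forall>gos vs x d l os is ws gis y d' os' is'. wired (DGraph gos (vs @ Vert x d l os is # ws) gis) \<longrightarrow>
      S (DGraph gos (vs @ Vert x d l os is # ws) gis) \<longrightarrow>
      mset os' = mset os \<longrightarrow> mset is' = mset is \<longrightarrow> S (DGraph gos (vs @ Vert y d' l os' is' # ws) gis))"

lemma stable_True: "stable (\<lambda>_. True)"
  by (simp add: stable_def)

lemma graphs_modify:
  assumes "stable S" "DGraph gos (vs @ Vert x d l os is # ws) gis \<in> graphs (\<lambda>_. model s) S"
    "mset os' = mset os" "mset is' = mset is" "y \<in> slot_space s (length os) (length is) d'"
  shows "DGraph gos (vs @ Vert y d' l os' is' # ws) gis \<in> graphs (\<lambda>_. model s) S"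
proof -
  have len: "length os' = length os" "length is' = length is" using assms(3,4) by (metis size_mset)+
  have "wired (DGraph gos (vs @ Vert x d l os is # ws) gis)" and
    S: "S (DGraph gos (vs @ Vert x d l os is # ws) gis)"
    using assms(2) by (auto simp: graphs_model)
  then have "wired (DGraph gos (vs @ Vert y d' l os' is' # ws) gis)"
    by (subst wired_mset_cong[where G' = "DGraph gos (vs @ Vert x d l os is # ws) gis"]) (simp_all add: assms(3,4))
  moreover have "S (DGraph gos (vs @ Vert y d' l os' is' # ws) gis)"
    using assms(1) \<open>wired (DGraph gos (vs @ Vert x d l os is # ws) gis)\<close> S assms(3,4) unfolding stable_def by blast
  ultimately show ?thesis using assms(2,5) len by (auto simp: graphs_model decorated_def)
qed

lemma graphs_swap:
  assumes "stable S" "DGraph gos (vs @ v # w # ws) gis \<in> graphs (\<lambda>_. model s) S"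
  shows "DGraph gos (vs @ w # v # ws) gis \<in> graphs (\<lambda>_. model s) S"
proof -
  have "wired (DGraph gos (vs @ v # w # ws) gis)" and S: "S (DGraph gos (vs @ v # w # ws) gis)"
    using assms(2) by (auto simp: graphs_model)
  then have "wired (DGraph gos (vs @ w # v # ws) gis)"
    by (subst wired_mset_cong[where G' = "DGraph gos (vs @ v # w # ws) gis"]) simp_all
  moreover have "S (DGraph gos (vs @ w # v # ws) gis)"
    using assms(1) \<open>wired (DGraph gos (vs @ v # w # ws) gis)\<close> S unfolding stable_def by blast
  ultimately show ?thesis using assms(2) by (auto simp: graphs_model)
qed

lemma graphs_rename:
  assumes "stable S" "G \<in> graphs (\<lambda>_. model s) S" "inj f"
  shows "rename_wires f G \<in> graphs (\<lambda>_. model s) S"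
  using assms by (auto simp: graphs_model wired_rename stable_def decorated_def)

lemma rels_span:
  assumes "stable S" "x \<in> graph_rels (\<lambda>_. model s) S"
  shows "x \<in> formal.span (gen ` graphs (\<lambda>_. model s) S)"
proof -
  let ?V = "formal.span (gen ` graphs (\<lambda>_. model s) S)"
  have g: "Poly_Mapping.single G c \<in> ?V" if "G \<in> graphs (\<lambda>_. model s) S" for G :: "(nat \<Rightarrow>\<^sub>0 'a) dgraph" and c :: 'a
    using formal.span_scale[OF formal.span_base[OF imageI[OF that, of gen]], of c] by simp
  have dec: "elt v \<in> slot_space s (length (outs v)) (length (ins v)) (vdeg v)"
    if "DGraph gos (vs @ v # ws) gis \<in> graphs (\<lambda>_. model s) S" for gos vs v ws gis
    using that by (auto simp: graphs_model decorated_def)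
  note fs = formal.span_diff formal.span_scale g
  from assms(2) show ?thesis
  proof cases
    case (add gos vs x d l os "is" ws gis y)
    have "x + y \<in> slot_space s (length os) (length is) d"
      using dec[OF add(2)] dec[OF add(3)] by (simp add: slot_space_closed)
    then have "DGraph gos (vs @ Vert (x + y) d l os is # ws) gis \<in> graphs (\<lambda>_. model s) S"
      using graphs_modify[OF assms(1) add(2)] by simp
    then show ?thesis using add by (simp add: fs)
  next
    case (smult gos vs x d l os "is" ws gis c)
    have "fscale c x \<in> slot_space s (length os) (length is) d"
      using dec[OF smult(2)] by (simp add: slot_space_closed)
    then have "DGraph gos (vs @ Vert (fscale c x) d l os is # ws) gis \<in> graphs (\<lambda>_. model s) S"
      using graphs_modify[OF assms(1) smult(2)] by simp
    then show ?thesis using smult by (simp add: fs)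
  next
    case (lact gos vs x d l os "is" ws gis \<sigma>)
    have "DGraph gos (vs @ Vert x d l (permute_list \<sigma> os) is # ws) gis \<in> graphs (\<lambda>_. model s) S"
      using graphs_modify[OF assms(1) lact(2) mset_permute_list[OF lact(3)] HOL.refl] dec[OF lact(2)] by simp
    then show ?thesis using lact by (simp add: fs)
  next
    case (ract gos vs x d l os "is" ws gis \<tau>)
    have "DGraph gos (vs @ Vert x d l os (permute_list \<tau> is) # ws) gis \<in> graphs (\<lambda>_. model s) S"
      using graphs_modify[OF assms(1) ract(2) HOL.refl mset_permute_list[OF ract(3)]] dec[OF ract(2)] by simp
    then show ?thesis using ract by (simp add: fs)
  next
    case (rename G f)
    then show ?thesis using graphs_rename[OF assms(1)] by (auto simp: fs)
  next
    case (swap gos vs v w ws gis)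
    then show ?thesis using graphs_swap[OF assms(1)] by (auto intro!: fs)
  qed
qed

lemma null_span:
  assumes "stable S" shows "graph_null (\<lambda>_. model s) S \<subseteq> formal.span (gen ` graphs (\<lambda>_. model s) S)"
  unfolding graph_null_def by (rule formal.span_minimal) (auto intro: rels_span[OF assms] formal.subspace_span)

lemma graph_rels_mono:
  assumes "\<And>G. S G \<Longrightarrow> S' G" "x \<in> graph_rels B S"
  shows "x \<in> graph_rels B S'"
proof -
  have *: "G \<in> graphs B S'" if "G \<in> graphs B S" for G using that assms(1) by (auto simp: graphs_def)
  from assms(2) show ?thesis
    by induction (intro graph_rels.intros *; assumption)+
qed

lemma graph_null_mono: "(\<And>G. S G \<Longrightarrow> S' G) \<Longrightarrow> graph_null B S \<subseteq> graph_null B S'"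
  unfolding graph_null_def by (rule formal.span_mono) (auto intro: graph_rels_mono)

section \<open>Multiplicative functionals vanishing on the graph relations\<close>

definition weigh :: "('a \<Rightarrow> 'k) \<Rightarrow> (nat \<Rightarrow> nat \<Rightarrow> int \<Rightarrow> 'k::field) \<Rightarrow> 'a dgraph \<Rightarrow> 'k" where
  "weigh \<chi> w G = w (length (gouts G)) (length (gins G)) (gdeg G) * prod_list (map (\<chi> \<circ> elt) (verts G))"

text \<open>Products of linear functionals respect multilinearity, and neither wire names nor slot
  orders enter. The only obstacle is the Koszul sign of a swap, which is 1 when at most one vertex
  is odd.\<close>

lemma weigh_null:
  assumes add: "\<And>x y. \<chi> (x + y) = \<chi> x + \<chi> y" and scale: "\<And>c x. \<chi> (fscale c x) = c * \<chi> x"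
    and odd: "\<And>G. G \<in> graphs (\<lambda>_. model s) S \<Longrightarrow> weigh \<chi> w G \<noteq> 0 \<Longrightarrow> total nr (verts G) \<le> 1"
    and x: "x \<in> graph_null (\<lambda>_. model s) S"
  shows "lin_form (weigh \<chi> w) x = 0"
  using x unfolding graph_null_def
proof (rule span_lin_ext_induct)
  fix x assume "x \<in> graph_rels (\<lambda>_. model s) S"
  then show "lin_form (weigh \<chi> w) x = 0"
  proof cases
    case add: (add gos vs x d l os "is" ws gis y)
    show ?thesis unfolding add(1) by (simp add: lin_form_diff lin_form_add weigh_def gdeg_def assms(1) algebra_simps)
  next
    case (smult gos vs x d l os "is" ws gis c)
    show ?thesis unfolding smult(1) by (simp add: lin_form_diff lin_form_fscale weigh_def gdeg_def assms(2) algebra_simps)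
  next
    case (swap gos vs v w' ws gis)
    let ?G = "DGraph gos (vs @ v # w' # ws) gis" let ?G' = "DGraph gos (vs @ w' # v # ws) gis"
    have eq: "weigh \<chi> w ?G' = weigh \<chi> w ?G" by (simp add: weigh_def gdeg_def algebra_simps)
    show ?thesis
    proof (cases "weigh \<chi> w ?G = 0")
      case False
      then have "total nr (verts ?G) \<le> 1" using odd swap by blast
      \<comment> \<open>Two odd neighbours would contribute 2 to \<open>total nr\<close>.\<close>
      then have "\<not> (odd (vdeg v) \<and> odd (vdeg w'))" by (auto simp: nr_def)
      then have "sgn_deg (vdeg v * vdeg w') = (1 :: 'a)" by (auto simp: sgn_deg_def)
      then show ?thesis using swap eq by (simp add: lin_form_diff)
    qed (use swap eq in \<open>simp add: lin_form_diff lin_form_fscale\<close>)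
  qed (auto simp: lin_form_diff weigh_def gdeg_def comp_def)
qed (auto simp: lin_form_add lin_form_fscale)

section \<open>The model is a dioperad\<close>

text \<open>An inner edge uses one output slot and one input slot, so the net arity of the legs is
  that of all vertices together.\<close>

lemma graph_balanced:
  assumes "wired G" "\<forall>v\<in>set (verts G). decorated s v" "coefs (verts G) \<noteq> 0"
  shows "int (length (gouts G)) - int (length (gins G)) = 2 * (int (total na (verts G)) - int (total nc (verts G)))"
    "gdeg G = - 2 * int (total nb (verts G)) - int (total nr (verts G)) - 4 * int (total nc (verts G))"
    "total nr (verts G) \<le> total na (verts G)" "s \<or> total na (verts G) \<le> total nb (verts G)"
  using numerics_coefs[OF assms(2,3)] wired_length[OF assms(1)]
  unfolding numerics_def balanced_def gdeg_def by linarith+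

lemma graph_admissible:
  assumes "wired G" "\<forall>v\<in>set (verts G). decorated s v" "coefs (verts G) \<noteq> 0"
    "slot s (length (gouts G)) (length (gins G)) (gdeg G) \<noteq> None"
  shows "admissible s (total nb (verts G)) (total nr (verts G)) (total nc (verts G)) (total na (verts G))"
  by (rule slot_admissible[OF assms(4) graph_balanced[OF assms(1,2,3)]])

lemma admissible_odd: "admissible s j r c a \<Longrightarrow> r \<le> 1"
  by (auto simp: admissible_def)

text \<open>A tree with \<open>k\<close> vertices has \<open>k - 1\<close> inner edges, which use
  \<open>2 * (k - 1)\<close> of the \<open>2 * k\<close> slots. Here genus 0 is essential:
  \<open>m\<close> and \<open>n\<close> joined by two edges have no legs.\<close>

lemma tree_arity:
  assumes "wired G" "tree2 G" "\<forall>v\<in>set (verts G). decorated s v" "coefs (verts G) \<noteq> 0"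
  shows "length (gouts G) + length (gins G) = 2"
proof (cases "verts G = []")
  case True
  then show ?thesis using assms(1,2) wired_length[OF assms(1)] by (simp add: tree2_def connected_graph_def)
next
  case False
  then show ?thesis
    using tree_length[of G] wired_length[OF assms(1)] numerics_coefs[OF assms(3,4)] assms(1,2)
    unfolding tree2_def numerics_def balanced_def by linarith
qed

text \<open>Exhibits each coordinate of the composition as a functional to which
  \<open>weigh_null\<close> applies.\<close>

lemma lookup_model_compose:
  "Poly_Mapping.lookup (model_compose s G) i = weigh coef (\<lambda>m n d. of_bool (slot s m n d = Some i)) G"
  by (auto simp: model_compose_def slot_elt_def weigh_def coefs_def lookup_single when_def split: option.splits)

lemma model_eval_null:
  assumes "x \<in> graph_null (\<lambda>_. model s) S"
  shows "lin_ext (model_compose s) x = 0"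
proof (rule poly_mapping_eqI)
  fix i
  have "lin_form (weigh coef (\<lambda>m n d. of_bool (slot s m n d = Some i))) x = 0"
  proof (rule weigh_null[OF coef_add coef_fscale _ assms])
    fix G :: "(nat \<Rightarrow>\<^sub>0 'a) dgraph"
    assume "G \<in> graphs (\<lambda>_. model s) S" "weigh coef (\<lambda>m n d. of_bool (slot s m n d = Some i)) G \<noteq> 0"
    then show "total nr (verts G) \<le> 1"
      using graph_admissible[of G s] admissible_odd by (auto simp: graphs_model weigh_def coefs_def)
  qed
  then show "Poly_Mapping.lookup (lin_ext (model_compose s) x) i = Poly_Mapping.lookup 0 i"
    by (simp add: lookup_lin_ext lookup_model_compose)
qed

section \<open>Compatibility of composition with the differential\<close>

definition diff_vert :: "(nat \<Rightarrow>\<^sub>0 'k::field) vert \<Rightarrow> (nat \<Rightarrow>\<^sub>0 'k) vert" where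
  "diff_vert v = Vert (model_diff (elt v)) (vdeg v - 1) (level v) (outs v) (ins v)"

lemma diff_vert_simps [simp]: "outs (diff_vert v) = outs v" "ins (diff_vert v) = ins v"
  "elt (diff_vert v) = model_diff (elt v)" "vdeg (diff_vert v) = vdeg v - 1" "level (diff_vert v) = level v"
  by (simp_all add: diff_vert_def)

lemma case_diff_vert:
  "(case v of Vert x d l os is \<Rightarrow> Vert (diff (model s) x) (d - 1) l os is) = diff_vert v"
  by (cases v) (simp add: diff_vert_def)

lemma single_sum: "Poly_Mapping.single k (sum f A) = (\<Sum>i\<in>A. Poly_Mapping.single k (f i))"
  by (induction A rule: infinite_finite_induct) (auto simp: single_add)

lemma graph_diff_model:
  "graph_diff (\<lambda>_. model s) G = (\<Sum>i<length (verts G). fscale (sgn_deg (vsdeg (take i (verts G))))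
     (gen (DGraph (gouts G) ((verts G)[i := diff_vert (verts G ! i)]) (gins G))))"
  by (simp only: graph_diff_def case_diff_vert)

lemma map_list_update_same: "f v = f (xs ! i) \<Longrightarrow> map f (xs[i := v]) = map f xs"
  by (metis list_update_id map_update)

lemma vsdeg_diff_vert: "i < length vs \<Longrightarrow> vsdeg (vs[i := diff_vert (vs ! i)]) = vsdeg vs - 1"
  by (subst (2) id_take_nth_drop[of i vs]) (simp_all add: upd_conv_take_nth_drop)

lemma coefs_update:
  "i < length vs \<Longrightarrow> coefs (vs[i := v]) * coef (elt (vs ! i)) = coefs vs * coef (elt v)"
  by (subst (2) id_take_nth_drop[of i vs]) (simp_all add: upd_conv_take_nth_drop algebra_simps)

lemma coefs_eq_0: "coefs vs = 0 \<longleftrightarrow> (\<exists>v\<in>set vs. coef (elt v) = 0)"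
  by (auto simp: coefs_def prod_list_zero_iff)

lemma decorated_diff_vert: "decorated s v \<Longrightarrow> decorated s (diff_vert v)"
  by (simp add: decorated_def model_diff_in)

lemma le_total: "v \<in> set vs \<Longrightarrow> f v \<le> total f vs"
  by (induction vs) auto

text \<open>A vertex with nonzero differential is a \<open>q\<close>, which becomes the odd
  \<open>r\<close>. The only admissible counts with an odd vertex are those of a single
  \<open>r\<close> among units, so the composite has the type of \<open>r\<close>.\<close>

lemma compose_diff_vert:
  assumes "wired G" "\<forall>v\<in>set (verts G). decorated s v" "i < length (verts G)"
    "slot_elt s (length (gouts G)) (length (gins G)) (gdeg G - 1) (coefs ((verts G)[i := diff_vert (verts G ! i)])) \<noteq> 0"
  shows "s \<and> length (gouts G) = 2 \<and> length (gins G) = 0 \<and> gdeg G = 0"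
proof -
  let ?v = "verts G ! i"
  let ?G = "DGraph (gouts G) ((verts G)[i := diff_vert ?v]) (gins G)"
  have v: "decorated s ?v" using assms(2,3) by simp
  have dec: "\<forall>v\<in>set (verts ?G). decorated s v"
    using assms(2) v by (auto dest!: set_update_subset_insert[THEN subsetD] intro: decorated_diff_vert)
  have w: "wired ?G"
    using assms(1) by (simp add: wired_def map_list_update_same)
  have ne: "coefs (verts ?G) \<noteq> 0" and sl: "slot s (length (gouts G)) (length (gins G)) (gdeg G - 1) \<noteq> None"
    using assms(4) by (auto simp: slot_elt_def split: option.splits)
  have gd: "gdeg ?G = gdeg G - 1" using assms(3) by (simp add: gdeg_def vsdeg_diff_vert)
  have adm: "admissible s (total nb (verts ?G)) (total nr (verts ?G)) (total nc (verts ?G)) (total na (verts ?G))"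
    by (rule graph_admissible[OF w dec ne]) (use sl gd in simp)
  have mem: "diff_vert ?v \<in> set (verts ?G)" using assms(3) by (simp add: set_update_memI)
  then have "coef (model_diff (elt ?v)) \<noteq> 0" using ne by (auto simp: coefs_eq_0)
  then have "vdeg ?v = 0" using v by (auto simp: decorated_def model_diff_slot split: if_splits)
  then have "nr (diff_vert ?v) = 1" by (simp add: nr_def)
  then have "total nr (verts ?G) \<ge> 1" using le_total[OF mem, of nr] by simp
  obtain j r c a where t: "total nb (verts ?G) = j" "total nr (verts ?G) = r" "total nc (verts ?G) = c" "total na (verts ?G) = a"
    by blast
  have "r \<ge> 1" using \<open>total nr (verts ?G) \<ge> 1\<close> unfolding t .
  then have "r = 1" "j = 0" "c = 0" "a = 1"
    using adm unfolding t admissible_def by auto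
  then have "gdeg G = 0" "int (length (gouts G)) - int (length (gins G)) = 2"
    using graph_balanced(1,2)[OF w dec ne] gd unfolding t by auto
  then show ?thesis using sl by (auto simp: slot_def split: if_splits)
qed

text \<open>In this type a nonzero product consists of one \<open>q\<close> and units. All degrees
  are 0, so no signs occur, and just the summand that differentiates \<open>q\<close>
  survives.\<close>

lemma coefs_diff_vert_sum:
  assumes "wired G" "\<forall>v\<in>set (verts G). decorated s v" s and "length (gouts G) = 2" "length (gins G) = 0" "gdeg G = 0"
  shows "(\<Sum>i<length (verts G). sgn_deg (vsdeg (take i (verts G))) * coefs ((verts G)[i := diff_vert (verts G ! i)])) = coefs (verts G)"
proof (cases "coefs (verts G) = 0")
  case True
  then obtain k where k: "k < length (verts G)" "coef (elt (verts G ! k)) = 0"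
    by (auto simp: coefs_eq_0 in_set_conv_nth)
  then have "elt (verts G ! k) = 0" using assms(2) unfolding decorated_def by (metis coef_eq_0 nth_mem)
  \<comment> \<open>A zero decoration stays zero, whether or not its own vertex is
    differentiated.\<close>
  then have "coefs ((verts G)[i := diff_vert (verts G ! i)]) = 0" if "i < length (verts G)" for i
  proof -
    have "coef (elt ((verts G)[i := diff_vert (verts G ! i)] ! k)) = 0"
      using that k \<open>elt (verts G ! k) = 0\<close> by (cases "i = k") auto
    moreover have "(verts G)[i := diff_vert (verts G ! i)] ! k \<in> set ((verts G)[i := diff_vert (verts G ! i)])"
      using k by (intro nth_mem) simp
    ultimately show ?thesis unfolding coefs_eq_0 by blast
  qed
  then show ?thesis using True by simp
next
  case False
  have "slot s (length (gouts G)) (length (gins G)) (gdeg G) \<noteq> None" using assms by (simp add: slot_def)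
  note bal = graph_balanced[OF assms(1,2) False]
  obtain j r c a where t: "total nb (verts G) = j" "total nr (verts G) = r" "total nc (verts G) = c" "total na (verts G) = a"
    by blast
  \<comment> \<open>The degree is minus a sum of nonnegative terms, so degree 0 makes each of them
    zero.\<close>
  have "j = 0" "r = 0" "c = 0" using bal(2) assms(6) unfolding t by linarith+
  moreover from this have "a = 1" using bal(1) assms(4,5) unfolding t by simp
  ultimately have "total nb (verts G) = 0" "total nr (verts G) = 0" "total nc (verts G) = 0" "total na (verts G) = 1"
    unfolding t .
  then have z: "nb v = 0" "nr v = 0" "nc v = 0" if "v \<in> set (verts G)" for v using that by auto
  have d: "vdeg v = 0" if "v \<in> set (verts G)" for v
  proof -
    have "slot s (length (outs v)) (length (ins v)) (vdeg v) \<noteq> None"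
      by (rule decorated_slot) (use assms(2) False that in \<open>auto simp: coefs_eq_0\<close>)
    then show ?thesis using z[OF that]
      by (auto simp: nb_def nr_def nc_def slot_def split: if_splits)
  qed
  have t: "sgn_deg (vsdeg (take i (verts G))) * coefs ((verts G)[i := diff_vert (verts G ! i)]) =
      coefs (verts G) * of_nat (na (verts G ! i))" if i: "i < length (verts G)" for i
  proof -
    let ?v = "verts G ! i"
    have v: "?v \<in> set (verts G)" using i by simp
    have "map vdeg (take i (verts G)) = map (\<lambda>_. 0) (take i (verts G))"
      using d by (auto dest: in_set_takeD)
    then have "vsdeg (take i (verts G)) = sum_list (map (\<lambda>_. 0) (take i (verts G)))" by (rule arg_cong)
    also have "\<dots> = 0" by (rule sum_list_0)
    finally have "vsdeg (take i (verts G)) = 0" .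
    moreover have "coef (model_diff (elt ?v)) = coef (elt ?v) * of_nat (na ?v)"
    proof -
      have "slot s (length (outs ?v)) (length (ins ?v)) (vdeg ?v) \<noteq> None"
        by (rule decorated_slot) (use assms(2) False v in \<open>auto simp: coefs_eq_0\<close>)
      then show ?thesis
        using d[OF v] v assms(2,3) model_diff_slot[of "elt ?v"]
        by (auto simp: decorated_def slot_def na_def coef_def lookup_single split: if_splits)
    qed
    moreover have "coef (elt ?v) \<noteq> 0" using False v by (auto simp: coefs_eq_0)
    ultimately show ?thesis using coefs_update[OF i, of "diff_vert ?v"] by (simp add: sgn_deg_def)
  qed
  have "(\<Sum>i<length (verts G). of_nat (na (verts G ! i))) = (of_nat (total na (verts G)) :: 'a)"
    by (simp add: sum_list_sum_nth atLeast0LessThan)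
  then show ?thesis using t \<open>total na (verts G) = 1\<close> by (simp flip: sum_distrib_left)
qed

text \<open>In the type of \<open>q\<close> this is \<open>coefs_diff_vert_sum\<close>. In all other
  types both sides are zero, the left one summand by summand.\<close>

lemma model_eval_diff:
  assumes "wired G" "\<forall>v\<in>set (verts G). decorated s v"
  shows "lin_ext (model_compose s) (graph_diff (\<lambda>_. model s) G) = model_diff (model_compose s G)"
proof -
  let ?m = "length (gouts G)" let ?n = "length (gins G)"
  have eq: "lin_ext (model_compose s) (graph_diff (\<lambda>_. model s) G) =
     (\<Sum>i<length (verts G). fscale (sgn_deg (vsdeg (take i (verts G))))
       (slot_elt s ?m ?n (gdeg G - 1) (coefs ((verts G)[i := diff_vert (verts G ! i)]))))"
    by (simp add: graph_diff_model lin_ext_sum model_compose_def gdeg_def vsdeg_diff_vert)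
  show ?thesis
  proof (cases "s \<and> ?m = 2 \<and> ?n = 0 \<and> gdeg G = 0")
    case True
    then have sl: "slot_elt s ?m ?n (gdeg G - 1) c = Poly_Mapping.single 2 c"
      "slot_elt s ?m ?n (gdeg G) c = Poly_Mapping.single 1 c" for c :: 'a
      by (simp_all add: slot_elt_def slot_def)
    have "lin_ext (model_compose s) (graph_diff (\<lambda>_. model s) G) = Poly_Mapping.single 2
      (\<Sum>i<length (verts G). sgn_deg (vsdeg (take i (verts G))) * coefs ((verts G)[i := diff_vert (verts G ! i)]))"
      unfolding eq sl by (simp add: single_sum)
    also have "\<dots> = Poly_Mapping.single 2 (coefs (verts G))"
      using coefs_diff_vert_sum[OF assms] True by simp
    finally show ?thesis by (simp add: model_compose_def sl model_diff_def)
  next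
    case False
    then have "model_diff (slot_elt s ?m ?n (gdeg G) (coefs (verts G))) = 0"
      by (subst model_diff_slot[OF slot_elt_in]) auto
    then have "model_diff (model_compose s G) = 0"
      by (simp add: model_compose_def)
    moreover have "slot_elt s ?m ?n (gdeg G - 1) (coefs ((verts G)[i := diff_vert (verts G ! i)])) = 0"
      if "i < length (verts G)" for i
      using compose_diff_vert[OF assms that] False by blast
    ultimately show ?thesis unfolding eq by simp
  qed
qed

section \<open>Cosets, and composition as a map on the quotient\<close>

lemma set_add_plus: "add G = (+) \<Longrightarrow> A <+>\<^bsub>G\<^esub> B = A + B"
  by (auto simp: set_add_def set_mult_def set_plus_def)

text \<open>Together with its neighbours this turns the coset operations of records into sums of
  sets, so that identities between cosets follow by associativity and commutativity.\<close>

lemma a_coset_plus: "add G = (+) \<Longrightarrow> N +>\<^bsub>G\<^esub> x = N + {x}"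
  by (auto simp: a_r_coset_def r_coset_def set_plus_def)

lemma coset_map_plus: "add Q = (+) \<Longrightarrow> coset_map Q N f X = N + f ` X"
  by (simp add: coset_map_def set_add_plus)

lemma graph_span_simps [simp]: "add (graph_span B S) = (+)" "zero (graph_span B S) = 0"
  "smult (graph_span B S) = fscale" "diff (graph_span B S) = lin_ext (graph_diff B)"
  "lact (graph_span B S) \<sigma> = lin_ext (\<lambda>G. gen (graph_lact \<sigma> G))"
  "ract (graph_span B S) x \<tau> = lin_ext (\<lambda>G. gen (graph_ract G \<tau>)) x"
  "part (graph_span B S) m n d = formal.span (gen `
        {G \<in> graphs B S. length (gouts G) = m \<and> length (gins G) = n \<and> gdeg G = d})"
  by (simp_all add: graph_span_def)

lemma graph_sbimod_simps [simp]:
  "add (graph_sbimod B S) = (+)" "zero (graph_sbimod B S) = graph_null B S"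
  "smult (graph_sbimod B S) c X = graph_null B S + fscale c ` X"
  "diff (graph_sbimod B S) X = graph_null B S + lin_ext (graph_diff B) ` X"
  "lact (graph_sbimod B S) \<sigma> X = graph_null B S + lin_ext (\<lambda>G. gen (graph_lact \<sigma> G)) ` X"
  "ract (graph_sbimod B S) X \<tau> = graph_null B S + lin_ext (\<lambda>G. gen (graph_ract G \<tau>)) ` X"
  "part (graph_sbimod B S) m n d = (\<lambda>x. graph_null B S + {x}) ` part (graph_span B S) m n d"
  by (auto simp: graph_sbimod_def quot_sbimod_def coset_map_plus a_coset_plus fun_eq_iff set_add_plus
      simp del: graph_span_simps(7))

lemma graph_class_plus: "graph_class B S x = graph_null B S + {x}"
  by (simp add: graph_class_def a_coset_plus)

lemma zero_null: "0 \<in> graph_null B S"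
  by (simp add: graph_null_def formal.span_zero)

lemma graph_lact_simps [simp]: "length (gouts (graph_lact \<sigma> G)) = length (gouts G)"
  "gins (graph_lact \<sigma> G) = gins G" "verts (graph_lact \<sigma> G) = verts G"
  "gouts (graph_ract G \<tau>) = gouts G" "length (gins (graph_ract G \<tau>)) = length (gins G)"
  "verts (graph_ract G \<tau>) = verts G"
  by (simp_all add: graph_lact_def graph_ract_def)

lemma gdeg_act [simp]: "gdeg (graph_lact \<sigma> G) = gdeg G" "gdeg (graph_ract G \<tau>) = gdeg G"
  by (simp_all add: gdeg_def)

lemma model_eval_part:
  assumes "x \<in> formal.span (gen ` {G \<in> graphs (\<lambda>_. model s) S. length (gouts G) = m \<and> length (gins G) = n \<and> gdeg G = d})"
  shows "lin_ext (model_compose s) x \<in> slot_space s m n d"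
    "lin_ext (model_compose s) (lin_ext (graph_diff (\<lambda>_. model s)) x) = model_diff (lin_ext (model_compose s) x)"
proof -
  show "lin_ext (model_compose s) x \<in> slot_space s m n d"
    using assms by (rule span_lin_ext_induct)
      (auto simp: lin_ext_add lin_ext_fscale slot_space_closed model_compose_def slot_elt_in)
  show "lin_ext (model_compose s) (lin_ext (graph_diff (\<lambda>_. model s)) x) = model_diff (lin_ext (model_compose s) x)"
    using assms by (rule span_lin_ext_induct)
      (auto simp: lin_ext_add lin_ext_fscale model_diff_add model_diff_fscale model_eval_diff graphs_model)
qed

lemma model_eval_span:
  assumes "x \<in> formal.span (gen ` graphs (\<lambda>_. model s) S)"
  shows "lin_ext (model_compose s) (lin_ext (graph_diff (\<lambda>_. model s)) x) = model_diff (lin_ext (model_compose s) x)"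
  using assms by (rule span_lin_ext_induct)
    (auto simp: lin_ext_add lin_ext_fscale model_diff_add model_diff_fscale model_eval_diff graphs_model)

text \<open>Enlarging the shape to all wired graphs, which is stable, places the relations in a span
  on which composition is known to commute with the differential.\<close>

lemma model_eval_diff_null:
  assumes "x \<in> graph_null (\<lambda>_. model s) S"
  shows "lin_ext (model_compose s) (lin_ext (graph_diff (\<lambda>_. model s)) x) = 0"
proof -
  have "x \<in> graph_null (\<lambda>_. model s) (\<lambda>_. True)"
    using graph_null_mono[of S "\<lambda>_. True"] assms by blast
  then have "x \<in> formal.span (gen ` graphs (\<lambda>_. model s) (\<lambda>_. True))"
    using null_span[OF stable_True] by blast
  from model_eval_span[OF this] show ?thesis using model_eval_null[OF assms] by simp
qed

lemma model_eval_act: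
  "lin_ext (model_compose s) (lin_ext (\<lambda>G. gen (graph_lact \<sigma> G)) x) = lin_ext (model_compose s) x"
  "lin_ext (model_compose s) (lin_ext (\<lambda>G. gen (graph_ract G \<tau>)) x) = lin_ext (model_compose s) x"
  by (rule poly_mapping_eqI; simp add: lookup_lin_ext lin_form_lin_ext lookup_model_compose weigh_def)+

text \<open>The map demanded by \<open>graph_monoid\<close>: composition evaluated on a
  representative, independent of its choice by \<open>model_eval_null\<close>.\<close>

definition eval_coset :: "bool \<Rightarrow> ((nat \<Rightarrow>\<^sub>0 'k::field) dgraph \<Rightarrow>\<^sub>0 'k) set \<Rightarrow> (nat \<Rightarrow>\<^sub>0 'k)" where
  "eval_coset s X = lin_ext (model_compose s) (SOME x. x \<in> X)"

lemma eval_coset_eq: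
  assumes "X \<noteq> {}" "\<And>x. x \<in> X \<Longrightarrow> lin_ext (model_compose s) x = v"
  shows "eval_coset s X = v"
  unfolding eval_coset_def by (rule assms(2)) (use assms(1) in \<open>auto intro: someI\<close>)

lemma model_compose_hom: "sbimod_hom (graph_sbimod (\<lambda>_. model s) S) (model s) (eval_coset s)"
proof -
  let ?B = "\<lambda>_. model s :: ('a, nat \<Rightarrow>\<^sub>0 'a) properad"
  let ?N = "graph_null ?B S" let ?P = "part (graph_span ?B S)" let ?ev = "lin_ext (model_compose s)"
  have N: "?ev x = 0" "?ev (lin_ext (graph_diff ?B) x) = 0" if "x \<in> ?N" for x
    using that by (simp_all add: model_eval_null model_eval_diff_null)
  have ev: "eval_coset s (?N + {x}) = ?ev x" for x
    by (rule eval_coset_eq) (use zero_null[of ?B S] in \<open>auto simp: set_plus_def lin_ext_add N\<close>)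
  \<comment> \<open>All operations of the quotient bring a coset into this form, with
    \<open>f\<close> the operation on representatives.\<close>
  have ev2: "eval_coset s (?N + f ` (?N + {x})) = v"
    if "\<And>n. n \<in> ?N \<Longrightarrow> ?ev (f (n + x)) = v" for f x v
    by (rule eval_coset_eq) (use zero_null[of ?B S] that in \<open>auto simp: set_plus_def lin_ext_add N\<close>)
  show ?thesis unfolding sbimod_hom_def linear_on_part_def
  proof (intro allI conjI ballI impI)
    fix m n d
    show "eval_coset s ` part (graph_sbimod ?B S) m n d \<subseteq> part (model s) m n d"
      by (auto simp: ev model_eval_part)
  next
    fix m n d X Y assume "X \<in> part (graph_sbimod ?B S) m n d" "Y \<in> part (graph_sbimod ?B S) m n d"
    then obtain x y where "X = ?N + {x}" "Y = ?N + {y}" by auto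
    moreover have "eval_coset s ((?N + {x}) + (?N + {y})) = ?ev x + ?ev y"
      by (rule eval_coset_eq) (use zero_null[of ?B S] in \<open>auto simp: set_plus_def lin_ext_add N\<close>)
    ultimately show "eval_coset s (X \<oplus>\<^bsub>graph_sbimod ?B S\<^esub> Y) = eval_coset s X \<oplus>\<^bsub>model s\<^esub> eval_coset s Y"
      by (simp add: ev)
  next
    fix m n d c X assume "X \<in> part (graph_sbimod ?B S) m n d"
    then obtain x where x: "X = ?N + {x}" by auto
    show "eval_coset s (c \<odot>\<^bsub>graph_sbimod ?B S\<^esub> X) = c \<odot>\<^bsub>model s\<^esub> eval_coset s X"
      unfolding x by (simp add: ev) (rule ev2, simp add: lin_ext_fscale lin_ext_add N)
  next
    fix m n d X assume "X \<in> part (graph_sbimod ?B S) m n d"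
    then obtain x where x: "X = ?N + {x}" "x \<in> ?P m n d" by auto
    show "eval_coset s (diff (graph_sbimod ?B S) X) = diff (model s) (eval_coset s X)"
      unfolding x by (simp add: ev) (rule ev2, use x in \<open>simp add: lin_ext_add N model_eval_part\<close>)
  next
    fix m n d X \<sigma> assume "X \<in> part (graph_sbimod ?B S) m n d"
    then obtain x where x: "X = ?N + {x}" by auto
    show "eval_coset s (lact (graph_sbimod ?B S) \<sigma> X) = lact (model s) \<sigma> (eval_coset s X)"
      unfolding x by (simp add: ev) (rule ev2, simp add: lin_ext_add N model_eval_act)
  next
    fix m n d X \<tau> assume "X \<in> part (graph_sbimod ?B S) m n d"
    then obtain x where x: "X = ?N + {x}" by auto
    show "eval_coset s (ract (graph_sbimod ?B S) X \<tau>) = ract (model s) (eval_coset s X) \<tau>"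
      unfolding x by (simp add: ev) (rule ev2, simp add: lin_ext_add N model_eval_act)
  qed
qed

lemma eval_coset_gen: "eval_coset s (graph_class (\<lambda>_. model s) S (gen G)) = model_compose s G"
  by (rule eval_coset_eq)
    (use zero_null[of "\<lambda>_. model s :: ('a, nat \<Rightarrow>\<^sub>0 'a) properad" S]
      in \<open>auto simp: graph_class_plus set_plus_def lin_ext_add model_eval_null\<close>)

section \<open>Units and associativity\<close>

lemma unit_verts:
  "coefs (map (\<lambda>(a, b). Vert (gen 0) 0 l (f a b) (g a b)) zs) = 1"
  "vsdeg (map (\<lambda>(a, b). Vert (gen 0) 0 l (f a b) (g a b)) zs) = 0"
  by (induction zs) (auto simp: coef_def lookup_one)

lemma reorder_total: "reorder vs c ws \<Longrightarrow> total f ws = total f vs"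
  by (induction rule: reorder.induct) auto

lemma reorder_vsdeg: "reorder vs c ws \<Longrightarrow> vsdeg ws = vsdeg vs"
  by (induction rule: reorder.induct) auto

text \<open>A sign arises only when two odd vertices pass each other.\<close>

lemma reorder_sign: "reorder vs c ws \<Longrightarrow> total nr vs \<le> 1 \<Longrightarrow> c = 1"
proof (induction rule: reorder.induct)
  case (swap us c vs v w ws)
  then have "total nr (vs @ v # w # ws) \<le> 1" by (simp only: reorder_total)
  then have "\<not> (odd (vdeg v) \<and> odd (vdeg w))" by (auto simp: nr_def)
  then show ?case using swap by (auto simp: sgn_deg_def)
qed simp

lemma reorder_coefs:
  assumes "reorder vs c ws" shows "coefs ws = coefs vs"
  using assms by induction (auto simp: algebra_simps)


lemma decorated_set_level [simp]: "decorated s (set_level l v) = decorated s v"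
  by (simp add: decorated_def)

lemma level_simps [simp]: "nb (set_level l v) = nb v"
  "nr (set_level l v) = nr v" "nc (set_level l v) = nc v" "na (set_level l v) = na v"
  by (simp_all add: nb_def nr_def nc_def na_def)

lemma composite_simps [simp]: "outs (composite_vert P l K) = gouts K" "ins (composite_vert P l K) = gins K"
  "elt (composite_vert P l K) = compose P K" "vdeg (composite_vert P l K) = gdeg K" "level (composite_vert P l K) = l"
  by (simp_all add: composite_vert_def)

abbreviation flat :: "'a dgraph list \<Rightarrow> 'a vert list" where
  "flat Ks \<equiv> concat (map verts Ks)"

lemma coefs_composite_zero:
  "coefs (flat Ks) = 0 \<Longrightarrow> coefs (map (composite_vert (model s) l) Ks) = 0"
  by (induction Ks) (auto simp: model_compose_def)

text \<open>A composite loses its coefficient only if its type has no slot. This does not happen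
  here: the counts of each block lie below admissible ones, hence are admissible, and with two legs
  per tree this gives a slot.\<close>

lemma coefs_composite:
  assumes "set Ks \<subseteq> graphs (\<lambda>_. model s) tree2" "coefs (flat Ks) \<noteq> 0" "admissible s j r c a"
    "total nb (flat Ks) \<le> j" "total nr (flat Ks) \<le> r" "total nc (flat Ks) \<le> c" "total na (flat Ks) \<le> a"
  shows "coefs (map (composite_vert (model s) l) Ks) = coefs (flat Ks)"
  using assms
proof (induction Ks)
  case (Cons K Ks)
  have K: "wired K" "tree2 K" "\<forall>v\<in>set (verts K). decorated s v" "coefs (verts K) \<noteq> 0"
    using Cons.prems by (auto simp: graphs_model)
  note bal = graph_balanced[OF K(1,3,4)]
  have "admissible s (total nb (verts K)) (total nr (verts K)) (total nc (verts K)) (total na (verts K))"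
    by (rule admissible_mono[OF Cons.prems(3)]) (use Cons.prems bal in auto)
  then have "slot s (length (gouts K)) (length (gins K)) (gdeg K) \<noteq> None"
    by (rule admissible_slot[OF _ bal(1) tree_arity[OF K] bal(2)])
  then have "coef (model_compose s K) = coefs (verts K)"
    unfolding model_compose_def coef_slot_elt by auto
  moreover have "coefs (map (composite_vert (model s) l) Ks) = coefs (flat Ks)"
    using Cons.prems by (intro Cons.IH) auto
  ultimately show ?case by simp
qed simp

text \<open>If the flat graph has a nonzero value, its counts are admissible and no block loses its
  coefficient; otherwise both sides are zero.\<close>

lemma compose_flatten:
  assumes "set Ks \<subseteq> graphs (\<lambda>_. model s) tree2" "wired (DGraph os vs is)" "\<forall>v\<in>set vs. decorated s v"
    "coefs vs = c * coefs (flat Ks)"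
    "total nb (flat Ks) \<le> total nb vs" "total nr (flat Ks) \<le> total nr vs"
    "total nc (flat Ks) \<le> total nc vs" "total na (flat Ks) \<le> total na vs"
  shows "slot_elt s (length os) (length is) (vsdeg vs) (c * coefs (map (composite_vert (model s) l) Ks)) =
    slot_elt s (length os) (length is) (vsdeg vs) (coefs vs)"
proof (cases "coefs vs = 0 \<or> slot s (length os) (length is) (vsdeg vs) = None")
  case True
  then show ?thesis using assms(4) coefs_composite_zero[of Ks s l] by (auto simp: slot_elt_def split: option.splits)
next
  case False
  then have "admissible s (total nb vs) (total nr vs) (total nc vs) (total na vs)"
    using graph_admissible[of "DGraph os vs is" s] assms(2,3) by (simp add: gdeg_def)
  moreover have "coefs (flat Ks) \<noteq> 0" using False assms(4) by auto
  ultimately show ?thesis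
    using coefs_composite[of Ks s] assms by simp
qed

lemma vsdeg_composite: "vsdeg (map (composite_vert P l) Ks) = vsdeg (flat Ks)"
  by (induction Ks) (auto simp: gdeg_def)

lemma raise_lists: "coefs (map raise vs) = coefs vs" "vsdeg (map raise vs) = vsdeg vs"
  "total nb (map raise vs) = total nb vs" "total nr (map raise vs) = total nr vs"
  "total nc (map raise vs) = total nc vs" "total na (map raise vs) = total na vs"
  by (induction vs) auto

lemma comp_raise [simp]: "nb \<circ> (\<lambda>v. raise v) = nb" "nr \<circ> (\<lambda>v. raise v) = nr"
  "nc \<circ> (\<lambda>v. raise v) = nc" "na \<circ> (\<lambda>v. raise v) = na"
  by (auto simp: fun_eq_iff)

lemma raise_flat: "concat (map (\<lambda>K. map raise (verts K)) Ks) = map raise (flat Ks)"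
  by (induction Ks) auto

text \<open>Both bracketings have the value of the flat graph: a type with a slot and a product of
  coefficients, neither of which depends on the bracketing.\<close>

lemma model_associative:
  fixes Gs Hs :: "(nat \<Rightarrow>\<^sub>0 'k::field) dgraph list"
  assumes "set Gs \<subseteq> graphs (\<lambda>_. model s) tree2" "set Hs \<subseteq> graphs (\<lambda>_. model s) tree2"
    and ws: "\<forall>v\<in>set ws. decorated s v"
    and w: "wired (DGraph os (map raise ws @ flat Gs) is)"
    and r: "reorder (map raise ws @ flat Gs) c (map raise (flat Hs) @ us)"
  shows "model_compose s (DGraph os (ws @ map (composite_vert (model s) 1) Gs) is) =
    fscale c (model_compose s (DGraph os (map (composite_vert (model s) 2) Hs @ us) is))"
proof -
  let ?vs = "map raise ws @ flat Gs"
  have dec: "\<forall>v\<in>set ?vs. decorated s v" using ws assms(1) by (auto simp: graphs_model)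
  have co: "coefs ?vs = coefs us * coefs (flat Hs)"
    using reorder_coefs[OF r] by (simp add: raise_lists ac_simps)
  have vd: "vsdeg us + vsdeg (flat Hs) = vsdeg ?vs"
    using reorder_vsdeg[OF r] by (simp only: map_append sum_list_append raise_lists add.commute)
  have tot: "total f (flat Hs) \<le> total f ?vs" if "f \<in> {nb, nr, nc, na}" for f
    unfolding reorder_total[OF r, symmetric] using that by (auto simp: raise_lists)
  have G: "model_compose s (DGraph os (ws @ map (composite_vert (model s) 1) Gs) is) =
      slot_elt s (length os) (length is) (vsdeg ?vs) (coefs ?vs)"
    unfolding model_compose_def gdeg_def
    using compose_flatten[OF assms(1) w dec, of "coefs ws" 1] by (simp add: raise_lists vsdeg_composite del: map_map)
  have e1: "vsdeg (map (composite_vert (model s) 2) Hs @ us) = vsdeg ?vs"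
    using vd by (simp only: map_append sum_list_append vsdeg_composite add.commute)
  have e2: "coefs (map (composite_vert (model s) 2) Hs @ us) = coefs us * coefs (map (composite_vert (model s) 2) Hs)"
    by simp
  have H: "model_compose s (DGraph os (map (composite_vert (model s) 2) Hs @ us) is) =
      slot_elt s (length os) (length is) (vsdeg ?vs) (coefs ?vs)"
    unfolding model_compose_def gdeg_def dgraph.sel e1 e2
    by (rule compose_flatten[OF assms(2) w dec co]) (rule tot, simp)+
  show ?thesis
  proof (cases "coefs ?vs = 0 \<or> slot s (length os) (length is) (vsdeg ?vs) = None")
    case True
    then show ?thesis unfolding G H by (auto simp: slot_elt_def split: option.splits)
  next
    case False
    \<comment> \<open>A nonzero value admits at most one odd vertex.\<close>
    then have "c = 1"
      using graph_admissible[OF w, of s] dec reorder_sign[OF r] admissible_odd by (auto simp: gdeg_def)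
    then show ?thesis unfolding G H by simp
  qed
qed

lemma dioperad_model: "dioperad (model s)"
  unfolding dioperad_def graph_monoid_def
proof (intro conjI)
  show "dg_sbimodule (model s)" by (rule dg_sbimodule_model)
  show "ident (model s) \<in> part (model s) 1 1 0"
    by (simp add: slot_space_def slot_def) (rule range_eqI[of _ _ 1], simp)
  show "diff (model s) (ident (model s)) = \<zero>\<^bsub>model s\<^esub>"
    by (simp add: model_diff_def lookup_one)
  show "\<exists>h. sbimod_hom (box tree2 (model s) (model s)) (model s) h \<and>
        (\<forall>G\<in>graphs (\<lambda>_. model s) tree2. h (graph_class (\<lambda>_. model s) tree2 (gen G)) = compose (model s) G)"
    by (rule exI[of _ "eval_coset s"]) (simp add: box_def model_compose_hom eval_coset_gen)
  show "\<forall>p d os ws is. let G = DGraph os (Vert p d 1 ws is #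
            map2 (\<lambda>out w. Vert (ident (model s)) 0 2 [out] [w]) os ws) is in
        length os = length ws \<and> wired G \<and> p \<in> part (model s) (length ws) (length is) d \<longrightarrow>
        compose (model s) G = p"
    unfolding Let_def model_simps model_compose_def gdeg_def
    by (clarsimp simp del: single_one map_map simp: unit_verts slot_elt_coef)
  show "\<forall>p d os ws is. let G = DGraph os (Vert p d 2 os ws #
            map2 (\<lambda>w inp. Vert (ident (model s)) 0 1 [w] [inp]) ws is) is in
        length ws = length is \<and> wired G \<and> p \<in> part (model s) (length os) (length ws) d \<longrightarrow>
        compose (model s) G = p"
    unfolding Let_def model_simps model_compose_def gdeg_def
    by (clarsimp simp del: single_one map_map simp: unit_verts slot_elt_coef)
  show "\<forall>os is ws us Gs Hs c.
        let G = DGraph os (ws @ map (composite_vert (model s) 1) Gs) is;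
            H = DGraph os (map (composite_vert (model s) 2) Hs @ us) is;
            flat = map raise ws @ concat (map verts Gs)
        in (\<forall>v\<in>set ws. level v = 2) \<and> (\<forall>v\<in>set us. level v = 1) \<and>
           set Gs \<subseteq> graphs (\<lambda>_. model s) tree2 \<and> set Hs \<subseteq> graphs (\<lambda>_. model s) tree2 \<and>
           G \<in> graphs (\<lambda>_. model s) tree2 \<and> H \<in> graphs (\<lambda>_. model s) tree2 \<and>
           wired (DGraph os flat is) \<and>
           reorder flat c (concat (map (\<lambda>K. map raise (verts K)) Hs) @ us) \<longrightarrow>
           compose (model s) G = c \<odot>\<^bsub>model s\<^esub> compose (model s) H"
    unfolding Let_def model_simps raise_flat graphs_model dgraph.sel
    by (intro allI impI, elim conjE, rule model_associative) (auto simp: graphs_model)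
qed

section \<open>The inclusion of the homology\<close>

lemma slot_False: "slot False m n d = Some i \<Longrightarrow> slot True m n d = Some i"
  by (auto simp: slot_def split: if_splits)

lemma slot_space_False: "slot_space False m n d \<subseteq> slot_space True m n d"
  by (cases "slot False m n d") (auto simp: slot_space_def slot_False split: option.split intro: range_eqI[of _ _ 0])

text \<open>The two models could differ only where the larger one has additional slots, in arity
  (2,0) and degrees 0 and -1. Composites of the small model in that arity contain as many vertices
  counted by \<open>nb\<close> as by \<open>na\<close>, so they have degree at most -2.\<close>

lemma model_compose_False:
  assumes "wired G" "\<forall>v\<in>set (verts G). decorated False v"
  shows "model_compose False G = model_compose True G"
proof (cases "coefs (verts G) = 0 \<or> slot False (length (gouts G)) (length (gins G)) (gdeg G) \<noteq> None")
  case True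
  then show ?thesis using slot_False by (auto simp: model_compose_def slot_elt_def split: option.splits)
next
  case False
  have "slot True (length (gouts G)) (length (gins G)) (gdeg G) = None"
  proof (rule ccontr)
    assume *: "slot True (length (gouts G)) (length (gins G)) (gdeg G) \<noteq> None"
    with False have "length (gouts G) = 2" "length (gins G) = 0" "gdeg G = 0 \<or> gdeg G = -1"
      by (auto simp: slot_def split: if_splits)
    with graph_balanced[OF assms] False show False by auto
  qed
  then show ?thesis using False by (auto simp: model_compose_def slot_elt_def split: option.splits)
qed

lemma inclusion_hom: "dioperad_hom (model False) (model True) id"
  using slot_space_False
  by (auto simp: dioperad_hom_def sbimod_hom_def linear_on_part_def graphs_model dgraph.map_id
      model_compose_False)


lemma boundaries_model:
  "boundaries (model s) m n d = (if s \<and> m = 2 \<and> n = 0 \<and> d = -1 then range (Poly_Mapping.single 2) else {0})"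
proof (cases "s \<and> m = 2 \<and> n = 0 \<and> d = -1")
  case True
  then have "slot s m n (d + 1) = Some 1" by (simp add: slot_def)
  then show ?thesis using True
    by (auto simp: boundaries_def slot_space_def model_diff_def image_image lookup_single image_iff)
next
  case False
  then have "model_diff x = 0" if "x \<in> slot_space s m n (d + 1)" for x :: "nat \<Rightarrow>\<^sub>0 'a"
    using model_diff_slot[OF that] by auto
  then show ?thesis using False slot_space_closed(1)[of s m n "d + 1"] by (auto simp: boundaries_def)
qed

lemma homology_model:
  "homology (model s) m n d = (\<lambda>x. boundaries (model s) m n d + {x}) ` {x \<in> slot_space s m n d. model_diff x = 0}"
  by (simp add: homology_def cycles_def a_coset_plus)

lemma slot_space_True: "\<not> (m = 2 \<and> n = 0 \<and> (d = 0 \<or> d = -1)) \<Longrightarrow> slot_space True m n d = slot_space False m n d"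
  by (auto simp: slot_space_def slot_def)

lemma inclusion_quasi_iso: "quasi_iso (model False) (model True :: ('k::field, nat \<Rightarrow>\<^sub>0 'k) properad) id"
  unfolding quasi_iso_def
proof (intro allI)
  fix m n :: nat and d :: int
  let ?B = "boundaries (model True :: ('k, nat \<Rightarrow>\<^sub>0 'k) properad) m n d"
  let ?H = "\<lambda>s. homology (model s :: ('k, nat \<Rightarrow>\<^sub>0 'k) properad) m n d"
  have f: "coset_map (model True) ?B id X = ?B + X" for X
    by (simp add: coset_map_plus)
  consider "m = 2 \<and> n = 0 \<and> d = 0" | "m = 2 \<and> n = 0 \<and> d = -1" | "\<not> (m = 2 \<and> n = 0 \<and> (d = 0 \<or> d = -1))"
    by blast
  then show "bij_betw (coset_map (model True) ?B id) (?H False) (?H True)"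
  proof cases
    case 1
    then have sp: "slot_space False m n d = {0 :: nat \<Rightarrow>\<^sub>0 'k}" "slot_space True m n d = range (Poly_Mapping.single 1 :: 'k \<Rightarrow> _)"
      by (simp_all add: slot_space_def slot_def)
    have B: "boundaries (model s) m n d = {0 :: nat \<Rightarrow>\<^sub>0 'k}" for s
      using 1 by (simp add: boundaries_model)
    \<comment> \<open>\<open>q\<close> is not a cycle, so this degree carries no homology on either
      side.\<close>
    have K: "{x \<in> range (Poly_Mapping.single 1 :: 'k \<Rightarrow> _). model_diff x = 0} = {0}"
      by (auto simp: model_diff_def lookup_single image_iff intro: exI[of _ 0]) (metis single_zero lookup_single_eq)+
    have "?H False = {{0}}" unfolding homology_model sp B by (auto simp: set_plus_def image_iff)
    moreover have "?H True = {{0}}" unfolding homology_model sp B K by (auto simp: set_plus_def)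
    ultimately show ?thesis using f[of "{0}"] by (simp add: bij_betw_def B set_plus_def)
  next
    case 2
    let ?R = "range (Poly_Mapping.single 2 :: 'k \<Rightarrow> _)"
    have sp: "slot_space False m n d = {0 :: nat \<Rightarrow>\<^sub>0 'k}" "slot_space True m n d = ?R"
      using 2 by (simp_all add: slot_space_def slot_def)
    have R: "?R + {Poly_Mapping.single 2 c} = ?R" for c
    proof
      show "?R + {Poly_Mapping.single 2 c} \<subseteq> ?R" by (auto simp: set_plus_def simp flip: single_add)
      show "?R \<subseteq> ?R + {Poly_Mapping.single 2 c}"
      proof
        fix x assume "x \<in> ?R"
        then obtain b where "x = Poly_Mapping.single 2 (b - c) + Poly_Mapping.single 2 c"
          by (auto simp flip: single_add)
        then show "x \<in> ?R + {Poly_Mapping.single 2 c}" by (auto simp: set_plus_def)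
      qed
    qed
    \<comment> \<open>Every multiple of \<open>r\<close> is a boundary, which leaves one homology
      class.\<close>
    have B: "?B = ?R" using 2 by (simp add: boundaries_model)
    have "{x \<in> ?R. model_diff x = 0} = ?R" by (auto simp: model_diff_def lookup_single)
    then have "?H True = {?R}" unfolding homology_model sp B by (auto simp: R image_iff)
    moreover have "?H False = {{0}}"
      unfolding homology_model sp boundaries_model by (auto simp: set_plus_def image_iff)
    moreover have "?R + {0} = ?R" using R[of 0] by simp
    ultimately show ?thesis using f[of "{0}"] by (simp add: bij_betw_def B)
  next
    case 3
    \<comment> \<open>Away from \<open>q\<close> and \<open>r\<close> the components agree and only
      zero is a boundary.\<close>
    then have B: "?B = {0}" and H: "?H True = ?H False"
      by (auto simp: homology_model boundaries_model slot_space_True)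
    have "coset_map (model True) ?B id X = X" for X
      by (simp only: f) (auto simp: B set_plus_def)
    then have "coset_map (model True) ?B id = (\<lambda>X. X)" by (rule ext)
    then show ?thesis unfolding H by (simp only:) (simp add: bij_betw_def)
  qed
qed

section \<open>Position-free descriptions of connectedness and acyclicity\<close>

definition wires :: "'a vert \<Rightarrow> nat set" where
  "wires v = set (outs v) \<union> set (ins v)"

definition wire_set :: "'a dgraph \<Rightarrow> nat set" where
  "wire_set G = (\<Union>v\<in>set (verts G). wires v)"

text \<open>Connectedness tested by two-colourings of wires. Wires, unlike positions in the list of
  vertices, are easy to follow through a substitution. A vertex without wires is invisible
  here.\<close>

definition rigid :: "'a dgraph \<Rightarrow> bool" where
  "rigid G \<longleftrightarrow> (\<forall>\<kappa> :: nat \<Rightarrow> bool. (\<forall>v\<in>set (verts G). \<forall>x\<in>wires v. \<forall>y\<in>wires v. \<kappa> x = \<kappa> y) \<longrightarrow>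
     (\<forall>x\<in>wire_set G. \<forall>y\<in>wire_set G. \<kappa> x = \<kappa> y))"

lemma rigidD:
  fixes \<kappa> :: "nat \<Rightarrow> bool"
  assumes "rigid G" "\<And>v x y. v \<in> set (verts G) \<Longrightarrow> x \<in> wires v \<Longrightarrow> y \<in> wires v \<Longrightarrow> \<kappa> x = \<kappa> y"
    "x \<in> wire_set G" "y \<in> wire_set G"
  shows "\<kappa> x = \<kappa> y"
  using spec[OF assms(1)[unfolded rigid_def], of \<kappa>] assms(2-4) by blast

text \<open>Acyclicity in terms of wires: a rank that increases through every vertex. Ranks of
  several graphs can be combined by adding offsets.\<close>

definition ranked :: "'a dgraph \<Rightarrow> bool" where
  "ranked G \<longleftrightarrow> (\<exists>\<rho> :: nat \<Rightarrow> nat. \<forall>v\<in>set (verts G). \<forall>x\<in>set (ins v). \<forall>y\<in>set (outs v). \<rho> x < \<rho> y)"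

lemma concat_index_unique:
  "distinct (concat (map f xs)) \<Longrightarrow> k < length xs \<Longrightarrow> l < length xs \<Longrightarrow>
   x \<in> set (f (xs ! k)) \<Longrightarrow> x \<in> set (f (xs ! l)) \<Longrightarrow> k = l"
proof (induction xs arbitrary: k l)
  case (Cons a xs)
  have "x \<in> set (concat (map f xs))" if "n < length xs" "x \<in> set (f (xs ! n))" for n
    using that by auto
  then show ?case using Cons by (cases k; cases l) (auto simp: disjoint_iff)
qed simp

lemma wired_distinct:
  assumes "wired G"
  shows "distinct (concat (map outs (verts G)))" "distinct (concat (map ins (verts G)))"
    "distinct (gins G)" "distinct (gouts G)"
    "v \<in> set (verts G) \<Longrightarrow> set (gins G) \<inter> set (outs v) = {}"
    "v \<in> set (verts G) \<Longrightarrow> set (gouts G) \<inter> set (ins v) = {}"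
  using assms by (auto simp: wired_def)

lemma wired_source:
  assumes "wired G"
  shows "x \<in> set (gouts G) \<Longrightarrow> x \<in> set (gins G) \<or> (\<exists>v\<in>set (verts G). x \<in> set (outs v))"
    "x \<in> set (gins G) \<Longrightarrow> x \<in> set (gouts G) \<or> (\<exists>v\<in>set (verts G). x \<in> set (ins v))"
    "v \<in> set (verts G) \<Longrightarrow> x \<in> set (ins v) \<Longrightarrow> x \<in> set (gins G) \<or> (\<exists>v\<in>set (verts G). x \<in> set (outs v))"
    "v \<in> set (verts G) \<Longrightarrow> x \<in> set (outs v) \<Longrightarrow> x \<in> set (gouts G) \<or> (\<exists>v\<in>set (verts G). x \<in> set (ins v))"
proof -
  have "set (gins G) \<union> (\<Union>v\<in>set (verts G). set (outs v)) = set (gouts G) \<union> (\<Union>v\<in>set (verts G). set (ins v))"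
    using assms by (auto simp: wired_def)
  then show "x \<in> set (gouts G) \<Longrightarrow> x \<in> set (gins G) \<or> (\<exists>v\<in>set (verts G). x \<in> set (outs v))"
    "x \<in> set (gins G) \<Longrightarrow> x \<in> set (gouts G) \<or> (\<exists>v\<in>set (verts G). x \<in> set (ins v))"
    "v \<in> set (verts G) \<Longrightarrow> x \<in> set (ins v) \<Longrightarrow> x \<in> set (gins G) \<or> (\<exists>v\<in>set (verts G). x \<in> set (outs v))"
    "v \<in> set (verts G) \<Longrightarrow> x \<in> set (outs v) \<Longrightarrow> x \<in> set (gouts G) \<or> (\<exists>v\<in>set (verts G). x \<in> set (ins v))"
    by blast+
qed

abbreviation links :: "'a dgraph \<Rightarrow> (nat \<times> nat) set" where
  "links G \<equiv> (arrows G \<union> (arrows G)\<inverse>)\<^sup>*"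

text \<open>A wire shared by two different vertices leaves one of them and enters the other, since
  sources and targets are unique.\<close>

lemma links_shared:
  assumes "wired G" "k < length (verts G)" "l < length (verts G)" "x \<in> wires (verts G ! k)" "x \<in> wires (verts G ! l)"
  shows "(k, l) \<in> links G"
proof -
  consider "k = l" | "(k, l) \<in> arrows G" | "(l, k) \<in> arrows G"
    using assms concat_index_unique[OF wired_distinct(1)[OF assms(1)] assms(2,3)]
      concat_index_unique[OF wired_distinct(2)[OF assms(1)] assms(2,3)]
    unfolding arrows_def wires_def by blast
  then show ?thesis by cases auto
qed

lemma links_wires:
  assumes "(i, k) \<in> links G" "i \<noteq> k"
  shows "wires (verts G ! i) \<noteq> {}"
proof -
  obtain j where "(i, j) \<in> arrows G \<union> (arrows G)\<inverse>"
    using assms by (meson converse_rtranclE)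
  then show ?thesis by (auto simp: arrows_def wires_def)
qed

text \<open>A vertex without wires has no links, so it can occur only as the sole vertex. Otherwise
  rigidity, applied to the colouring by reachability from one vertex, yields the links.\<close>

lemma connected_iff:
  assumes "wired G" "verts G \<noteq> []"
  shows "(\<forall>i<length (verts G). \<forall>j<length (verts G). (i, j) \<in> links G) \<longleftrightarrow>
    rigid G \<and> (length (verts G) = 1 \<or> (\<forall>v\<in>set (verts G). wires v \<noteq> {}))"
proof (intro iffI conjI)
  assume c: "\<forall>i<length (verts G). \<forall>j<length (verts G). (i, j) \<in> links G"
  show "rigid G" unfolding rigid_def
  proof (intro allI impI ballI)
    fix \<kappa> :: "nat \<Rightarrow> bool" and x y
    assume k: "\<forall>v\<in>set (verts G). \<forall>x\<in>wires v. \<forall>y\<in>wires v. \<kappa> x = \<kappa> y"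
      and xy: "x \<in> wire_set G" "y \<in> wire_set G"
    then obtain i j where ij: "i < length (verts G)" "j < length (verts G)"
      "x \<in> wires (verts G ! i)" "y \<in> wires (verts G ! j)"
      unfolding wire_set_def by (auto simp: in_set_conv_nth)
    have "(i, j) \<in> links G" using c ij by blast
    then have "\<forall>y\<in>wires (verts G ! j). \<kappa> x = \<kappa> y"
    proof induction
      case base then show ?case using k ij by (meson nth_mem)
    next
      case (step j k')
      then obtain w where "w \<in> wires (verts G ! j)" "w \<in> wires (verts G ! k')" "k' < length (verts G)"
        by (auto simp: arrows_def wires_def)
      then show ?case using step.IH k by (metis nth_mem)
    qed
    then show "\<kappa> x = \<kappa> y" using ij by blast
  qed
  show "length (verts G) = 1 \<or> (\<forall>v\<in>set (verts G). wires v \<noteq> {})"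
  proof (rule disjCI, rule ccontr)
    assume a: "\<not> (\<forall>v\<in>set (verts G). wires v \<noteq> {})" "length (verts G) \<noteq> 1"
    then obtain i where i: "i < length (verts G)" "wires (verts G ! i) = {}" by (auto simp: in_set_conv_nth)
    define k :: nat where "k = (if i = 0 then 1 else 0)"
    have "length (verts G) \<noteq> 0" using assms(2) by simp
    then have "k < length (verts G)" "i \<noteq> k" using a(2) i by (auto simp: k_def)
    then show False using links_wires[of i k G] c i by blast
  qed
next
  assume r: "rigid G \<and> (length (verts G) = 1 \<or> (\<forall>v\<in>set (verts G). wires v \<noteq> {}))"
  show "\<forall>i<length (verts G). \<forall>j<length (verts G). (i, j) \<in> links G"
  proof (intro allI impI)
    fix i j assume ij: "i < length (verts G)" "j < length (verts G)"
    show "(i, j) \<in> links G"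
    proof (cases "length (verts G) = 1")
      case True then show ?thesis using ij by simp
    next
      case False
      define \<kappa> where "\<kappa> w \<longleftrightarrow> (\<exists>k<length (verts G). (i, k) \<in> links G \<and> w \<in> wires (verts G ! k))" for w
      have step: "(i, l) \<in> links G" if "\<kappa> x" "x \<in> wires (verts G ! l)" "l < length (verts G)" for x l
        using that links_shared[OF assms(1)] unfolding \<kappa>_def by (meson rtrancl_trans)
      have "\<forall>v\<in>set (verts G). \<forall>x\<in>wires v. \<forall>y\<in>wires v. \<kappa> x = \<kappa> y"
      proof -
        have "\<kappa> y" if "v \<in> set (verts G)" "x \<in> wires v" "y \<in> wires v" "\<kappa> x" for v x y
        proof -
          obtain l where "l < length (verts G)" "v = verts G ! l" using \<open>v \<in> set (verts G)\<close> by (auto simp: in_set_conv_nth)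
          then show ?thesis using step[of x l] that unfolding \<kappa>_def by blast
        qed
        then show ?thesis by blast
      qed
      then have c: "\<forall>x\<in>wire_set G. \<forall>y\<in>wire_set G. \<kappa> x = \<kappa> y" using rigidD[of G \<kappa>] r by blast
      obtain x y where xy: "x \<in> wires (verts G ! i)" "y \<in> wires (verts G ! j)"
        using r False ij by (meson all_not_in_conv nth_mem)
      then have "\<kappa> x" using ij by (auto simp: \<kappa>_def)
      moreover have "x \<in> wire_set G" "y \<in> wire_set G" using xy ij by (auto simp: wire_set_def)
      ultimately have "\<kappa> y" using c by blast
      then show ?thesis using step xy ij by blast
    qed
  qed
qed

lemma finite_arrows: "finite (arrows G)"
  by (rule finite_subset[of _ "{..<length (verts G)} \<times> {..<length (verts G)}"]) (auto simp: arrows_def)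

lemma acyclic_iff:
  assumes "wired G"
  shows "acyclic (arrows G) \<longleftrightarrow> ranked G"
proof
  assume ac: "acyclic (arrows G)"
  \<comment> \<open>The number of ancestors, which strictly grows along arrows in the absence of
    cycles.\<close>
  define ht where "ht i = card {k. (k, i) \<in> (arrows G)\<^sup>+}" for i
  have fin: "finite {k. (k, i) \<in> (arrows G)\<^sup>+}" for i
    by (rule finite_subset[of _ "Domain (arrows G)"])
      (auto simp: finite_Domain[OF finite_arrows] dest!: tranclD)
  have ht: "ht i < ht j" if "(i, j) \<in> arrows G" for i j
    unfolding ht_def
  proof (rule psubset_card_mono[OF fin])
    have "i \<notin> {k. (k, i) \<in> (arrows G)\<^sup>+}" using ac by (simp add: acyclic_def)
    moreover have "i \<in> {k. (k, j) \<in> (arrows G)\<^sup>+}" using that by auto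
    moreover have "{k. (k, i) \<in> (arrows G)\<^sup>+} \<subseteq> {k. (k, j) \<in> (arrows G)\<^sup>+}"
      using that by (auto intro: trancl_into_trancl)
    ultimately show "{k. (k, i) \<in> (arrows G)\<^sup>+} \<subset> {k. (k, j) \<in> (arrows G)\<^sup>+}" by blast
  qed
  define src where "src w = (THE i. i < length (verts G) \<and> w \<in> set (outs (verts G ! i)))" for w
  have src: "src w = i" if "i < length (verts G)" "w \<in> set (outs (verts G ! i))" for w i
    unfolding src_def using that concat_index_unique[OF wired_distinct(1)[OF assms]] by blast
  \<comment> \<open>\<open>Suc\<close> keeps every wire with a source vertex above the global
    inputs, which have rank 0.\<close>
  define \<rho> where "\<rho> w = (if \<exists>v\<in>set (verts G). w \<in> set (outs v) then Suc (ht (src w)) else 0)" for w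
  have "\<rho> x < \<rho> y" if v: "v \<in> set (verts G)" "x \<in> set (ins v)" "y \<in> set (outs v)" for v x y
  proof -
    obtain i where i: "i < length (verts G)" "v = verts G ! i" using v(1) by (auto simp: in_set_conv_nth)
    have y: "\<rho> y = Suc (ht i)" using i v src by (auto simp: \<rho>_def)
    show ?thesis
    proof (cases "\<exists>v\<in>set (verts G). x \<in> set (outs v)")
      case True
      then obtain k where k: "k < length (verts G)" "x \<in> set (outs (verts G ! k))" by (metis in_set_conv_nth)
      then have "(k, i) \<in> arrows G" using i v by (auto simp: arrows_def)
      then show ?thesis using y True ht src k by (auto simp: \<rho>_def)
    qed (simp add: y, simp add: \<rho>_def)
  qed
  then show "ranked G" unfolding ranked_def by blast
next
  assume "ranked G"
  then obtain \<rho> :: "nat \<Rightarrow> nat" where \<rho>: "\<And>v x y. v \<in> set (verts G) \<Longrightarrow> x \<in> set (ins v) \<Longrightarrow> y \<in> set (outs v) \<Longrightarrow> \<rho> x < \<rho> y"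
    unfolding ranked_def by blast
  \<comment> \<open>Ranks do not drop from an output of the start to an input of the end of a path;
    on a cycle this contradicts the increase through the vertex itself.\<close>
  have path: "\<exists>w\<in>set (outs (verts G ! i)). \<exists>w'\<in>set (ins (verts G ! j)). \<rho> w \<le> \<rho> w'"
    if "(i, j) \<in> (arrows G)\<^sup>+" for i j
    using that
  proof induction
    case (base j) then show ?case by (auto simp: arrows_def)
  next
    case (step j k)
    then obtain w w' where w: "w \<in> set (outs (verts G ! i))" "w' \<in> set (ins (verts G ! j))" "\<rho> w \<le> \<rho> w'" by blast
    obtain z where z: "z \<in> set (outs (verts G ! j))" "z \<in> set (ins (verts G ! k))" "j < length (verts G)"
      using step(2) by (auto simp: arrows_def)
    have "\<rho> w' < \<rho> z" using \<rho> w z by (meson nth_mem)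
    then show ?case using w z by (meson le_trans less_imp_le)
  qed
  show "acyclic (arrows G)" unfolding acyclic_def
  proof (intro allI notI)
    fix i assume i: "(i, i) \<in> (arrows G)\<^sup>+"
    then have "i < length (verts G)" by (auto simp: arrows_def elim: tranclE)
    then show False using path[OF i] \<rho>[of "verts G ! i"] by (meson leD nth_mem)
  qed
qed

lemma flow_iff:
  assumes "wired G"
  shows "flow G \<longleftrightarrow> (\<forall>v\<in>set (verts G). level v = 0) \<and>
    (if verts G = [] then length (gins G) = 1 else set (gins G) \<inter> set (gouts G) = {} \<and> rigid G \<and>
      (length (verts G) = 1 \<or> (\<forall>v\<in>set (verts G). wires v \<noteq> {}))) \<and> ranked G"
  using connected_iff[OF assms] unfolding flow_def connected_graph_def acyclic_iff[OF assms] by auto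

text \<open>Apart from the number of vertices, all conditions of \<open>flow_iff\<close> on vertices
  quantify over the set of these triples. So the order of slots, the order of vertices and the
  decorations do not matter.\<close>

lemma flow_cong:
  fixes G G' :: "'a dgraph"
  assumes "wired G" "wired G'" "flow G" "set (gins G') = set (gins G)" "set (gouts G') = set (gouts G)"
    "length (gins G') = length (gins G)" "length (verts G') = length (verts G)"
    "(\<lambda>v. (level v, set (outs v), set (ins v))) ` set (verts G') = (\<lambda>v. (level v, set (outs v), set (ins v))) ` set (verts G)"
  shows "flow G'"
proof -
  let ?T = "\<lambda>H :: 'a dgraph. (\<lambda>v. (level v, set (outs v), set (ins v))) ` set (verts H)"
  let ?U = "\<lambda>t :: nat \<times> nat set \<times> nat set. fst (snd t) \<union> snd (snd t)"
  have lev: "(\<forall>v\<in>set (verts H). level v = 0) \<longleftrightarrow> (\<forall>t\<in>?T H. fst t = 0)" for H :: "'a dgraph" by simp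
  have ws: "wire_set H = (\<Union>t\<in>?T H. ?U t)" for H :: "'a dgraph" by (simp add: wire_set_def wires_def)
  have ne: "(\<forall>v\<in>set (verts H). wires v \<noteq> {}) \<longleftrightarrow> (\<forall>t\<in>?T H. ?U t \<noteq> {})" for H :: "'a dgraph" by (simp add: wires_def)
  have rk: "ranked H \<longleftrightarrow> (\<exists>\<rho> :: nat \<Rightarrow> nat. \<forall>t\<in>?T H. \<forall>x\<in>snd (snd t). \<forall>y\<in>fst (snd t). \<rho> x < \<rho> y)" for H :: "'a dgraph"
    by (simp add: ranked_def)
  have rg: "rigid H \<longleftrightarrow> (\<forall>\<kappa> :: nat \<Rightarrow> bool. (\<forall>t\<in>?T H. \<forall>x\<in>?U t. \<forall>y\<in>?U t. \<kappa> x = \<kappa> y) \<longrightarrow>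
     (\<forall>x\<in>wire_set H. \<forall>y\<in>wire_set H. \<kappa> x = \<kappa> y))" for H :: "'a dgraph"
    by (simp only: rigid_def wires_def ball_simps fst_conv snd_conv)
  have nil: "verts G' = [] \<longleftrightarrow> verts G = []" using assms(7) by (metis length_0_conv)
  have "flow G' = flow G"
    unfolding flow_iff[OF assms(1)] flow_iff[OF assms(2)] lev ne rk rg ws assms(4-8) nil by (rule HOL.refl)
  then show ?thesis using assms(3) by blast
qed

lemma flow_rename:
  assumes "inj f" "wired G" "flow G"
  shows "flow (rename_wires f G)"
proof -
  have w: "wired (rename_wires f G)" using assms by (simp add: wired_rename)
  have wi: "wires (rename_vert f v) = f ` wires v" for v :: "'a vert" by (auto simp: wires_def)
  have fl: "\<forall>v\<in>set (verts G). level v = 0"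
    "if verts G = [] then length (gins G) = 1 else set (gins G) \<inter> set (gouts G) = {} \<and> rigid G \<and>
      (length (verts G) = 1 \<or> (\<forall>v\<in>set (verts G). wires v \<noteq> {}))" "ranked G"
    using assms(3) flow_iff[OF assms(2)] by auto
  have "rigid (rename_wires f G)" if r: "rigid G"
    unfolding rigid_def
  proof (intro allI impI)
    fix \<kappa> :: "nat \<Rightarrow> bool"
    assume k: "\<forall>v\<in>set (verts (rename_wires f G)). \<forall>x\<in>wires v. \<forall>y\<in>wires v. \<kappa> x = \<kappa> y"
    have "\<kappa> (f x) = \<kappa> (f y)" if "v \<in> set (verts G)" "x \<in> wires v" "y \<in> wires v" for v x y
      by (rule k[rule_format, of "rename_vert f v"]) (use that in \<open>auto simp: wi\<close>)
    then have "\<kappa> (f x) = \<kappa> (f y)" if "x \<in> wire_set G" "y \<in> wire_set G" for x y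
      by (rule rigidD[OF r _ that, of "\<lambda>x. \<kappa> (f x)"])
    then show "\<forall>x\<in>wire_set (rename_wires f G). \<forall>y\<in>wire_set (rename_wires f G). \<kappa> x = \<kappa> y"
      unfolding wire_set_def rename_simps set_map image_image wi by blast
  qed
  moreover have "ranked (rename_wires f G)"
  proof -
    obtain \<rho> :: "nat \<Rightarrow> nat" where \<rho>: "\<And>v x y. v \<in> set (verts G) \<Longrightarrow> x \<in> set (ins v) \<Longrightarrow> y \<in> set (outs v) \<Longrightarrow> \<rho> x < \<rho> y"
      using fl(3) unfolding ranked_def by blast
    then show ?thesis unfolding ranked_def
      by (intro exI[of _ "\<rho> \<circ> inv_into UNIV f"]) (auto simp: inv_f_f[OF assms(1)])
  qed
  moreover have "set (map f (gins G)) \<inter> set (map f (gouts G)) = {}" if "set (gins G) \<inter> set (gouts G) = {}"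
    using that assms(1) by (auto dest: injD)
  ultimately show ?thesis unfolding flow_iff[OF w] using fl(1,2) by (auto simp: wi)
qed

lemma stable_flow: "stable flow"
  unfolding stable_def
proof (intro conjI allI impI)
  fix f :: "nat \<Rightarrow> nat" and G :: "'a dgraph" assume "inj f" "wired G" "flow G"
  then show "flow (rename_wires f G)" by (rule flow_rename)
next
  fix gos vs gis ws and v w :: "'a vert"
  assume a: "wired (DGraph gos (vs @ v # w # ws) gis)" "flow (DGraph gos (vs @ v # w # ws) gis)"
  then have "wired (DGraph gos (vs @ w # v # ws) gis)"
    by (subst wired_mset_cong[where G' = "DGraph gos (vs @ v # w # ws) gis"]) simp_all
  from flow_cong[OF a(1) this a(2)] show "flow (DGraph gos (vs @ w # v # ws) gis)" by (simp add: insert_commute)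
next
  fix gos vs gis ws and x y :: 'a and d l os "is" d' os' is'
  assume a: "wired (DGraph gos (vs @ Vert x d l os is # ws) gis)" "flow (DGraph gos (vs @ Vert x d l os is # ws) gis)"
    and m: "mset os' = mset os" "mset is' = mset is"
  then have "wired (DGraph gos (vs @ Vert y d' l os' is' # ws) gis)"
    by (subst wired_mset_cong[where G' = "DGraph gos (vs @ Vert x d l os is # ws) gis"]) simp_all
  moreover have "set os' = set os" "set is' = set is" using m by (metis set_mset_mset)+
  ultimately show "flow (DGraph gos (vs @ Vert y d' l os' is' # ws) gis)"
    by (intro flow_cong[OF a(1) _ a(2)]) simp_all
qed

section \<open>Substitution of graphs\<close>

lemma distinct_concat_upt:
  assumes "\<And>i. i < n \<Longrightarrow> distinct (f i)" "\<And>i j. i < n \<Longrightarrow> j < n \<Longrightarrow> i \<noteq> j \<Longrightarrow> set (f i) \<inter> set (f j) = {}"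
  shows "distinct (concat (map f [0..<n]))"
  using assms
proof (induction n)
  case (Suc n)
  have "set (f i) \<inter> set (f n) = {}" if "i < n" for i using Suc.prems(2)[of i n] that by simp
  moreover have "distinct (concat (map f [0..<n]))" using Suc by simp
  ultimately show ?case using Suc.prems(1)[of n] by (auto simp: disjoint_iff)
qed simp

lemma in_concat_upt: "y \<in> set (concat (map f [0..<n])) \<longleftrightarrow> (\<exists>i<n. y \<in> set (f i))"
  by auto

lemma mset_concat_upt: "mset (concat (map f [0..<n])) = (\<Sum>i<n. mset (f i))"
  by (induction n) auto

lemma mset_concat_nth: "mset (concat (map f xs)) = (\<Sum>i<length xs. mset (f (xs ! i)))"
proof -
  have "map f xs = map (\<lambda>i. f (xs ! i)) [0..<length xs]" by (rule nth_equalityI) auto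
  then show ?thesis by (simp only: mset_concat_upt)
qed

lemma map_map_of_zip:
  assumes "distinct xs" "length xs = length ys"
  shows "map (\<lambda>z. case map_of (zip xs ys) z of Some w \<Rightarrow> w | None \<Rightarrow> d z) xs = ys"
  using assms by (intro nth_equalityI) (auto simp: map_of_zip_nth)

lemma trivial_graph:
  assumes "wired G" "flow G" "verts G = []"
  shows "\<exists>z. gins G = [z] \<and> gouts G = [z]"
proof -
  have "length (gins G) = 1" using assms flow_iff[OF assms(1)] by auto
  moreover have "length (gouts G) = length (gins G)" "set (gouts G) = set (gins G)"
    using wired_length[OF assms(1)] assms(1,3) by (auto simp: wired_def)
  ultimately show ?thesis by (cases "gins G"; cases "gouts G") auto
qed

lemma legs_attached:
  assumes "wired G" "flow G" "verts G \<noteq> []"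
  shows "x \<in> set (gouts G) \<Longrightarrow> \<exists>v\<in>set (verts G). x \<in> set (outs v)"
    "x \<in> set (gins G) \<Longrightarrow> \<exists>v\<in>set (verts G). x \<in> set (ins v)"
    "set (gins G) \<inter> set (gouts G) = {}"
  using assms flow_iff[OF assms(1)] wired_source(1,2)[OF assms(1), of x] by auto

text \<open>The situation in \<open>free_compose\<close>: flow graphs of matching arities are to be
  inserted at the vertices of a connected 2-levelled graph.\<close>

locale composable =
  fixes G :: "'b dgraph" and Gs :: "'a dgraph list"
  assumes wired_G: "wired G" and conn_G: "conn2 G"
    and len: "length Gs = length (verts G)"
    and wired_Gs: "i < length Gs \<Longrightarrow> wired (Gs ! i)"
    and flow_Gs: "i < length Gs \<Longrightarrow> flow (Gs ! i)"
    and gouts_Gs: "i < length Gs \<Longrightarrow> length (gouts (Gs ! i)) = length (outs (verts G ! i))"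
    and gins_Gs: "i < length Gs \<Longrightarrow> length (gins (Gs ! i)) = length (ins (verts G ! i))"
begin

abbreviation "N \<equiv> length Gs"
abbreviation "outs_at i \<equiv> outs (verts G ! i)"
abbreviation "ins_at i \<equiv> ins (verts G ! i)"
abbreviation "level_at i \<equiv> level (verts G ! i)"
abbreviation "inner_outs i \<equiv> concat (map outs (verts (Gs ! i)))"
abbreviation "inner_ins i \<equiv> concat (map ins (verts (Gs ! i)))"
abbreviation "triv i \<equiv> verts (Gs ! i) = []"

lemma levels: "i < N \<Longrightarrow> level_at i = 1 \<or> level_at i = 2"
  using conn_G len by (auto simp: conn2_def two_levelled_def)

lemma level_1: "i < N \<Longrightarrow> level_at i = 1 \<Longrightarrow> x \<in> set (ins_at i) \<Longrightarrow> x \<in> set (gins G)"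
  using conn_G len by (auto simp: conn2_def two_levelled_def)

lemma level_2: "i < N \<Longrightarrow> level_at i = 2 \<Longrightarrow> x \<in> set (outs_at i) \<Longrightarrow> x \<in> set (gouts G)"
  using conn_G len by (auto simp: conn2_def two_levelled_def)

lemma outs_unique: "i < N \<Longrightarrow> j < N \<Longrightarrow> x \<in> set (outs_at i) \<Longrightarrow> x \<in> set (outs_at j) \<Longrightarrow> i = j"
  using concat_index_unique[OF wired_distinct(1)[OF wired_G], of i j x] len by simp

lemma ins_unique: "i < N \<Longrightarrow> j < N \<Longrightarrow> x \<in> set (ins_at i) \<Longrightarrow> x \<in> set (ins_at j) \<Longrightarrow> i = j"
  using concat_index_unique[OF wired_distinct(2)[OF wired_G], of i j x] len by simp

lemma gins_outs: "x \<in> set (gins G) \<Longrightarrow> i < N \<Longrightarrow> x \<notin> set (outs_at i)"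
  using wired_distinct(5)[OF wired_G, of "verts G ! i"] len by auto

lemma gouts_ins: "x \<in> set (gouts G) \<Longrightarrow> i < N \<Longrightarrow> x \<notin> set (ins_at i)"
  using wired_distinct(6)[OF wired_G, of "verts G ! i"] len by auto

lemma level_2_gins:
  assumes "i < N" "level_at i = 2" "x \<in> set (ins_at i)" shows "x \<notin> set (gins G)"
proof
  assume "x \<in> set (gins G)"
  then obtain v where "v \<in> set (verts G)" "level v = 1" "x \<in> set (ins v)"
    using conn_G by (auto simp: conn2_def two_levelled_def)
  then obtain j where "j < N" "level_at j = 1" "x \<in> set (ins_at j)" using len by (metis in_set_conv_nth)
  then show False using ins_unique assms by fastforce
qed

lemma nonempty: "verts G \<noteq> []"
proof
  assume "verts G = []"
  then show False using conn_G by (auto simp: conn2_def connected_graph_def two_levelled_def)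
qed

lemma trivial_at:
  assumes "i < N" "triv i"
  shows "\<exists>a b z. ins_at i = [a] \<and> outs_at i = [b] \<and> gins (Gs ! i) = [z] \<and> gouts (Gs ! i) = [z]"
proof -
  obtain z where "gins (Gs ! i) = [z]" "gouts (Gs ! i) = [z]"
    using trivial_graph wired_Gs flow_Gs assms by blast
  then show ?thesis using gouts_Gs[OF assms(1)] gins_Gs[OF assms(1)]
    by (cases "ins_at i"; cases "outs_at i") auto
qed

text \<open>
  A trivial graph merges the two wires at its vertex into the inner one; in a 2-levelled graph no
  two trivial graphs meet in a way that would require a longer chain of identifications.
\<close>

definition merge :: "nat \<Rightarrow> nat" where
  "merge w =
    (if \<exists>i<N. triv i \<and> level_at i = 1 \<and> w \<in> set (ins_at i)
     then hd (outs_at (THE i. i < N \<and> w \<in> set (ins_at i)))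
     else if \<exists>i<N. triv i \<and> level_at i = 2 \<and> w \<in> set (outs_at i)
     then hd (ins_at (THE i. i < N \<and> w \<in> set (outs_at i))) else w)"

lemma the_ins: "i < N \<Longrightarrow> w \<in> set (ins_at i) \<Longrightarrow> (THE i. i < N \<and> w \<in> set (ins_at i)) = i"
  using ins_unique by blast

lemma the_outs: "i < N \<Longrightarrow> w \<in> set (outs_at i) \<Longrightarrow> (THE i. i < N \<and> w \<in> set (outs_at i)) = i"
  using outs_unique by blast

lemma merge_ins_1: "i < N \<Longrightarrow> triv i \<Longrightarrow> level_at i = 1 \<Longrightarrow> w \<in> set (ins_at i) \<Longrightarrow> merge w = hd (outs_at i)"
  unfolding merge_def by (simp only: the_ins) auto

lemma merge_not_1:
  assumes "w \<notin> set (gins G)"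
  shows "merge w = (if \<exists>i<N. triv i \<and> level_at i = 2 \<and> w \<in> set (outs_at i)
     then hd (ins_at (THE i. i < N \<and> w \<in> set (outs_at i))) else w)"
  using level_1 assms by (auto simp: merge_def)

lemma merge_outs_2:
  assumes "i < N" "triv i" "level_at i = 2" "w \<in> set (outs_at i)"
  shows "merge w = hd (ins_at i)"
proof -
  have "w \<notin> set (gins G)" using gins_outs assms by blast
  then show ?thesis using assms by (auto simp: merge_not_1 the_outs)
qed

lemma merge_outs:
  assumes "i < N" "\<not> (triv i \<and> level_at i = 2)" "w \<in> set (outs_at i)"
  shows "merge w = w"
proof -
  have "w \<notin> set (gins G)" using gins_outs assms by blast
  moreover have "\<not> (\<exists>j<N. triv j \<and> level_at j = 2 \<and> w \<in> set (outs_at j))" using outs_unique assms by blast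
  ultimately show ?thesis by (auto simp: merge_not_1)
qed

lemma merge_ins_2:
  assumes "i < N" "level_at i = 2" "w \<in> set (ins_at i)"
  shows "merge w = w"
proof -
  have "w \<notin> set (gins G)" using level_2_gins assms by blast
  moreover have "\<not> (\<exists>j<N. triv j \<and> level_at j = 2 \<and> w \<in> set (outs_at j))"
    using gouts_ins level_2 assms by blast
  ultimately show ?thesis by (auto simp: merge_not_1)
qed

lemma merge_trivial:
  assumes "i < N" "triv i" "ins_at i = [a]" "outs_at i = [b]"
  shows "merge a = merge b"
proof (cases "level_at i = 1")
  case True
  then have "merge a = b" using merge_ins_1[OF assms(1,2) True, of a] assms by simp
  moreover have "merge b = b" using merge_outs[OF assms(1), of b] True assms by simp
  ultimately show ?thesis by simp
next
  case False
  then have "level_at i = 2" using levels assms(1) by blast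
  then show ?thesis using merge_ins_2[OF assms(1), of a] merge_outs_2[OF assms(1,2), of b] assms by simp
qed

lemma merge_gins:
  assumes "w \<in> set (gins G)"
  shows "merge w = w \<and> (\<forall>i<N. triv i \<longrightarrow> w \<notin> set (ins_at i)) \<or>
    (\<exists>i<N. triv i \<and> ins_at i = [w] \<and> outs_at i = [merge w])"
proof (cases "\<exists>i<N. triv i \<and> w \<in> set (ins_at i)")
  case True
  then obtain i where i: "i < N" "triv i" "w \<in> set (ins_at i)" by blast
  then have "level_at i = 1" using levels level_2_gins assms by blast
  moreover obtain a b where "ins_at i = [a]" "outs_at i = [b]" using trivial_at[OF i(1,2)] by blast
  ultimately show ?thesis using merge_ins_1[of i w] i by auto
next
  case False
  then have "merge w = w" using gins_outs[OF assms] unfolding merge_def by auto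
  then show ?thesis using False by blast
qed

text \<open>A merged global input takes the name of the output of a trivial vertex. Such a name is
  no global input, and it determines the vertex and hence its only input.\<close>

lemma merge_inj_gins: "inj_on merge (set (gins G))"
proof (rule inj_onI)
  fix x y assume a: "x \<in> set (gins G)" "y \<in> set (gins G)" "merge x = merge y"
  have key: "x = y" if x: "x \<in> set (gins G)" and y: "y \<in> set (gins G)" and eq: "merge x = merge y"
    and i: "i < N" "ins_at i = [x]" "outs_at i = [merge x]" for x y i
  proof -
    consider "merge y = y" | j where "j < N" "ins_at j = [y]" "outs_at j = [merge y]"
      using merge_gins[OF y] by blast
    then show ?thesis
    proof cases
      case 1
      then have "y \<in> set (outs_at i)" unfolding i(3) eq by simp
      then show ?thesis using gins_outs[OF y i(1)] by blast
    next
      case 2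
      have "i = j" by (rule outs_unique[OF i(1) 2(1), of "merge x"]) (simp add: i(3), simp add: 2(3) eq)
      then show ?thesis using i(2) 2(2) by simp
    qed
  qed
  consider i where "i < N" "ins_at i = [x]" "outs_at i = [merge x]" | i where "i < N" "ins_at i = [y]" "outs_at i = [merge y]"
    | "merge x = x" "merge y = y"
    using merge_gins[OF a(1)] merge_gins[OF a(2)] by blast
  then show "x = y"
  proof cases
    case 1 then show ?thesis using key a by blast
  next
    case 2 then show ?thesis using key[OF a(2,1) a(3)[symmetric]] by blast
  next
    case 3 then show ?thesis using a(3) by metis
  qed
qed

lemma merge_gins_outs:
  assumes "x \<in> set (gins G)" "i < N" "\<not> triv i" shows "merge x \<notin> set (outs_at i)"
proof -
  consider "merge x = x" | j where "j < N" "triv j" "outs_at j = [merge x]"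
    using merge_gins[OF assms(1)] by blast
  then show ?thesis
  proof cases
    case 1
    then show ?thesis using gins_outs[OF assms(1,2)] by metis
  next
    case 2
    then have "merge x \<in> set (outs_at j)" by simp
    then show ?thesis using outs_unique[OF assms(2) 2(1)] 2(2) assms(3) by blast
  qed
qed

text \<open>The pairing keeps names apart: tag 0 for wires of \<open>G\<close>, tag
  \<open>Suc i\<close> for wires inside the graph at vertex \<open>i\<close>.\<close>

definition glue :: "nat \<Rightarrow> nat" where "glue w = prod_encode (0, merge w)"

text \<open>Legs take the names of the wires to which they are glued, every other wire a fresh one.
  A trivial graph lists its wire twice; \<open>merge_trivial\<close> makes the two prescriptions
  agree.\<close>

definition inner :: "nat \<Rightarrow> nat \<Rightarrow> nat" where
  "inner i z = (case map_of (zip (gouts (Gs ! i) @ gins (Gs ! i)) (map glue (outs_at i @ ins_at i))) z of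
     Some w \<Rightarrow> w | None \<Rightarrow> prod_encode (Suc i, z))"

lemma inner_legs:
  assumes "i < N"
  shows "map (inner i) (gouts (Gs ! i)) = map glue (outs_at i)" "map (inner i) (gins (Gs ! i)) = map glue (ins_at i)"
proof -
  have "map (inner i) (gouts (Gs ! i)) = map glue (outs_at i) \<and> map (inner i) (gins (Gs ! i)) = map glue (ins_at i)"
  proof (cases "triv i")
    case True
    then obtain a b z where "ins_at i = [a]" "outs_at i = [b]" "gins (Gs ! i) = [z]" "gouts (Gs ! i) = [z]"
      using trivial_at[OF assms] by blast
    moreover from this have "merge a = merge b" using merge_trivial assms True by blast
    ultimately show ?thesis by (simp add: inner_def glue_def)
  next
    case False
    let ?xs = "gouts (Gs ! i) @ gins (Gs ! i)" let ?ys = "map glue (outs_at i @ ins_at i)"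
    have "distinct ?xs" using legs_attached(3)[OF wired_Gs flow_Gs False] wired_distinct(3,4)[OF wired_Gs] assms by auto
    moreover have "length ?xs = length ?ys" using gouts_Gs gins_Gs assms by simp
    ultimately have "map (inner i) ?xs = ?ys" unfolding inner_def by (rule map_map_of_zip)
    then show ?thesis using gouts_Gs[OF assms] by simp
  qed
  then show "map (inner i) (gouts (Gs ! i)) = map glue (outs_at i)" "map (inner i) (gins (Gs ! i)) = map glue (ins_at i)"
    by blast+
qed

lemma inner_fresh: "z \<notin> set (gouts (Gs ! i)) \<Longrightarrow> z \<notin> set (gins (Gs ! i)) \<Longrightarrow> inner i z = prod_encode (Suc i, z)"
proof -
  assume "z \<notin> set (gouts (Gs ! i))" "z \<notin> set (gins (Gs ! i))"
  then have "map_of (zip (gouts (Gs ! i) @ gins (Gs ! i)) (map glue (outs_at i @ ins_at i))) z = None"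
    by (auto simp: map_of_eq_None_iff dest: set_zip_leftD)
  then show ?thesis by (simp add: inner_def)
qed

lemma inner_gouts:
  assumes "i < N" "k < length (outs_at i)"
  shows "inner i (gouts (Gs ! i) ! k) = glue (outs_at i ! k)"
  using arg_cong[OF inner_legs(1)[OF assms(1)], of "\<lambda>xs. xs ! k"] assms gouts_Gs by simp

text \<open>The name of a wire with a source vertex shows where it comes from. Merging does not
  interfere, as a graph with a vertex is not trivial.\<close>

lemma inner_outs_cases:
  assumes "i < N" "z \<in> set (inner_outs i)"
  shows "z \<notin> set (gouts (Gs ! i)) \<and> inner i z = prod_encode (Suc i, z) \<or>
    (\<exists>k<length (outs_at i). z = gouts (Gs ! i) ! k \<and> inner i z = prod_encode (0, outs_at i ! k))"
proof (cases "z \<in> set (gouts (Gs ! i))")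
  case True
  then obtain k where k: "k < length (outs_at i)" "z = gouts (Gs ! i) ! k"
    using gouts_Gs[OF assms(1)] by (metis in_set_conv_nth)
  have "\<not> triv i" using assms(2) by auto
  then have "merge (outs_at i ! k) = outs_at i ! k" using merge_outs assms(1) k by simp
  then show ?thesis using inner_gouts[OF assms(1) k(1)] k by (auto simp: glue_def)
next
  case False
  moreover have "z \<notin> set (gins (Gs ! i))" using assms wired_distinct(5)[OF wired_Gs[OF assms(1)]] by auto
  ultimately show ?thesis using inner_fresh by blast
qed

lemma inj_inner_outs: "i < N \<Longrightarrow> inj_on (inner i) (set (inner_outs i))"
proof (rule inj_onI)
  fix x y assume i: "i < N" and xy: "x \<in> set (inner_outs i)" "y \<in> set (inner_outs i)" "inner i x = inner i y"
  have d: "distinct (outs_at i)"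
    using wired_distinct(1)[OF wired_G] i len by (auto simp: distinct_concat_iff)
  consider "inner i x = prod_encode (Suc i, x)"
    | k where "k < length (outs_at i)" "x = gouts (Gs ! i) ! k" "inner i x = prod_encode (0, outs_at i ! k)"
    using inner_outs_cases[OF i xy(1)] by blast
  then show "x = y"
  proof cases
    case 1
    then show ?thesis using inner_outs_cases[OF i xy(2)] unfolding xy(3) by auto
  next
    case 2
    then obtain l where "l < length (outs_at i)" "y = gouts (Gs ! i) ! l" "outs_at i ! k = outs_at i ! l"
      using inner_outs_cases[OF i xy(2)] unfolding xy(3) by auto
    then show ?thesis using 2 d by (simp add: nth_eq_iff_index_eq)
  qed
qed

definition plug :: "'a dgraph" where
  "plug = DGraph (map glue (gouts G))
     (concat (map (\<lambda>i. map (rename_vert (inner i)) (verts (Gs ! i))) [0..<N])) (map glue (gins G))"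

end

lemma concat_outs_blocks:
  "concat (map outs (concat (map (\<lambda>i. map (rename_vert (\<psi> i)) (vs i)) xs))) = concat (map (\<lambda>i. map (\<psi> i) (concat (map outs (vs i)))) xs)"
  "concat (map ins (concat (map (\<lambda>i. map (rename_vert (\<psi> i)) (vs i)) xs))) = concat (map (\<lambda>i. map (\<psi> i) (concat (map ins (vs i)))) xs)"
  by (induction xs) (auto simp: concat_map_rename)

context composable
begin

text \<open>Sources are told apart by their tags. Sources and targets agree because the balance of
  each inserted graph can be added to that of \<open>G\<close>, after which the glued wires
  cancel.\<close>

lemma wired_plug: "wired plug"
proof -
  let ?O = "\<lambda>i. map (inner i) (inner_outs i)" let ?I = "\<lambda>i. map (inner i) (inner_ins i)"
  have O: "concat (map outs (verts plug)) = concat (map ?O [0..<N])"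
    and I: "concat (map ins (verts plug)) = concat (map ?I [0..<N])"
    by (simp_all add: plug_def concat_outs_blocks)
  have img: "(\<exists>z. x = prod_encode (Suc i, z)) \<or> (\<exists>z\<in>set (outs_at i). x = prod_encode (0, z))"
    if i: "i < N" "x \<in> set (?O i)" for i x
  proof -
    obtain z where "z \<in> set (inner_outs i)" "x = inner i z" using i(2) by auto
    then show ?thesis using inner_outs_cases[OF i(1), of z] by (metis nth_mem)
  qed
  have d1: "distinct (concat (map ?O [0..<N]))"
  proof (rule distinct_concat_upt)
    show "distinct (?O i)" if "i < N" for i
      using inj_inner_outs[OF that] wired_distinct(1)[OF wired_Gs[OF that]] by (simp add: distinct_map)
    show "set (?O i) \<inter> set (?O j) = {}" if "i < N" "j < N" "i \<noteq> j" for i j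
    proof -
      have False if x: "x \<in> set (?O i)" "x \<in> set (?O j)" for x
        using img[OF \<open>i < N\<close> x(1)] img[OF \<open>j < N\<close> x(2)] outs_unique[OF \<open>i < N\<close> \<open>j < N\<close>] \<open>i \<noteq> j\<close>
        by auto
      then show ?thesis by blast
    qed
  qed
  have d2: "distinct (map glue (gins G))"
    using merge_inj_gins wired_distinct(3)[OF wired_G] by (auto simp: distinct_map glue_def inj_on_def)
  have d3: "glue x \<notin> set (?O i)" if "x \<in> set (gins G)" "i < N" for x i
  proof
    assume a: "glue x \<in> set (?O i)"
    then have "merge x \<in> set (outs_at i)" using img[OF that(2) a] unfolding glue_def prod_encode_eq by auto
    moreover have "\<not> triv i" using a by auto
    ultimately show False using merge_gins_outs that by blast
  qed
  have dist: "distinct (gins plug @ concat (map outs (verts plug)))"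
  proof -
    have "y \<notin> set (concat (map ?O [0..<N]))" if "y \<in> set (map glue (gins G))" for y
      using d3 that unfolding in_concat_upt by (metis (no_types, lifting) imageE set_map)
    then have "set (map glue (gins G)) \<inter> set (concat (map ?O [0..<N])) = {}" by blast
    moreover have "gins plug = map glue (gins G)" by (simp add: plug_def)
    ultimately show ?thesis unfolding O using d1 d2 by (simp only: distinct_append)
  qed
  have bal: "image_mset glue (mset (ins_at i)) + mset (?O i) = image_mset glue (mset (outs_at i)) + mset (?I i)"
    if "i < N" for i
  proof -
    have "mset (gins (Gs ! i) @ inner_outs i) = mset (gouts (Gs ! i) @ inner_ins i)"
      using wired_Gs[OF that] unfolding wired_iff_mset by blast
    then have "mset (map (inner i) (gins (Gs ! i) @ inner_outs i)) = mset (map (inner i) (gouts (Gs ! i) @ inner_ins i))"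
      unfolding mset_map by (rule arg_cong)
    then show ?thesis unfolding map_append inner_legs[OF that] by (simp)
  qed
  have balG: "mset (gins G) + (\<Sum>i<N. mset (outs_at i)) = mset (gouts G) + (\<Sum>i<N. mset (ins_at i))"
    using wired_G unfolding wired_iff_mset mset_append mset_concat_nth len by blast
  have sums: "image_mset glue (\<Sum>i<n. f i) = (\<Sum>i<n. image_mset glue (f i))" for f :: "nat \<Rightarrow> nat multiset" and n
    by (induction n) auto
  have balG': "mset (map glue (gins G)) + (\<Sum>i<N. image_mset glue (mset (outs_at i))) =
      mset (map glue (gouts G)) + (\<Sum>i<N. image_mset glue (mset (ins_at i)))"
    using arg_cong[OF balG, of "image_mset glue"] by (simp add: sums)
  have "(\<Sum>i<N. image_mset glue (mset (ins_at i)) + mset (?O i)) = (\<Sum>i<N. image_mset glue (mset (outs_at i)) + mset (?I i))"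
    by (rule sum.cong) (use bal in auto)
  then have tot: "(\<Sum>i<N. image_mset glue (mset (ins_at i))) + (\<Sum>i<N. mset (?O i)) =
      (\<Sum>i<N. image_mset glue (mset (outs_at i))) + (\<Sum>i<N. mset (?I i))"
    by (simp only: sum.distrib)
  have cancel: "A + R = B + S" if "A + P = B + Q" "Q + R = P + S" for A B P Q R S :: "nat multiset"
  proof -
    have "A + R + (P + Q) = (A + P) + (Q + R)" by (simp add: ac_simps)
    also have "\<dots> = (B + Q) + (P + S)" using that by simp
    also have "\<dots> = B + S + (P + Q)" by (simp add: ac_simps)
    finally show ?thesis by simp
  qed
  have "mset (map glue (gins G)) + (\<Sum>i<N. mset (?O i)) = mset (map glue (gouts G)) + (\<Sum>i<N. mset (?I i))"
    using cancel[OF balG' tot] .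
  then have "mset (gins plug @ concat (map outs (verts plug))) = mset (gouts plug @ concat (map ins (verts plug)))"
    unfolding O I mset_append mset_concat_upt by (simp add: plug_def)
  with dist show ?thesis unfolding wired_iff_mset by blast
qed

text \<open>The existence without which the choice in \<open>substitution\<close> would say
  nothing.\<close>

lemma substitutes_plug: "substitutes G Gs plug"
  unfolding substitutes_def
proof (intro conjI)
  show "length Gs = length (verts G)" by (rule len)
  show "wired plug" by (rule wired_plug)
  show "\<exists>\<phi> \<psi>. (\<forall>i<N. map \<phi> (outs_at i) = map (\<psi> i) (gouts (Gs ! i)) \<and> map \<phi> (ins_at i) = map (\<psi> i) (gins (Gs ! i))) \<and>
     plug = DGraph (map \<phi> (gouts G)) (concat (map (\<lambda>i. map (rename_vert (\<psi> i)) (verts (Gs ! i))) [0..<N])) (map \<phi> (gins G))"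
    by (rule exI[of _ glue], rule exI[of _ inner]) (simp add: inner_legs plug_def)
qed

lemma substitutes_substitution: "substitutes G Gs (substitution G Gs)"
  unfolding substitution_def using substitutes_plug by (rule someI)

end

section \<open>Every substitution of flow graphs is a flow graph\<close>

context composable
begin

lemma rigid_G: "rigid G"
  using connected_iff[OF wired_G nonempty] conn_G nonempty by (simp add: conn2_def connected_graph_def)

lemma wires_G: "N = 1 \<or> (\<forall>i<N. wires (verts G ! i) \<noteq> {})"
proof -
  have "length (verts G) = 1 \<or> (\<forall>v\<in>set (verts G). wires v \<noteq> {})"
    using connected_iff[OF wired_G nonempty] conn_G nonempty by (simp add: conn2_def connected_graph_def)
  then show ?thesis using len by auto
qed

lemma wire_set_G: "x \<in> wire_set G \<longleftrightarrow> (\<exists>i<N. x \<in> wires (verts G ! i))"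
  unfolding wire_set_def len UN_iff by (metis in_set_conv_nth)

lemma gins_wire_set: "x \<in> set (gins G) \<Longrightarrow> x \<in> wire_set G"
  using conn_G by (auto simp: conn2_def two_levelled_def wire_set_def wires_def)

text \<open>As \<open>substitution\<close> is a choice, this is proved for an arbitrary substitution
  and not through the names used in \<open>plug\<close>. Connectedness and acyclicity are carried
  over by colourings and ranks of wires.\<close>

lemma substitutes_flow:
  assumes "substitutes G Gs G'"
  shows "flow G'"
proof -
  obtain \<phi> \<psi> where
    outs_eq: "\<And>i. i < N \<Longrightarrow> map \<phi> (outs_at i) = map (\<psi> i) (gouts (Gs ! i))" and
    ins_eq: "\<And>i. i < N \<Longrightarrow> map \<phi> (ins_at i) = map (\<psi> i) (gins (Gs ! i))" and
    G': "G' = DGraph (map \<phi> (gouts G)) (concat (map (\<lambda>i. map (rename_vert (\<psi> i)) (verts (Gs ! i))) [0..<N])) (map \<phi> (gins G))"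
    using assms unfolding substitutes_def by blast
  have w: "wired G'" using assms by (simp add: substitutes_def)
  have gG': "gins G' = map \<phi> (gins G)" "gouts G' = map \<phi> (gouts G)"
    and vG': "verts G' = concat (map (\<lambda>i. map (rename_vert (\<psi> i)) (verts (Gs ! i))) [0..<N])"
    by (simp_all add: G')
  have V: "v \<in> set (verts G') \<longleftrightarrow> (\<exists>i<N. \<exists>u\<in>set (verts (Gs ! i)). v = rename_vert (\<psi> i) u)" for v
    unfolding vG' in_concat_upt by auto
  have wires_rename: "wires (rename_vert f u) = f ` wires u" for f and u :: "'a vert" by (auto simp: wires_def)
  have fl: "(\<forall>v\<in>set (verts (Gs ! i)). level v = 0)" "ranked (Gs ! i)"
    "\<not> triv i \<Longrightarrow> rigid (Gs ! i)" "\<not> triv i \<Longrightarrow> length (verts (Gs ! i)) = 1 \<or> (\<forall>v\<in>set (verts (Gs ! i)). wires v \<noteq> {})"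
    if "i < N" for i
    using flow_Gs[OF that] flow_iff[OF wired_Gs[OF that]] by auto
  have O: "concat (map outs (verts G')) = concat (map (\<lambda>i. map (\<psi> i) (inner_outs i)) [0..<N])"
    and I: "concat (map ins (verts G')) = concat (map (\<lambda>i. map (\<psi> i) (inner_ins i)) [0..<N])"
    unfolding vG' concat_outs_blocks by (rule HOL.refl)+
  \<comment> \<open>A wire of \<open>G'\<close> has one source slot (\<open>S\<close> below) and one
    target slot (\<open>T\<close>), each of which identifies an inserted graph and a wire in
    it.\<close>
  have unique: "i = j \<and> z = y" if d: "distinct (concat (map (\<lambda>i. map (\<psi> i) (f i)) [0..<N]))"
    and a: "i < N" "j < N" "z \<in> set (f i)" "y \<in> set (f j)" "\<psi> i z = \<psi> j y" for f i j z y
  proof -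
    have "\<psi> i z \<in> set (map (\<psi> i) (f i))" using a(3) by simp
    moreover have "\<psi> i z \<in> set (map (\<psi> j) (f j))" using a(4) unfolding a(5) by simp
    ultimately have "i = j"
      using concat_index_unique[OF d, of i j "\<psi> i z"] a(1,2) by simp
    moreover have "distinct (map (\<psi> i) (f i))"
      using d a(1) by (auto simp: distinct_concat_iff)
    ultimately show ?thesis using a by (auto simp: distinct_map inj_on_def)
  qed
  note S = unique[OF wired_distinct(1)[OF w, unfolded O]]
  note T = unique[OF wired_distinct(2)[OF w, unfolded I]]
  have out_leg: "\<exists>z\<in>set (gouts (Gs ! i)). \<phi> x = \<psi> i z" if "i < N" "x \<in> set (outs_at i)" for i x
    using arg_cong[OF outs_eq[OF that(1)], of set] that(2) by auto
  have in_leg: "\<exists>z\<in>set (gins (Gs ! i)). \<phi> x = \<psi> i z" if "i < N" "x \<in> set (ins_at i)" for i x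
    using arg_cong[OF ins_eq[OF that(1)], of set] that(2) by auto
  have leg: "\<exists>z\<in>wire_set (Gs ! i). \<phi> x = \<psi> i z" if i: "i < N" "\<not> triv i" "x \<in> wires (verts G ! i)" for i x
  proof -
    note at = legs_attached(1,2)[OF wired_Gs[OF i(1)] flow_Gs[OF i(1)] i(2)]
    from i(3) consider "x \<in> set (outs_at i)" | "x \<in> set (ins_at i)" by (auto simp: wires_def)
    then show ?thesis
    proof cases
      case 1
      then obtain z where z: "z \<in> set (gouts (Gs ! i))" "\<phi> x = \<psi> i z" using out_leg i by blast
      have "z \<in> wire_set (Gs ! i)" using at(1)[OF z(1)] by (auto simp: wire_set_def wires_def)
      then show ?thesis using z(2) by blast
    next
      case 2
      then obtain z where z: "z \<in> set (gins (Gs ! i))" "\<phi> x = \<psi> i z" using in_leg i by blast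
      have "z \<in> wire_set (Gs ! i)" using at(2)[OF z(1)] by (auto simp: wire_set_def wires_def)
      then show ?thesis using z(2) by blast
    qed
  qed
  have trivial: "\<phi> x = \<phi> y" if i: "i < N" "triv i" and xy: "x \<in> wires (verts G ! i)" "y \<in> wires (verts G ! i)" for i x y
  proof -
    obtain a b z where "ins_at i = [a]" "outs_at i = [b]" "gins (Gs ! i) = [z]" "gouts (Gs ! i) = [z]"
      using trivial_at[OF i] by blast
    then show ?thesis using outs_eq[OF i(1)] ins_eq[OF i(1)] xy by (auto simp: wires_def)
  qed
  \<comment> \<open>A colouring of \<open>G'\<close> pulls back along \<open>\<psi> i\<close> to an
    inserted graph, which is rigid.\<close>
  have block: "\<kappa> (\<psi> i x) = \<kappa> (\<psi> i y)"
    if k: "\<forall>v\<in>set (verts G'). \<forall>x\<in>wires v. \<forall>y\<in>wires v. \<kappa> x = \<kappa> y"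
      and i: "i < N" and xy: "x \<in> wire_set (Gs ! i)" "y \<in> wire_set (Gs ! i)" for \<kappa> :: "nat \<Rightarrow> bool" and i x y
  proof -
    have "\<not> triv i" using xy by (auto simp: wire_set_def)
    then show ?thesis
    proof (rule rigidD[OF fl(3)[OF i] _ xy, of "\<lambda>x. \<kappa> (\<psi> i x)"])
      fix v x y assume "v \<in> set (verts (Gs ! i))" "x \<in> wires v" "y \<in> wires v"
      then show "\<kappa> (\<psi> i x) = \<kappa> (\<psi> i y)"
        by (intro k[rule_format, of "rename_vert (\<psi> i) v"]) (use V i in \<open>auto simp: wires_rename\<close>)
    qed
  qed
  \<comment> \<open>It also pulls back along \<open>\<phi>\<close> to \<open>G\<close>: two wires at
    a vertex of \<open>G\<close> are joined by the inserted graph, or merged if that graph is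
    trivial.\<close>
  have outer: "\<kappa> (\<phi> x) = \<kappa> (\<phi> y)"
    if k: "\<forall>v\<in>set (verts G'). \<forall>x\<in>wires v. \<forall>y\<in>wires v. \<kappa> x = \<kappa> y"
      and xy: "x \<in> wire_set G" "y \<in> wire_set G" for \<kappa> :: "nat \<Rightarrow> bool" and x y
  proof (rule rigidD[OF rigid_G _ xy, of "\<lambda>x. \<kappa> (\<phi> x)"])
    fix v x y assume v: "v \<in> set (verts G)" and x: "x \<in> wires v" and y: "y \<in> wires v"
    then obtain i where i: "i < N" "v = verts G ! i" using len by (metis in_set_conv_nth)
    show "\<kappa> (\<phi> x) = \<kappa> (\<phi> y)"
    proof (cases "triv i")
      case True
      then show ?thesis using trivial[OF i(1) True] x y i(2) by metis
    next
      case False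
      obtain z1 where "z1 \<in> wire_set (Gs ! i)" "\<phi> x = \<psi> i z1" using leg[OF i(1) False] x i(2) by blast
      moreover obtain z2 where "z2 \<in> wire_set (Gs ! i)" "\<phi> y = \<psi> i z2" using leg[OF i(1) False] y i(2) by blast
      ultimately show ?thesis using block[where \<kappa> = \<kappa>, OF k i(1)] by metis
    qed
  qed
  have level0: "\<forall>v\<in>set (verts G'). level v = 0" using V fl(1) by auto
  have nil: "length (gins G') = 1" if e: "verts G' = []"
  proof -
    have tr: "triv i" if "i < N" for i
    proof (rule ccontr)
      assume "\<not> triv i"
      then obtain u where "u \<in> set (verts (Gs ! i))" by fastforce
      then show False using V[of "rename_vert (\<psi> i) u"] that e by auto
    qed
    \<comment> \<open>Without vertices every colouring is allowed, in particular the one marking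
      only \<open>\<phi> x\<close>; so all global inputs are merged into one wire.\<close>
    have same: "\<phi> x = \<phi> y" if "x \<in> set (gins G)" "y \<in> set (gins G)" for x y
      using outer[of "\<lambda>w. w = \<phi> x" x y] that gins_wire_set unfolding e by auto
    have dist: "distinct (map \<phi> (gins G))" using wired_distinct(3)[OF w] gG' by simp
    have le: "length (gins G) \<le> 1"
    proof (rule ccontr)
      assume "\<not> length (gins G) \<le> 1"
      then obtain a b xs where ab: "gins G = a # b # xs"
        by (cases "gins G"; cases "tl (gins G)") auto
      then have "\<phi> a = \<phi> b" using same[of a b] by simp
      then show False using dist ab by simp
    qed
    have one: "length (outs v) = 1 \<and> length (ins v) = 1" if v: "v \<in> set (verts G)" for v
    proof -
      obtain i where i: "i < N" "v = verts G ! i" using v len by (metis in_set_conv_nth)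
      then show ?thesis using trivial_at[OF i(1) tr[OF i(1)]] by auto
    qed
    have "total (length \<circ> outs) (verts G) = total (length \<circ> ins) (verts G)"
      using one by (intro arg_cong[of _ _ sum_list] map_cong) auto
    then have eq: "length (gins G) = length (gouts G)" using wired_length[OF wired_G] by simp
    have N0: "0 < N" using nonempty len by auto
    then obtain a b where ab: "ins_at 0 = [a]" "outs_at 0 = [b]" using trivial_at[OF N0 tr[OF N0]] by blast
    \<comment> \<open>A vertex of either level is attached to legs of \<open>G\<close>, so there is
      a leg at all.\<close>
    have "a \<in> set (gins G) \<or> b \<in> set (gouts G)"
      using levels[OF N0] level_1[OF N0, of a] level_2[OF N0, of b] ab by auto
    then have "length (gins G) \<noteq> 0" using eq by auto
    then have "length (gins G) = 1" using le by linarith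
    then show ?thesis using gG' by simp
  qed
  have disj: "set (gins G') \<inter> set (gouts G') = {}" if ne: "verts G' \<noteq> []"
  proof (rule ccontr)
    assume "set (gins G') \<inter> set (gouts G') \<noteq> {}"
    then obtain x where x: "x \<in> set (gins G')" "x \<in> set (gouts G')" by blast
    then obtain g where g: "g \<in> set (gins G)" "x = \<phi> g" using gG' by auto
    have no: "x \<notin> wires v" if "v \<in> set (verts G')" for v
      using wired_distinct(5,6)[OF w that] x by (auto simp: wires_def)
    \<comment> \<open>A wire running straight through touches no vertex, so marking it alone is an
      allowed colouring. Hence all wires of \<open>G\<close> are merged into \<open>x\<close>, and
      no vertex of \<open>G'\<close> can be attached to them.\<close>
    have all: "\<phi> y = x" if "y \<in> wire_set G" for y
    proof -
      have "\<forall>v\<in>set (verts G'). \<forall>a\<in>wires v. \<forall>b\<in>wires v. (a = x) = (b = x)" using no by blast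
      from outer[OF this gins_wire_set[OF g(1)] that] show ?thesis using g(2) by simp
    qed
    obtain i u where iu: "i < N" "u \<in> set (verts (Gs ! i))" using ne V by (metis last_in_set)
    have nt: "\<not> triv i" using iu by auto
    have "wires (verts G ! i) = {}"
    proof (rule ccontr)
      assume "wires (verts G ! i) \<noteq> {}"
      then obtain y where y: "y \<in> wires (verts G ! i)" by blast
      then obtain z where z: "z \<in> wire_set (Gs ! i)" "\<phi> y = \<psi> i z" using leg[OF iu(1) nt] by blast
      then obtain u' where "u' \<in> set (verts (Gs ! i))" "z \<in> wires u'" by (auto simp: wire_set_def)
      then have "\<phi> y \<in> wires (rename_vert (\<psi> i) u')" "rename_vert (\<psi> i) u' \<in> set (verts G')"
        using V iu(1) z(2) by (auto simp: wires_rename)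
      moreover have "\<phi> y = x" using all y iu(1) wire_set_G by blast
      ultimately show False using no by blast
    qed
    then have "N = 1" using wires_G iu(1) by blast
    then show False using gins_wire_set[OF g(1)] \<open>wires (verts G ! i) = {}\<close> iu(1) wire_set_G by auto
  qed
  have rig: "rigid G'"
    unfolding rigid_def
  proof (intro allI impI ballI)
    fix \<kappa> :: "nat \<Rightarrow> bool" and x y
    assume k: "\<forall>v\<in>set (verts G'). \<forall>x\<in>wires v. \<forall>y\<in>wires v. \<kappa> x = \<kappa> y"
      and xy: "x \<in> wire_set G'" "y \<in> wire_set G'"
    have loc: "\<exists>i<N. \<exists>z\<in>wire_set (Gs ! i). x = \<psi> i z" if x: "x \<in> wire_set G'" for x
    proof -
      obtain v where v: "v \<in> set (verts G')" "x \<in> wires v" using x by (auto simp: wire_set_def)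
      then obtain i u where "i < N" "u \<in> set (verts (Gs ! i))" "v = rename_vert (\<psi> i) u" using V by blast
      then show ?thesis using v(2) by (auto simp: wires_rename wire_set_def)
    qed
    obtain i z where i: "i < N" "z \<in> wire_set (Gs ! i)" "x = \<psi> i z" using loc[OF xy(1)] by blast
    obtain j z' where j: "j < N" "z' \<in> wire_set (Gs ! j)" "y = \<psi> j z'" using loc[OF xy(2)] by blast
    have nt: "\<not> triv i" "\<not> triv j" using i(2) j(2) by (auto simp: wire_set_def)
    show "\<kappa> x = \<kappa> y"
    proof (cases "N = 1")
      case True
      then have "i = j" using i(1) j(1) by simp
      then show ?thesis using block[where \<kappa> = \<kappa>, OF k i(1)] i j by metis
    next
      case False
      then obtain p q where pq: "p \<in> wires (verts G ! i)" "q \<in> wires (verts G ! j)"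
        using wires_G i(1) j(1) by blast
      obtain zp where zp: "zp \<in> wire_set (Gs ! i)" "\<phi> p = \<psi> i zp" using leg[OF i(1) nt(1) pq(1)] by blast
      obtain zq where zq: "zq \<in> wire_set (Gs ! j)" "\<phi> q = \<psi> j zq" using leg[OF j(1) nt(2) pq(2)] by blast
      have "\<kappa> x = \<kappa> (\<phi> p)" unfolding i(3) zp(2) by (rule block[where \<kappa> = \<kappa>, OF k i(1) i(2) zp(1)])
      also have "\<dots> = \<kappa> (\<phi> q)"
        by (rule outer[where \<kappa> = \<kappa>, OF k]) (use pq i(1) j(1) wire_set_G in blast)+
      also have "\<dots> = \<kappa> y" unfolding j(3) zq(2) by (rule block[where \<kappa> = \<kappa>, OF k j(1) zq(1) j(2)])
      finally show ?thesis .
    qed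
  qed
  \<comment> \<open>A vertex without wires is alone in its inserted graph, which then has no legs;
    so \<open>G\<close> has a single vertex.\<close>
  have nonisolated: "length (verts G') = 1 \<or> (\<forall>v\<in>set (verts G'). wires v \<noteq> {})"
  proof (rule disjCI, rule ccontr)
    assume a: "\<not> (\<forall>v\<in>set (verts G'). wires v \<noteq> {})" "length (verts G') \<noteq> 1"
    then obtain v where v: "v \<in> set (verts G')" "wires v = {}" by blast
    obtain i u where iu: "i < N" "u \<in> set (verts (Gs ! i))" "v = rename_vert (\<psi> i) u" using V[THEN iffD1, OF v(1)] by blast
    then have u: "wires u = {}" using v(2) by (simp add: wires_rename)
    have nt: "\<not> triv i" using iu by auto
    have one: "length (verts (Gs ! i)) = 1" using fl(4)[OF iu(1) nt] iu(2) u by blast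
    then have vs: "verts (Gs ! i) = [u]" using iu(2) by (cases "verts (Gs ! i)") auto
    then have "wire_set (Gs ! i) = {}" using u by (simp add: wire_set_def)
    then have "wires (verts G ! i) = {}" using leg[OF iu(1) nt] by blast
    then have "N = 1" using wires_G iu(1) by blast
    then have "verts G' = map (rename_vert (\<psi> 0)) (verts (Gs ! 0))" "i = 0" using vG' iu(1) by auto
    then show False using a(2) one by simp
  qed
  have ran: "ranked G'"
  proof -
    have "\<forall>i. \<exists>\<rho> :: nat \<Rightarrow> nat. i < N \<longrightarrow> (\<forall>v\<in>set (verts (Gs ! i)). \<forall>x\<in>set (ins v). \<forall>y\<in>set (outs v). \<rho> x < \<rho> y)"
      using fl(2) unfolding ranked_def by blast
    then obtain \<rho> :: "nat \<Rightarrow> nat \<Rightarrow> nat" where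
      \<rho>: "\<And>i v x y. i < N \<Longrightarrow> v \<in> set (verts (Gs ! i)) \<Longrightarrow> x \<in> set (ins v) \<Longrightarrow> y \<in> set (outs v) \<Longrightarrow> \<rho> i x < \<rho> i y"
      by metis
    \<comment> \<open>An upper bound for all inner ranks; adding it on level 2 lifts level 2 above
      level 1. The \<open>Suc\<close> in \<open>val\<close> reserves 0 for wires without a source
      vertex.\<close>
    define B where "B = Suc (Max (insert 0 (\<Union>i\<in>{..<N}. \<rho> i ` set (inner_outs i))))"
    have B: "Suc (\<rho> i z) \<le> B" if "i < N" "z \<in> set (inner_outs i)" for i z
    proof -
      have "\<rho> i z \<in> insert 0 (\<Union>i\<in>{..<N}. \<rho> i ` set (inner_outs i))" using that by blast
      then show ?thesis unfolding B_def by (intro Suc_le_mono[THEN iffD2] Max_ge) auto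
    qed
    define val where "val i z = Suc (\<rho> i z) + (if level_at i = 1 then 0 else B)" for i z
    define P where "P x p \<longleftrightarrow> fst p < N \<and> snd p \<in> set (inner_outs (fst p)) \<and> x = \<psi> (fst p) (snd p)" for x and p :: "nat \<times> nat"
    define f where "f x = (if \<exists>p. P x p then val (fst (SOME p. P x p)) (snd (SOME p. P x p)) else 0)" for x
    have f: "f (\<psi> i z) = val i z" if "i < N" "z \<in> set (inner_outs i)" for i z
    proof -
      have "P (\<psi> i z) (i, z)" using that by (simp add: P_def)
      then have ex: "\<exists>p. P (\<psi> i z) p" by blast
      then have "P (\<psi> i z) (SOME p. P (\<psi> i z) p)" by (rule someI_ex)
      then have "i = fst (SOME p. P (\<psi> i z) p) \<and> z = snd (SOME p. P (\<psi> i z) p)"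
        using that unfolding P_def by (intro S) auto
      then show ?thesis using ex by (simp add: f_def)
    qed
    have "f x < f y" if v: "v \<in> set (verts G')" and x: "x \<in> set (ins v)" and y: "y \<in> set (outs v)" for v x y
    proof -
      obtain i u where iu: "i < N" "u \<in> set (verts (Gs ! i))" "v = rename_vert (\<psi> i) u" using v V by blast
      obtain a where a: "a \<in> set (ins u)" "x = \<psi> i a" using x iu(3) by auto
      obtain b where b: "b \<in> set (outs u)" "y = \<psi> i b" using y iu(3) by auto
      have ai: "a \<in> set (inner_ins i)" using a iu by auto
      have bo: "b \<in> set (inner_outs i)" using b iu by auto
      have fy: "f y = val i b" using f[OF iu(1) bo] b(2) by simp
      show ?thesis
      proof (cases "\<exists>p. P x p")
        case False
        then have "f x = 0" unfolding f_def by (rule if_not_P)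
        then show ?thesis unfolding fy val_def by simp
      next
        case True
        then obtain k c where kc: "k < N" "c \<in> set (inner_outs k)" "x = \<psi> k c" by (auto simp: P_def)
        have fx: "f x = val k c" using f[OF kc(1,2)] kc(3) by simp
        obtain vx where vx: "vx \<in> set (verts G')" "x \<in> set (outs vx)"
        proof -
          obtain u' where "u' \<in> set (verts (Gs ! k))" "c \<in> set (outs u')" using kc(2) by auto
          then show thesis using that[of "rename_vert (\<psi> k) u'"] V kc by auto
        qed
        show ?thesis
        proof (cases "a \<in> set (inner_outs i)")
          case True
          have "i = k \<and> a = c" using S[OF iu(1) kc(1) True kc(2)] a(2) kc(3) by simp
          then show ?thesis using \<rho>[OF iu(1,2) a(1) b(1)] by (simp add: fx fy val_def)
        next
          case False
          \<comment> \<open>The wire enters graph \<open>i\<close> from outside but has a source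
            vertex, so it runs from level 1 to level 2.\<close>
          then have "a \<in> set (gins (Gs ! i))" using wired_source(3)[OF wired_Gs[OF iu(1)] iu(2) a(1)] by auto
          then have "x \<in> set (map (\<psi> i) (gins (Gs ! i)))" using a(2) by simp
          then have "x \<in> set (map \<phi> (ins_at i))" unfolding ins_eq[OF iu(1)] .
          then obtain p where p: "p \<in> set (ins_at i)" "x = \<phi> p" by auto
          have "level_at i \<noteq> 1"
          proof
            assume "level_at i = 1"
            then have "x \<in> set (gins G')" using level_1[OF iu(1)] p gG' by simp
            then show False using wired_distinct(5)[OF w vx(1)] vx(2) by blast
          qed
          moreover have "level_at k = 1"
          proof (rule ccontr)
            assume "level_at k \<noteq> 1"
            then have l2: "level_at k = 2" using levels[OF kc(1)] by blast
            have "c \<notin> set (inner_ins k)"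
              using T[OF iu(1) kc(1) ai, of c] a(2) kc(2,3) False by auto
            then have "c \<in> set (gouts (Gs ! k))"
              using wired_source(4)[OF wired_Gs[OF kc(1)], of _ c] kc(2) by auto
            then have "x \<in> set (map (\<psi> k) (gouts (Gs ! k)))" using kc(3) by simp
            then have "x \<in> set (map \<phi> (outs_at k))" unfolding outs_eq[OF kc(1)] .
            then obtain q where q: "q \<in> set (outs_at k)" "x = \<phi> q" by auto
            then have "x \<in> set (gouts G')" using level_2[OF kc(1) l2] gG' by simp
            then show False using wired_distinct(6)[OF w v] x by blast
          qed
          ultimately show ?thesis using B[OF kc(1,2)] by (simp add: fx fy val_def)
        qed
      qed
    qed
    then show ?thesis unfolding ranked_def by blast
  qed
  show ?thesis unfolding flow_iff[OF w] using level0 nil disj rig nonisolated ran by auto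
qed

text \<open>These data are common to all substitutions, and the functional on the enveloping
  properad will depend on nothing else.\<close>

lemma substitutes_type:
  assumes "substitutes G Gs G'"
  shows "length (gouts G') = length (gouts G)" "length (gins G') = length (gins G)"
    "map elt (verts G') = concat (map (map elt \<circ> verts) Gs)"
    "gdeg G' = (\<Sum>i<N. gdeg (Gs ! i))"
proof -
  obtain \<phi> \<psi> where
    G': "G' = DGraph (map \<phi> (gouts G)) (concat (map (\<lambda>i. map (rename_vert (\<psi> i)) (verts (Gs ! i))) [0..<N])) (map \<phi> (gins G))"
    using assms unfolding substitutes_def by blast
  show "length (gouts G') = length (gouts G)" "length (gins G') = length (gins G)" by (simp_all add: G')
  have "map elt (verts G') = concat (map (\<lambda>i. map elt (verts (Gs ! i))) [0..<N])"
    by (simp add: G' map_concat comp_def)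
  also have "map (\<lambda>i. map elt (verts (Gs ! i))) [0..<N] = map (map elt \<circ> verts) Gs"
    by (rule nth_equalityI) auto
  finally show "map elt (verts G') = concat (map (map elt \<circ> verts) Gs)" .
  have "gdeg G' = vsdeg (concat (map (\<lambda>i. map (rename_vert (\<psi> i)) (verts (Gs ! i))) [0..<N]))"
    by (simp add: G' gdeg_def)
  also have "\<dots> = (\<Sum>i<n. gdeg (Gs ! i))" if "n = N" for n
    unfolding that[symmetric] by (induction n) (auto simp: gdeg_def comp_def)
  finally show "gdeg G' = (\<Sum>i<N. gdeg (Gs ! i))" by simp
qed

end

lemma (in composable) substitution_decorated:
  assumes "substitutes G Gs G'" "\<And>i v. i < N \<Longrightarrow> v \<in> set (verts (Gs ! i)) \<Longrightarrow> D (elt v) (length (outs v)) (length (ins v)) (vdeg v)"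
    "v \<in> set (verts G')"
  shows "D (elt v) (length (outs v)) (length (ins v)) (vdeg v)"
proof -
  obtain \<phi> \<psi> where
    "G' = DGraph (map \<phi> (gouts G)) (concat (map (\<lambda>i. map (rename_vert (\<psi> i)) (verts (Gs ! i))) [0..<N])) (map \<phi> (gins G))"
    using assms(1) unfolding substitutes_def by blast
  then have "v \<in> set (concat (map (\<lambda>i. map (rename_vert (\<psi> i)) (verts (Gs ! i))) [0..<N]))" using assms(3) by simp
  then obtain i u where "i < N" "u \<in> set (verts (Gs ! i))" "v = rename_vert (\<psi> i) u"
    unfolding in_concat_upt by auto
  then show ?thesis using assms(2)[of i u] by simp
qed

section \<open>Composition in the free properad\<close>

abbreviation null :: "bool \<Rightarrow> ((nat \<Rightarrow>\<^sub>0 'k::field) dgraph \<Rightarrow>\<^sub>0 'k) set" where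
  "null s \<equiv> graph_null (\<lambda>_. model s) flow"

abbreviation flow_graphs :: "bool \<Rightarrow> (nat \<Rightarrow>\<^sub>0 'k::field) dgraph set" where
  "flow_graphs s \<equiv> graphs (\<lambda>_. model s) flow"

abbreviation flow_span :: "bool \<Rightarrow> ((nat \<Rightarrow>\<^sub>0 'k::field) dgraph \<Rightarrow>\<^sub>0 'k) set" where
  "flow_span s \<equiv> formal.span (gen ` flow_graphs s)"

abbreviation has_type :: "nat \<Rightarrow> nat \<Rightarrow> int \<Rightarrow> 'a dgraph \<Rightarrow> bool" where
  "has_type m n d G \<equiv> length (gouts G) = m \<and> length (gins G) = n \<and> gdeg G = d"

lemma extend_simps:
  "zero (sbimod.extend r t) = zero r" "add (sbimod.extend r t) = add r" "smult (sbimod.extend r t) = smult r"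
  "diff (sbimod.extend r t) = diff r" "lact (sbimod.extend r t) = lact r" "ract (sbimod.extend r t) = ract r"
  "part (sbimod.extend r t) = part r"
  by (simp_all add: sbimod.extend_def)

lemma free_properad_simps [simp]:
  "zero (free_properad P) = graph_null (\<lambda>_. P) flow"
  "add (free_properad P) = (+)"
  "smult (free_properad P) c X = graph_null (\<lambda>_. P) flow + fscale c ` X"
  "diff (free_properad P) X = graph_null (\<lambda>_. P) flow + lin_ext (graph_diff (\<lambda>_. P)) ` X"
  "lact (free_properad P) \<sigma> X = graph_null (\<lambda>_. P) flow + lin_ext (\<lambda>G. gen (graph_lact \<sigma> G)) ` X"
  "ract (free_properad P) X \<tau> = graph_null (\<lambda>_. P) flow + lin_ext (\<lambda>G. gen (graph_ract G \<tau>)) ` X"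
  "part (free_properad P) m n d = (\<lambda>x. graph_null (\<lambda>_. P) flow + {x}) ` part (graph_span (\<lambda>_. P) flow) m n d"
  "compose (free_properad P) = free_compose P"
  unfolding free_properad_def extend_simps by (rule graph_sbimod_simps)+ (simp add: sbimod.extend_def)

lemma null_add: "graph_null B S + graph_null B S = graph_null B S"
  using zero_null[of B S] unfolding graph_null_def by (force simp: set_plus_def intro: formal.span_add)

lemma null_absorb: "graph_null B S + (graph_null B S + X) = graph_null B S + X"
  by (simp add: null_add flip: add.assoc)

lemma null_scale: "x \<in> graph_null B S \<Longrightarrow> fscale c x \<in> graph_null B S"
  unfolding graph_null_def by (rule formal.span_scale)

lemma listset_iff: "Gs \<in> listset As \<longleftrightarrow> length Gs = length As \<and> (\<forall>i<length As. Gs ! i \<in> As ! i)"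
proof (induction As arbitrary: Gs)
  case (Cons A As)
  show ?case
    by (cases Gs) (auto simp: set_Cons_def Cons.IH All_less_Suc2 nth_Cons split: nat.split)
qed auto

text \<open>Distributivity: the value of a multiplicative functional on a multilinear extension
  becomes a product over the factors.\<close>

lemma sum_listset_prod:
  fixes f :: "'b \<Rightarrow> 'a \<Rightarrow> 'k::comm_ring_1"
  shows "(\<Sum>gs\<in>listset (map A xs). prod_list (map2 f xs gs)) = prod_list (map (\<lambda>x. \<Sum>g\<in>A x. f x g) xs)"
proof (induction xs)
  case (Cons x xs)
  have "inj_on (\<lambda>(g, gs). g # gs) (A x \<times> listset (map A xs))" by (auto simp: inj_on_def)
  moreover have "listset (map A (x # xs)) = (\<lambda>(g, gs). g # gs) ` (A x \<times> listset (map A xs))"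
    by (auto simp: set_Cons_def)
  ultimately have "(\<Sum>gs\<in>listset (map A (x # xs)). prod_list (map2 f (x # xs) gs)) =
      (\<Sum>(g, gs)\<in>A x \<times> listset (map A xs). f x g * prod_list (map2 f xs gs))"
    by (simp add: sum.reindex case_prod_unfold comp_def)
  also have "\<dots> = (\<Sum>g\<in>A x. f x g) * (\<Sum>gs\<in>listset (map A xs). prod_list (map2 f xs gs))"
    by (simp add: sum_product sum.cartesian_product)
  finally show ?case by (simp add: Cons.IH)
qed simp

abbreviation reps :: "('k::field, nat \<Rightarrow>\<^sub>0 'k) properad \<Rightarrow> ((nat \<Rightarrow>\<^sub>0 'k) dgraph \<Rightarrow>\<^sub>0 'k) set dgraph \<Rightarrow> ((nat \<Rightarrow>\<^sub>0 'k) dgraph \<Rightarrow>\<^sub>0 'k) list" where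
  "reps P G \<equiv> map (rep (graph_span (\<lambda>_. P) flow)) (verts G)"

text \<open>Components of the free properad consist of cosets of homogeneous elements, so the choice
  in \<open>rep\<close> can be made.\<close>

lemma rep_free:
  assumes "elt v \<in> part (free_properad P) (length (outs v)) (length (ins v)) (vdeg v)"
  shows "rep (graph_span (\<lambda>_. P) flow) v \<in> elt v"
    "rep (graph_span (\<lambda>_. P) flow) v \<in> part (graph_span (\<lambda>_. P) flow) (length (outs v)) (length (ins v)) (vdeg v)"
proof -
  obtain x where x: "elt v = graph_null (\<lambda>_. P) flow + {x}"
    "x \<in> part (graph_span (\<lambda>_. P) flow) (length (outs v)) (length (ins v)) (vdeg v)"
    using assms by (auto simp del: graph_span_simps)
  have "x \<in> elt v" using x(1) zero_null[of "\<lambda>_. P" flow] by (force simp: set_plus_def)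
  then have "\<exists>x. x \<in> elt v \<and> x \<in> part (graph_span (\<lambda>_. P) flow) (length (outs v)) (length (ins v)) (vdeg v)"
    using x by blast
  from someI_ex[OF this] show "rep (graph_span (\<lambda>_. P) flow) v \<in> elt v"
    "rep (graph_span (\<lambda>_. P) flow) v \<in> part (graph_span (\<lambda>_. P) flow) (length (outs v)) (length (ins v)) (vdeg v)"
    by (auto simp: rep_def simp del: graph_span_simps)
qed

lemma rep_keys:
  assumes "G \<in> graphs (\<lambda>_. free_properad P) conn2" "i < length (verts G)" "K \<in> Poly_Mapping.keys (reps P G ! i)"
  shows "K \<in> graphs (\<lambda>_. P) flow" "has_type (length (outs (verts G ! i))) (length (ins (verts G ! i))) (vdeg (verts G ! i)) K"
proof -
  let ?v = "verts G ! i"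
  have "elt ?v \<in> part (free_properad P) (length (outs ?v)) (length (ins ?v)) (vdeg ?v)"
    using assms(1,2) by (simp add: graphs_def del: free_properad_simps)
  from rep_free(2)[OF this] have "reps P G ! i \<in> formal.span (gen `
        {G \<in> graphs (\<lambda>_. P) flow. has_type (length (outs ?v)) (length (ins ?v)) (vdeg ?v) G})"
    using assms(2) by simp
  from keys_span_gen[OF this] assms(3)
  show "K \<in> graphs (\<lambda>_. P) flow" "has_type (length (outs ?v)) (length (ins ?v)) (vdeg ?v) K" by auto
qed

lemma keys_composable:
  assumes "G \<in> graphs (\<lambda>_. free_properad (model s)) conn2" "Gs \<in> listset (map Poly_Mapping.keys (reps (model s) G))"
  shows "composable G Gs" "\<And>i. i < length Gs \<Longrightarrow> Gs ! i \<in> flow_graphs s"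
    "\<And>i. i < length Gs \<Longrightarrow> gdeg (Gs ! i) = vdeg (verts G ! i)" "length Gs = length (verts G)"
proof -
  have l: "length Gs = length (verts G)" and k: "\<And>i. i < length (verts G) \<Longrightarrow> Gs ! i \<in> Poly_Mapping.keys (reps (model s) G ! i)"
    using assms(2) by (auto simp: listset_iff)
  note r = rep_keys[OF assms(1) _ k]
  show "\<And>i. i < length Gs \<Longrightarrow> Gs ! i \<in> flow_graphs s" "\<And>i. i < length Gs \<Longrightarrow> gdeg (Gs ! i) = vdeg (verts G ! i)"
    "length Gs = length (verts G)" using r l by auto
  show "composable G Gs"
  proof
    show "wired G" "conn2 G" using assms(1) by (auto simp: graphs_def)
    show "wired (Gs ! i)" "flow (Gs ! i)" if "i < length Gs" for i using r(1)[of i] that l by (auto simp: graphs_def)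
    show "length (gouts (Gs ! i)) = length (outs (verts G ! i))" "length (gins (Gs ! i)) = length (ins (verts G ! i))"
      if "i < length Gs" for i using r(2)[of i] that l by auto
  qed (rule l)
qed

lemma (in composable) substitution_flow_graph:
  assumes "\<And>i. i < length Gs \<Longrightarrow> Gs ! i \<in> graphs (\<lambda>_. P) flow" "substitutes G Gs H"
  shows "H \<in> graphs (\<lambda>_. P) flow"
  unfolding graphs_def
proof (intro CollectI conjI ballI)
  show "wired H" using assms(2) by (simp add: substitutes_def)
  show "flow H" by (rule substitutes_flow[OF assms(2)])
  fix v assume "v \<in> set (verts H)"
  then show "elt v \<in> part P (length (outs v)) (length (ins v)) (vdeg v)"
    by (rule substitution_decorated[where D = "\<lambda>x m n d. x \<in> part P m n d", OF assms(2), rotated]) (use assms(1) in \<open>auto simp: graphs_def\<close>)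
qed

definition compose_sum :: "'b dgraph \<Rightarrow> ('a dgraph \<Rightarrow>\<^sub>0 'k::field) list \<Rightarrow> ('a dgraph \<Rightarrow>\<^sub>0 'k)" where
  "compose_sum G xs = (\<Sum>Gs\<in>listset (map Poly_Mapping.keys xs).
           fscale (prod_list (map2 Poly_Mapping.lookup xs Gs)) (gen (substitution G Gs)))"

lemma free_compose_sum: "free_compose P G = graph_null (\<lambda>_. P) flow + {compose_sum G (reps P G)}"
  by (simp add: free_compose_def compose_sum_def graph_class_plus Let_def)

lemma compose_sum_span:
  assumes "G \<in> graphs (\<lambda>_. free_properad (model s)) conn2"
  shows "compose_sum G (reps (model s) G) \<in> flow_span s"
  unfolding compose_sum_def
proof (intro formal.span_sum formal.span_scale formal.span_base imageI)
  fix Gs assume "Gs \<in> listset (map Poly_Mapping.keys (reps (model s) G))"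
  from keys_composable[OF assms this] interpret composable G Gs by blast
  show "substitution G Gs \<in> flow_graphs s"
    by (rule substitution_flow_graph[OF _ substitutes_substitution])
      (use keys_composable[OF assms \<open>Gs \<in> _\<close>] in blast)
qed

text \<open>A union of cosets, not necessarily a single one: weak enough to survive the operations
  that generate the ideal by plain set arithmetic.\<close>

definition coset_like :: "bool \<Rightarrow> ((nat \<Rightarrow>\<^sub>0 'k::field) dgraph \<Rightarrow>\<^sub>0 'k) set \<Rightarrow> bool" where
  "coset_like s X \<longleftrightarrow> X \<noteq> {} \<and> null s + X = X \<and> X \<subseteq> flow_span s"

lemma coset_like_map:
  assumes "X \<noteq> {}" "\<And>x. x \<in> X \<Longrightarrow> f x \<in> flow_span s"
  shows "coset_like s (null s + f ` X)"
  unfolding coset_like_def null_absorb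
  using assms zero_null[of "\<lambda>_. model s" flow] null_span[OF stable_flow, of s]
  by (auto simp: set_plus_def intro: formal.span_add)

lemma coset_like_singleton: "x \<in> flow_span s \<Longrightarrow> coset_like s (null s + {x})"
  using coset_like_map[of "{x}" "\<lambda>x. x" s] by simp

lemma coset_like_add: "coset_like s X \<Longrightarrow> coset_like s Y \<Longrightarrow> coset_like s (X + Y)"
proof -
  assume X: "coset_like s X" and Y: "coset_like s Y"
  have "null s + X = X" using X unfolding coset_like_def by blast
  then have "null s + (X + Y) = X + Y" by (simp only: add.assoc[symmetric])
  moreover have "X + Y \<noteq> {}" using X Y set_plus_intro unfolding coset_like_def by blast
  moreover have "X + Y \<subseteq> flow_span s"
    using X Y by (auto simp: coset_like_def elim!: set_plus_elim intro: formal.span_add)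
  ultimately show ?thesis unfolding coset_like_def by blast
qed

lemma coset_like_null: "coset_like s (null s)"
  unfolding coset_like_def null_add using zero_null null_span[OF stable_flow] by blast

lemma act_flow_graphs:
  assumes "G \<in> flow_graphs s"
  shows "graph_lact \<sigma> G \<in> flow_graphs s" "graph_ract G \<tau> \<in> flow_graphs s"
proof -
  have w: "wired G" "flow G" using assms by (auto simp: graphs_def)
  have m: "mset (gouts (graph_lact \<sigma> G)) = mset (gouts G)" "mset (gins (graph_ract G \<tau>)) = mset (gins G)"
    by (auto simp: graph_lact_def graph_ract_def mset_permute_list permutes_inv)
  then have e: "set (gouts (graph_lact \<sigma> G)) = set (gouts G)" "set (gins (graph_ract G \<tau>)) = set (gins G)"
    by (metis set_mset_mset)+
  have "wired (graph_lact \<sigma> G)" "wired (graph_ract G \<tau>)"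
    using w m wired_mset_cong[of "graph_lact \<sigma> G" G] wired_mset_cong[of "graph_ract G \<tau>" G] by simp_all
  moreover from this have "flow (graph_lact \<sigma> G)" "flow (graph_ract G \<tau>)"
    using flow_cong[OF w(1) _ w(2)] e by simp_all
  ultimately show "graph_lact \<sigma> G \<in> flow_graphs s" "graph_ract G \<tau> \<in> flow_graphs s"
    using assms by (simp_all add: graphs_model)
qed

lemma act_flow_span:
  assumes "x \<in> flow_span s"
  shows "lin_ext (\<lambda>G. gen (graph_lact \<sigma> G)) x \<in> flow_span s" "lin_ext (\<lambda>G. gen (graph_ract G \<tau>)) x \<in> flow_span s"
proof -
  show "lin_ext (\<lambda>G. gen (graph_lact \<sigma> G)) x \<in> flow_span s"
    by (rule lin_ext_in_span[OF assms]) (auto intro!: formal.span_base imageI act_flow_graphs)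
  show "lin_ext (\<lambda>G. gen (graph_ract G \<tau>)) x \<in> flow_span s"
    by (rule lin_ext_in_span[OF assms]) (auto intro!: formal.span_base imageI act_flow_graphs)
qed

section \<open>Generators of the enveloping ideal\<close>

lemma corolla_flow:
  assumes "x \<in> slot_space s m n d"
  shows "corolla x d m n \<in> flow_graphs s"
proof -
  let ?G = "corolla x d m n"
  have w: "wired ?G" by (simp add: corolla_def wired_def) auto
  moreover have "rigid ?G" unfolding rigid_def wire_set_def corolla_def dgraph.sel list.set by blast
  moreover have "ranked ?G" unfolding ranked_def
    by (rule exI[of _ "\<lambda>w. if w < m then 1 else 0"]) (auto simp: corolla_def)
  ultimately have "flow ?G" by (subst flow_iff) (auto simp: corolla_def)
  then show ?thesis using w assms by (simp add: graphs_model decorated_def corolla_def)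
qed

lemma trivial_flow: "DGraph [0] [] [0] \<in> flow_graphs s"
proof -
  have w: "wired (DGraph [0] [] [0])" by (simp add: wired_def)
  then have "flow (DGraph [0] [] [0])" by (subst flow_iff) (auto simp: ranked_def)
  then show ?thesis using w by (simp add: graphs_model)
qed

lemma forget_levels_flow:
  assumes "G \<in> graphs (\<lambda>_. model s) tree2"
  shows "forget_levels G \<in> flow_graphs s"
proof -
  have G: "wired G" "two_levelled G" "connected_graph G" using assms by (auto simp: graphs_model tree2_def)
  have ne: "verts G \<noteq> []" using G(2,3) by (auto simp: two_levelled_def connected_graph_def)
  have w: "wired (forget_levels G)" using G(1) by (simp add: wired_def forget_levels_def comp_def)
  have ar: "arrows (forget_levels G) = arrows G" by (auto simp: arrows_def forget_levels_def)
  have "connected_graph (forget_levels G)"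
    using G(3) ne unfolding connected_graph_def ar by (simp add: forget_levels_def)
  moreover have "ranked (forget_levels G)" unfolding ranked_def
  \<comment> \<open>Rank by position in a 2-levelled graph: global inputs, wires between the levels,
    global outputs.\<close>
  proof (intro exI[of _ "\<lambda>w. if w \<in> set (gins G) then 0 else if w \<in> set (gouts G) then 2 else 1 :: nat"] ballI)
    fix v x y assume v: "v \<in> set (verts (forget_levels G))" and xy: "x \<in> set (ins v)" "y \<in> set (outs v)"
    then obtain u where u: "u \<in> set (verts G)" "v = set_level 0 u" by (auto simp: forget_levels_def)
    have "y \<notin> set (gins G)" "x \<notin> set (gouts G)" using wired_distinct(5,6)[OF G(1) u(1)] xy u(2) by auto
    moreover have "x \<in> set (gins G) \<or> y \<in> set (gouts G)"
      using G(2) u xy by (auto simp: two_levelled_def)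
    ultimately show "(if x \<in> set (gins G) then 0 else if x \<in> set (gouts G) then 2 else 1 :: nat)
      < (if y \<in> set (gins G) then 0 else if y \<in> set (gouts G) then 2 else 1)" by auto
  qed
  ultimately have "flow (forget_levels G)"
    unfolding flow_def acyclic_iff[OF w] by (auto simp: forget_levels_def)
  then show ?thesis using w assms by (auto simp: graphs_model forget_levels_def)
qed

section \<open>A functional vanishing on the enveloping ideal\<close>

text \<open>Equals 1 on the unit, \<open>m\<close> and \<open>n\<close>, and 0 on
  \<open>b\<close>.\<close>

definition coef0 :: "(nat \<Rightarrow>\<^sub>0 'k::field) \<Rightarrow> 'k" where
  "coef0 x = Poly_Mapping.lookup x 0"

text \<open>
  The types for which the functional on graphs decorated by the unit, \<open>m\<close> and \<open>n\<close> vanishes on the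
  ideal.  The type of the genus 0 composite of \<open>m\<close> and \<open>n\<close>, which is a relation, must be excluded.
\<close>

definition good :: "nat \<Rightarrow> nat \<Rightarrow> int \<Rightarrow> bool" where
  "good m n d \<longleftrightarrow> (int m - int n, d) \<in> {(0, 0), (2, -2), (-2, -4)} \<or> (m = 0 \<and> n = 0 \<and> d = -6)"

abbreviation lam :: "nat \<Rightarrow> nat \<Rightarrow> int \<Rightarrow> (nat \<Rightarrow>\<^sub>0 'k::field) dgraph \<Rightarrow> 'k" where
  "lam m n d \<equiv> weigh coef0 (\<lambda>m' n' d'. of_bool (m' = m \<and> n' = n \<and> d' = d))"

definition coefs0 :: "(nat \<Rightarrow>\<^sub>0 'k::field) vert list \<Rightarrow> 'k" where
  "coefs0 vs = prod_list (map (coef0 \<circ> elt) vs)"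

lemma coefs0_simps [simp]: "coefs0 [] = 1" "coefs0 (v # vs) = coef0 (elt v) * coefs0 vs"
  by (simp_all add: coefs0_def)

lemma lam_eq: "lam m n d G = (if has_type m n d G then coefs0 (verts G) else 0)"
  by (auto simp: weigh_def coefs0_def)

lemma coef0_linear: "coef0 (x + y) = coef0 x + coef0 y" "coef0 (fscale c x) = c * coef0 x"
  by (simp_all add: coef0_def lookup_add)

text \<open>With \<open>b\<close> excluded, degree -2 comes from \<open>m\<close> alone, so
  \<open>na\<close> and \<open>nc\<close> determine both the net arity and the degree.\<close>

lemma decorated_coef0:
  assumes "decorated False v" "coef0 (elt v) \<noteq> 0"
  shows "int (length (outs v)) - int (length (ins v)) = 2 * (int (na v) - int (nc v))"
    "vdeg v = - 2 * int (na v) - 4 * int (nc v)" "nr v = 0"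
proof -
  have "slot False (length (outs v)) (length (ins v)) (vdeg v) = Some 0"
    using assms lookup_slot_space[of "elt v" False _ _ _ 0] unfolding decorated_def coef0_def by (metis (full_types))
  then show "int (length (outs v)) - int (length (ins v)) = 2 * (int (na v) - int (nc v))"
    "vdeg v = - 2 * int (na v) - 4 * int (nc v)" "nr v = 0"
    by (auto simp: slot_def na_def nc_def nr_def split: if_splits)
qed

lemma total_coefs0:
  assumes "\<forall>v\<in>set vs. decorated False v" "coefs0 vs \<noteq> 0"
  shows "int (total (length \<circ> outs) vs) - int (total (length \<circ> ins) vs) = 2 * (int (total na vs) - int (total nc vs))
    \<and> vsdeg vs = - 2 * int (total na vs) - 4 * int (total nc vs) \<and> total nr vs = 0"
  using assms
proof (induction vs)
  case (Cons v vs)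
  then show ?case using decorated_coef0[of v] by simp
qed simp

lemma graph_coefs0:
  assumes "G \<in> graphs (\<lambda>_. model False) S" "coefs0 (verts G) \<noteq> 0"
  shows "int (length (gouts G)) - int (length (gins G)) = 2 * (int (total na (verts G)) - int (total nc (verts G)))"
    "gdeg G = - 2 * int (total na (verts G)) - 4 * int (total nc (verts G))" "total nr (verts G) = 0"
  using total_coefs0[of "verts G"] wired_length[of G] assms by (auto simp: graphs_model gdeg_def)

lemma lam_null: "x \<in> null False \<Longrightarrow> lin_form (lam m n d) x = 0"
proof (rule weigh_null[OF coef0_linear])
  fix G :: "(nat \<Rightarrow>\<^sub>0 'a) dgraph"
  assume "G \<in> flow_graphs False" "lam m n d G \<noteq> 0"
  then have "total nr (verts G) = 0"
    by (intro graph_coefs0(3)[of G flow]) (auto simp: lam_eq split: if_splits)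
  then show "total nr (verts G) \<le> 1" by linarith
qed

lemma lam_act:
  "lin_form (lam m n d) (lin_ext (\<lambda>G. gen (graph_lact \<sigma> G)) x) = lin_form (lam m n d) x"
  "lin_form (lam m n d) (lin_ext (\<lambda>G. gen (graph_ract G \<tau>)) x) = lin_form (lam m n d) x"
  by (simp_all add: lin_form_lin_ext weigh_def[abs_def])

text \<open>\<open>m\<close> counts in \<open>nb\<close> and in \<open>na\<close>, but
  \<open>b\<close> in \<open>nb\<close> only; equal totals therefore exclude
  \<open>b\<close>.\<close>

lemma coefs0_eq_coefs:
  assumes "\<forall>v\<in>set vs. decorated False v" "coefs vs \<noteq> 0" "total nb vs = total na vs"
  shows "coefs0 vs = coefs vs"
  using assms
proof (induction vs)
  case (Cons v vs)
  have sl: "slot False (length (outs v)) (length (ins v)) (vdeg v) \<noteq> None"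
    by (rule decorated_slot) (use Cons.prems in auto)
  then have le: "na v \<le> nb v" by (auto simp: slot_def na_def nb_def split: if_splits)
  moreover have "total na vs \<le> total nb vs"
    using numerics_coefs[of vs False] Cons.prems by (simp add: numerics_def balanced_def)
  ultimately have eq: "nb v = na v" "total nb vs = total na vs" using Cons.prems(3) by auto
  have "slot False (length (outs v)) (length (ins v)) (vdeg v) = Some 0"
    using sl eq(1) by (auto simp: slot_def na_def nb_def split: if_splits)
  then have "coef0 (elt v) = coef (elt v)"
    using lookup_slot_space[of "elt v" False "length (outs v)" "length (ins v)" "vdeg v" 0] Cons.prems(1) by (simp add: coef0_def decorated_def)
  moreover have "coefs0 vs = coefs vs" using Cons.IH Cons.prems eq by simp
  ultimately show ?case by simp
qed simp

text \<open>In a good type the degree leaves no room for \<open>b\<close>, so both sides are the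
  same product of coefficients. In type (1,1,-6) this fails: \<open>m\<close> glued to
  \<open>n\<close> has composite 0 but value 1.\<close>

lemma coef0_compose:
  fixes G :: "(nat \<Rightarrow>\<^sub>0 'k::field) dgraph"
  assumes "G \<in> graphs (\<lambda>_. model False) tree2" "good (length (gouts G)) (length (gins G)) (gdeg G)"
  shows "coef0 (model_compose False G) = coefs0 (verts G)"
proof (cases "coefs (verts G) = 0")
  case True
  then obtain v where v: "v \<in> set (verts G)" "coef (elt v) = 0" by (auto simp: coefs_eq_0)
  then have "elt v = 0" using assms(1) coef_eq_0 unfolding graphs_model decorated_def by blast
  then have "coef0 (elt v) = 0" by (simp add: coef0_def)
  then have "coefs0 (verts G) = 0" using v by (auto simp: coefs0_def prod_list_zero_iff image_iff)
  then show ?thesis using True by (simp add: model_compose_def coef0_def)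
next
  case False
  have G: "wired G" "tree2 G" "\<forall>v\<in>set (verts G). decorated False v" using assms(1) by (auto simp: graphs_model)
  obtain j r c a where t: "total nb (verts G) = j" "total nr (verts G) = r" "total nc (verts G) = c" "total na (verts G) = a"
    by blast
  obtain m n d where mnd: "length (gouts G) = m" "length (gins G) = n" "gdeg G = d" by blast
  have bal: "int m - int n = 2 * (int a - int c)" "d = - 2 * int j - int r - 4 * int c" "r \<le> a" "a \<le> j"
    using graph_balanced[OF G(1,3) False] unfolding t mnd by auto
  have mn: "m + n = 2" using tree_arity[OF G False] unfolding mnd .
  have "good m n d" using assms(2) unfolding mnd .
  then consider "int m - int n = 0" "d = 0" | "int m - int n = 2" "d = -2" | "int m - int n = -2" "d = -4"
    using mn by (auto simp: good_def)
  then have "j = a \<and> slot False m n d = Some 0"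
  proof cases
    case 1
    then have "j = 0" "a = 0" "m = 1" "n = 1" using bal mn by linarith+
    then show ?thesis using 1 by (simp add: slot_def)
  next
    case 2
    then have "c = 0" using bal by linarith
    then have "a = 1" using 2(1) bal(1) by simp
    moreover from this have "j = 1" using 2(2) bal(2-4) \<open>c = 0\<close> by linarith
    moreover have "m = 2" "n = 0" using 2(1) mn by linarith+
    ultimately show ?thesis using 2 by (simp add: slot_def)
  next
    case 3
    then have "2 * (int a - int c) = -2" using bal(1) by simp
    then have "int a - int c = -1" by presburger
    then have "c = a + 1" by simp
    then have "j = 0" "a = 0" using 3(2) bal(2-4) by linarith+
    moreover have "m = 0" "n = 2" using 3(1) mn by linarith+
    ultimately show ?thesis using 3 by (simp add: slot_def)
  qed
  then show ?thesis
    using coefs0_eq_coefs[OF G(3) False] unfolding t by (simp add: model_compose_def slot_elt_def mnd coef0_def)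
qed

text \<open>Vanishing is demanded on all representatives, because \<open>rep\<close> may choose any
  homogeneous one.\<close>

definition killed :: "((nat \<Rightarrow>\<^sub>0 'k::field) dgraph \<Rightarrow>\<^sub>0 'k) set \<Rightarrow> bool" where
  "killed X \<longleftrightarrow> coset_like False X \<and> (\<forall>m n d. good m n d \<longrightarrow> (\<forall>x\<in>X. lin_form (lam m n d) x = 0))"

lemma killed_map:
  assumes "X \<noteq> {}" "\<And>x. x \<in> X \<Longrightarrow> f x \<in> flow_span False"
    "\<And>m n d x. good m n d \<Longrightarrow> x \<in> X \<Longrightarrow> lin_form (lam m n d) (f x) = 0"
  shows "killed (null False + f ` X)"
  unfolding killed_def using coset_like_map[OF assms(1,2)] assms(3)
  by (auto simp: lin_form_add lam_null elim!: set_plus_elim)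

lemma killed_singleton:
  assumes "x \<in> flow_span False" "\<And>m n d. good m n d \<Longrightarrow> lin_form (lam m n d) x = 0"
  shows "killed (null False + {x})"
  using killed_map[of "{x}" "\<lambda>x. x"] assms by simp

lemma killed_nonempty: "killed X \<Longrightarrow> X \<noteq> {}" and killed_span: "killed X \<Longrightarrow> x \<in> X \<Longrightarrow> x \<in> flow_span False"
  and killed_lam: "killed X \<Longrightarrow> good m n d \<Longrightarrow> x \<in> X \<Longrightarrow> lin_form (lam m n d) x = 0"
  by (auto simp: killed_def coset_like_def)

lemma killed_add: "killed X \<Longrightarrow> killed Y \<Longrightarrow> killed (X + Y)"
  unfolding killed_def using coset_like_add by (auto simp: lin_form_add elim!: set_plus_elim)

lemma killed_null: "killed (null False)"
  unfolding killed_def using coset_like_null lam_null by blast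

lemma killed_relations:
  fixes X :: "((nat \<Rightarrow>\<^sub>0 'k::field) dgraph \<Rightarrow>\<^sub>0 'k) set"
  assumes "X \<in> enveloping_relations (model False)"
  shows "killed X"
proof -
  have span: "gen G \<in> flow_span False" if "G \<in> flow_graphs False" for G :: "(nat \<Rightarrow>\<^sub>0 'k) dgraph"
    using that by (auto intro: formal.span_base)
  consider "X = null False + {gen (corolla (gen 0) 0 1 1) - gen (DGraph [0] [] [0])}"
    | G where "X = null False + {gen (corolla (model_compose False G) (gdeg G) (length (gouts G)) (length (gins G))) - gen (forget_levels G)}"
      "G \<in> graphs (\<lambda>_. model False) tree2"
    using assms by (auto simp: enveloping_relations_def graph_class_plus simp del: single_one)
  then show ?thesis
  proof cases
    case 1
    have "(gen 0 :: nat \<Rightarrow>\<^sub>0 'k) \<in> slot_space False 1 1 0" by (simp add: slot_space_def slot_def del: single_one)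
    then have "corolla (gen 0 :: nat \<Rightarrow>\<^sub>0 'k) 0 1 1 \<in> flow_graphs False" by (rule corolla_flow)
    then have "gen (corolla (gen 0 :: nat \<Rightarrow>\<^sub>0 'k) 0 1 1) - gen (DGraph [0] [] [0]) \<in> flow_span False"
      by (intro formal.span_diff span trivial_flow)
    moreover have "lin_form (lam m n d) (gen (corolla (gen 0 :: nat \<Rightarrow>\<^sub>0 'k) 0 1 1) - gen (DGraph [0] [] [0])) = 0" for m n d
      by (simp add: lin_form_diff weigh_def gdeg_def corolla_def coef0_def lookup_one)
    ultimately show ?thesis unfolding 1 by (intro killed_singleton)
  next
    case 2
    let ?c = "corolla (model_compose False G) (gdeg G) (length (gouts G)) (length (gins G))"
    have "?c \<in> flow_graphs False" by (rule corolla_flow) (simp add: model_compose_def slot_elt_in)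
    then have "gen ?c - gen (forget_levels G) \<in> flow_span False"
      using forget_levels_flow[OF 2(2)] by (intro formal.span_diff span)
    moreover have "lin_form (lam m n d) (gen ?c - gen (forget_levels G)) = 0" if "good m n d" for m n d
    proof -
      have "lam m n d ?c = (if has_type m n d G then coef0 (model_compose False G) else 0)"
        by (simp add: lam_eq gdeg_def corolla_def)
      moreover have "lam m n d (forget_levels G) = (if has_type m n d G then coefs0 (verts G) else 0)"
        by (simp add: lam_eq gdeg_def forget_levels_def coefs0_def comp_def)
      ultimately show ?thesis using coef0_compose[OF 2(2)] that by (auto simp: lin_form_diff)
    qed
    ultimately show ?thesis unfolding 2(1) by (intro killed_singleton)
  qed
qed

text \<open>The functional is multiplicative because substitution collects the decorations
  unchanged.\<close>

lemma coefs0_substitution: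
  assumes "composable G Gs"
  shows "coefs0 (verts (substitution G Gs)) = prod_list (map (coefs0 \<circ> verts) Gs)"
proof -
  interpret composable G Gs by (rule assms)
  have "coefs0 (verts (substitution G Gs)) = prod_list (map coef0 (map elt (verts (substitution G Gs))))"
    by (simp add: coefs0_def)
  also have "\<dots> = prod_list (map coef0 (concat (map (map elt \<circ> verts) Gs)))"
    by (simp only: substitutes_type(3)[OF substitutes_substitution])
  also have "\<dots> = prod_list (map (coefs0 \<circ> verts) Gs)"
    by (induction Gs) (auto simp: coefs0_def)
  finally show ?thesis .
qed

text \<open>The counts of the blocks add up to those of \<open>G\<close>, so a block contains at
  most one \<open>m\<close> and one \<open>n\<close>. If it contains both, then \<open>G\<close> has
  no legs; on either level the block then has no inputs or no outputs, and as these are equal in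
  number its type is (0,0,-6) and not the excluded (1,1,-6).\<close>

lemma good_blocks:
  assumes "wired G" "two_levelled G" "good (length (gouts G)) (length (gins G)) (gdeg G)"
    and "\<And>i. i < length (verts G) \<Longrightarrow> int (length (outs (verts G ! i))) - int (length (ins (verts G ! i))) = 2 * (int (a i) - int (c i))
       \<and> vdeg (verts G ! i) = - 2 * int (a i) - 4 * int (c i)"
    and k: "k < length (verts G)"
  shows "good (length (outs (verts G ! k))) (length (ins (verts G ! k))) (vdeg (verts G ! k))"
proof -
  let ?N = "length (verts G)"
  define A C where "A = (\<Sum>i<?N. a i)" and "C = (\<Sum>i<?N. c i)"
  obtain m n d where mnd: "length (gouts G) = m" "length (gins G) = n" "gdeg G = d" by blast
  have lenG: "int n + (\<Sum>i<?N. int (length (outs (verts G ! i)))) = int m + (\<Sum>i<?N. int (length (ins (verts G ! i))))"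
    using arg_cong[OF wired_length[OF assms(1)], of int] mnd
    by (simp add: sum_list_sum_nth atLeast0LessThan)
  have "(\<Sum>i<?N. int (length (outs (verts G ! i))) - int (length (ins (verts G ! i)))) = (\<Sum>i<?N. 2 * (int (a i) - int (c i)))"
    by (rule sum.cong) (use assms(4) in auto)
  then have e1: "int m - int n = 2 * (int A - int C)"
    using lenG by (simp add: A_def C_def sum_subtractf flip: sum_distrib_left)
  have "d = (\<Sum>i<?N. vdeg (verts G ! i))"
    using mnd(3) by (simp add: gdeg_def sum_list_sum_nth atLeast0LessThan)
  also have "\<dots> = (\<Sum>i<?N. - 2 * int (a i) - 4 * int (c i))" by (rule sum.cong) (use assms(4) in auto)
  also have "\<dots> = - 2 * int A - 4 * int C"
    by (simp add: A_def C_def sum_subtractf sum_negf flip: sum_distrib_left)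
  finally have e2: "d = - 2 * int A - 4 * int C" .
  have ak: "a k \<le> A" "c k \<le> C" unfolding A_def C_def by (rule member_le_sum; use k in auto)+
  have "good m n d" using assms(3) unfolding mnd .
  then consider "A \<le> 1" "C = 0" | "A = 0" "C = 1" | "m = 0" "n = 0" "A = 1" "C = 1"
    using e1 e2 unfolding good_def by fastforce
  then show ?thesis
  proof cases
    case 1
    then have "c k = 0" "a k = 0 \<or> a k = 1" using ak by auto
    then show ?thesis using assms(4)[OF k] by (auto simp: good_def)
  next
    case 2
    then have "a k = 0" "c k = 0 \<or> c k = 1" using ak by auto
    then show ?thesis using assms(4)[OF k] by (auto simp: good_def)
  next
    case 3
    show ?thesis
    proof (cases "a k = 1 \<and> c k = 1")
      case False
      then have "(a k, c k) \<in> {(0, 0), (1, 0), (0, 1)}" using ak 3 by auto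
      then show ?thesis using assms(4)[OF k] by (auto simp: good_def)
    next
      case True
      have z: "length (outs (verts G ! k)) = length (ins (verts G ! k))" using assms(4)[OF k] True by simp
      have io: "gins G = []" "gouts G = []" using 3 mnd by auto
      have "level (verts G ! k) = 1 \<or> level (verts G ! k) = 2" using assms(2) k by (auto simp: two_levelled_def)
      moreover have "set (ins (verts G ! k)) \<subseteq> set (gins G)" if "level (verts G ! k) = 1"
        using assms(2) k that unfolding two_levelled_def by auto
      moreover have "set (outs (verts G ! k)) \<subseteq> set (gouts G)" if "level (verts G ! k) = 2"
        using assms(2) k that unfolding two_levelled_def by auto
      ultimately have "set (ins (verts G ! k)) = {} \<or> set (outs (verts G ! k)) = {}"
        unfolding io by auto
      then show ?thesis using z True assms(4)[OF k] by (auto simp: good_def)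
    qed
  qed
qed

text \<open>The value is a product over the blocks. If no factor vanished, every representative
  would contain a graph of nonzero value, whose counts feed \<open>good_blocks\<close>; so the
  killed block has a good type and its factor vanishes after all.\<close>

lemma lam_compose_sum:
  fixes G :: "((nat \<Rightarrow>\<^sub>0 'k::field) dgraph \<Rightarrow>\<^sub>0 'k) set dgraph"
  assumes G: "G \<in> graphs (\<lambda>_. free_properad (model False)) conn2"
    and v: "v \<in> set (verts G)" "killed (elt v)" and g: "good m n d"
  shows "lin_form (lam m n d) (compose_sum G (reps (model False) G)) = 0"
proof (cases "has_type m n d G")
  case False
  have "lam m n d (substitution G Gs) = 0" if "Gs \<in> listset (map Poly_Mapping.keys (reps (model False) G))" for Gs
  proof -
    note kc = keys_composable[OF G that]
    interpret composable G Gs by (rule kc(1))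
    have "gdeg (substitution G Gs) = gdeg G"
      using substitutes_type(4)[OF substitutes_substitution] kc(3,4)
      by (simp add: gdeg_def sum_list_sum_nth atLeast0LessThan)
    then show ?thesis using False substitutes_type(1,2)[OF substitutes_substitution] by (auto simp: lam_eq)
  qed
  then show ?thesis by (simp add: compose_sum_def lin_form_sum lin_form_fscale)
next
  case True
  let ?xs = "reps (model False) G"
  have "lin_form (lam m n d) (compose_sum G ?xs) =
      (\<Sum>Gs\<in>listset (map Poly_Mapping.keys ?xs). prod_list (map2 (\<lambda>x K. Poly_Mapping.lookup x K * coefs0 (verts K)) ?xs Gs))"
    unfolding compose_sum_def lin_form_sum lin_form_fscale
  proof (rule sum.cong[OF HOL.refl])
    fix Gs assume Gs: "Gs \<in> listset (map Poly_Mapping.keys ?xs)"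
    note kc = keys_composable[OF G Gs]
    interpret composable G Gs by (rule kc(1))
    have "gdeg (substitution G Gs) = gdeg G"
      using substitutes_type(4)[OF substitutes_substitution] kc(3,4)
      by (simp add: gdeg_def sum_list_sum_nth atLeast0LessThan)
    then have "lam m n d (substitution G Gs) = prod_list (map (coefs0 \<circ> verts) Gs)"
      using True substitutes_type(1,2)[OF substitutes_substitution] coefs0_substitution[OF kc(1)] by (simp add: lam_eq)
    moreover have "prod_list (map2 Poly_Mapping.lookup xs Gs) * prod_list (map (coefs0 \<circ> verts) Gs) =
      prod_list (map2 (\<lambda>x K. Poly_Mapping.lookup x K * coefs0 (verts K)) xs Gs)"
      if "length xs = length Gs" for xs and Gs :: "(nat \<Rightarrow>\<^sub>0 'k) dgraph list"
      using that by (induction xs Gs rule: list_induct2) (auto simp: algebra_simps)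
    moreover have "length ?xs = length Gs" using kc(4) by simp
    ultimately show "prod_list (map2 Poly_Mapping.lookup ?xs Gs) * lin_form (lam m n d) (gen (substitution G Gs)) =
      prod_list (map2 (\<lambda>x K. Poly_Mapping.lookup x K * coefs0 (verts K)) ?xs Gs)"
      by simp
  qed
  also have "\<dots> = prod_list (map (\<lambda>x. \<Sum>K\<in>Poly_Mapping.keys x. Poly_Mapping.lookup x K * coefs0 (verts K)) ?xs)"
    by (rule sum_listset_prod)
  also have "\<dots> = prod_list (map (lin_form (coefs0 \<circ> verts)) ?xs)"
    by (simp add: lin_form_def comp_def)
  also have "\<dots> = 0"
  proof (rule ccontr)
    assume ne: "prod_list (map (lin_form (coefs0 \<circ> verts)) ?xs) \<noteq> 0"
    have ex: "\<exists>K\<in>Poly_Mapping.keys (?xs ! i). coefs0 (verts K) \<noteq> 0" if "i < length (verts G)" for i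
    proof (rule ccontr)
      assume "\<not> ?thesis"
      then have "lin_form (coefs0 \<circ> verts) (?xs ! i) = 0" by (simp add: lin_form_def)
      moreover have "?xs ! i \<in> set ?xs" using that by (intro nth_mem) simp
      ultimately show False using ne by (auto simp: prod_list_zero_iff)
    qed
    have "\<forall>i. \<exists>a c. i < length (verts G) \<longrightarrow> int (length (outs (verts G ! i))) - int (length (ins (verts G ! i))) = 2 * (int a - int c)
       \<and> vdeg (verts G ! i) = - 2 * int a - 4 * int c"
    proof
      fix i
      show "\<exists>a c. i < length (verts G) \<longrightarrow> int (length (outs (verts G ! i))) - int (length (ins (verts G ! i))) = 2 * (int a - int c)
       \<and> vdeg (verts G ! i) = - 2 * int a - 4 * int c"
      proof (cases "i < length (verts G)")
        case True
        then obtain K where K: "K \<in> Poly_Mapping.keys (?xs ! i)" "coefs0 (verts K) \<noteq> 0" using ex by blast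
        show ?thesis
          using graph_coefs0(1,2)[OF rep_keys(1)[OF G True K(1)] K(2)] rep_keys(2)[OF G True K(1)] by auto
      qed blast
    qed
    then obtain a c where ac: "\<And>i. i < length (verts G) \<Longrightarrow> int (length (outs (verts G ! i))) - int (length (ins (verts G ! i))) = 2 * (int (a i) - int (c i))
       \<and> vdeg (verts G ! i) = - 2 * int (a i) - 4 * int (c i)"
      by metis
    obtain k where k: "k < length (verts G)" "v = verts G ! k" using v(1) by (metis in_set_conv_nth)
    have gk: "good (length (outs v)) (length (ins v)) (vdeg v)"
      unfolding k(2) by (rule good_blocks[OF _ _ _ ac k(1)]) (use G g True in \<open>auto simp: graphs_def conn2_def\<close>)
    have "elt v \<in> part (free_properad (model False)) (length (outs v)) (length (ins v)) (vdeg v)"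
      using G v(1) by (simp add: graphs_def del: free_properad_simps)
    from rep_free(1)[OF this] have "?xs ! k \<in> elt v" using k by simp
    then have "lin_form (lam (length (outs v)) (length (ins v)) (vdeg v)) (?xs ! k) = 0"
      using killed_lam[OF v(2) gk] by blast
    moreover have "lin_form (lam (length (outs v)) (length (ins v)) (vdeg v)) (?xs ! k) = lin_form (coefs0 \<circ> verts) (?xs ! k)"
      by (rule lin_form_cong) (use rep_keys(2)[OF G k(1)] k(2) in \<open>auto simp: lam_eq\<close>)
    moreover have "?xs ! k \<in> set ?xs" using k by (intro nth_mem) simp
    ultimately show False using ne by (auto simp: prod_list_zero_iff)
  qed
  finally show ?thesis .
qed

text \<open>The linear operations and the actions preserve the functional up to scalars; closure
  under composition is the substance of \<open>lam_compose_sum\<close>.\<close>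

lemma killed_ideal: "X \<in> enveloping_ideal (model False) \<Longrightarrow> killed X"
  unfolding enveloping_ideal_def
proof (induction rule: properadic_ideal.induct)
  case zero then show ?case by (simp add: killed_null)
next
  case (base x) then show ?case by (rule killed_relations)
next
  case (add x y) then show ?case by (simp add: killed_add)
next
  case (smult x c)
  have "killed (null False + fscale c ` x)"
    using smult.IH by (intro killed_map) (auto simp: lin_form_fscale killed_lam killed_span killed_nonempty intro: formal.span_scale)
  then show ?case by simp
next
  case (lact x m n d \<sigma>)
  have "killed (null False + lin_ext (\<lambda>G. gen (graph_lact \<sigma> G)) ` x)"
    using lact.IH by (intro killed_map) (auto simp: lam_act killed_lam killed_span killed_nonempty act_flow_span)
  then show ?case by simp
next
  case (ract x m n d \<tau>)
  have "killed (null False + lin_ext (\<lambda>G. gen (graph_ract G \<tau>)) ` x)"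
    using ract.IH by (intro killed_map) (auto simp: lam_act killed_lam killed_span killed_nonempty act_flow_span)
  then show ?case by simp
next
  case (compose G v)
  then show ?case
    by (auto simp: free_compose_sum intro!: killed_singleton compose_sum_span lam_compose_sum simp del: list.map)
qed

section \<open>Well-definedness of substitution modulo the graph relations\<close>

lemma null_closed: "x \<in> graph_null B S \<Longrightarrow> y \<in> graph_null B S \<Longrightarrow> x + y \<in> graph_null B S"
  "x \<in> graph_null B S \<Longrightarrow> y \<in> graph_null B S \<Longrightarrow> x - y \<in> graph_null B S"
  "x \<in> graph_null B S \<Longrightarrow> - x \<in> graph_null B S"
  unfolding graph_null_def by (simp_all add: formal.span_add formal.span_diff formal.span_neg)

lemma null_transfer3:
  assumes "a - a' \<in> graph_null B S" "b - b' \<in> graph_null B S" "c - c' \<in> graph_null B S" "a' - b' - c' \<in> graph_null B S"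
  shows "a - b - c \<in> graph_null B S"
  using null_closed(1)[OF null_closed(2)[OF null_closed(2)[OF assms(1,2)] assms(3)] assms(4)]
  by (simp add: algebra_simps)

lemma null_transfer:
  assumes "a - a' \<in> graph_null B S" "b - b' \<in> graph_null B S" "a' - fscale c b' \<in> graph_null B S"
  shows "a - fscale c b \<in> graph_null B S"
proof -
  have "fscale c (b - b') = fscale c b - fscale c b'"
    by (rule poly_mapping_eqI) (simp add: lookup_minus algebra_simps)
  then show ?thesis
    using null_closed(1)[OF null_closed(2)[OF assms(1) null_scale[OF assms(2), of c]] assms(3)]
    by (simp add: algebra_simps)
qed

lemma null_transfer2:
  assumes "a - a' \<in> graph_null B S" "b - b' \<in> graph_null B S" "a' - b' \<in> graph_null B S"
  shows "a - b \<in> graph_null B S"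
  using null_transfer[of a a' B S b b' 1] assms by simp

lemma rel_null: "x \<in> graph_rels B S \<Longrightarrow> x \<in> graph_null B S"
  unfolding graph_null_def by (rule formal.span_base)

lemma concat_upt_split:
  assumes "i < n"
  shows "concat (map f [0..<n]) = concat (map f [0..<i]) @ f i @ concat (map f [Suc i..<n])"
proof -
  have "[0..<n] = [0..<i] @ i # [Suc i..<n]"
    using upt_add_eq_append[of 0 i "n - i"] upt_conv_Cons[OF assms] assms by simp
  then show ?thesis by (simp only: map_append concat_append list.map concat.simps)
qed

lemma rename_concat:
  "mset (concat (map outs vs)) = mset (concat (map outs ws)) \<Longrightarrow>
    mset (concat (map outs (map (rename_vert f) vs))) = mset (concat (map outs (map (rename_vert f) ws)))"
  "mset (concat (map ins vs)) = mset (concat (map ins ws)) \<Longrightarrow>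
    mset (concat (map ins (map (rename_vert f) vs))) = mset (concat (map ins (map (rename_vert f) ws)))"
  by (simp_all only: map_map concat_map_rename mset_map)

text \<open>A relation changes a segment \<open>mid\<close> of one inserted graph. As long as the
  new segment uses the same wires, all names can be kept, and only the image of \<open>mid\<close>
  changes in the result.\<close>

lemma substitutes_modify:
  fixes mid :: "'a vert list"
  assumes "substitutes G Gs H" "i < length Gs" "Gs ! i = DGraph gos (vs @ mid @ ws) gis"
  shows "\<exists>\<psi> A B go gi. H = DGraph go (A @ map (rename_vert \<psi>) mid @ B) gi \<and>
    (\<forall>mid'. mset (concat (map outs mid')) = mset (concat (map outs mid)) \<longrightarrow>
       mset (concat (map ins mid')) = mset (concat (map ins mid)) \<longrightarrow>
       substitutes G (Gs[i := DGraph gos (vs @ mid' @ ws) gis]) (DGraph go (A @ map (rename_vert \<psi>) mid' @ B) gi))"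
proof -
  obtain \<phi> \<psi> where len: "length Gs = length (verts G)" and w: "wired H"
    and eq: "\<forall>i<length Gs. map \<phi> (outs (verts G ! i)) = map (\<psi> i) (gouts (Gs ! i)) \<and>
           map \<phi> (ins (verts G ! i)) = map (\<psi> i) (gins (Gs ! i))"
    and H: "H = DGraph (map \<phi> (gouts G))
               (concat (map (\<lambda>i. map (rename_vert (\<psi> i)) (verts (Gs ! i))) [0..<length Gs]))
               (map \<phi> (gins G))"
    using assms(1) unfolding substitutes_def by blast
  define f where "f j = map (rename_vert (\<psi> j)) (verts (Gs ! j))" for j
  define A where "A = concat (map f [0..<i]) @ map (rename_vert (\<psi> i)) vs"
  define B where "B = map (rename_vert (\<psi> i)) ws @ concat (map f [Suc i..<length Gs])"
  define K where "K mid' = DGraph gos (vs @ mid' @ ws) gis" for mid' :: "'a vert list"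
  have split: "concat (map (\<lambda>j. map (rename_vert (\<psi> j)) (verts (Gs[i := K mid'] ! j))) [0..<length Gs]) =
      A @ map (rename_vert (\<psi> i)) mid' @ B" for mid' :: "'a vert list"
  proof -
    let ?g = "\<lambda>j. map (rename_vert (\<psi> j)) (verts (Gs[i := K mid'] ! j))"
    have "map ?g [0..<i] = map f [0..<i]" "map ?g [Suc i..<length Gs] = map f [Suc i..<length Gs]"
      by (auto simp: f_def)
    moreover have "?g i = map (rename_vert (\<psi> i)) vs @ map (rename_vert (\<psi> i)) mid' @ map (rename_vert (\<psi> i)) ws"
      using assms(2) by (simp add: K_def)
    ultimately show ?thesis
      by (simp only: concat_upt_split[OF assms(2), of ?g] A_def B_def append_assoc)
  qed
  have "Gs[i := K mid] = Gs" using assms(3) by (simp add: K_def list_update_same_conv assms(2))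
  then have H': "H = DGraph (map \<phi> (gouts G)) (A @ map (rename_vert (\<psi> i)) mid @ B) (map \<phi> (gins G))"
    using H split[of mid] by simp
  show ?thesis
  proof (intro exI conjI allI impI, rule H')
    fix mid' :: "'a vert list"
    assume m: "mset (concat (map outs mid')) = mset (concat (map outs mid))" "mset (concat (map ins mid')) = mset (concat (map ins mid))"
    let ?H = "DGraph (map \<phi> (gouts G)) (A @ map (rename_vert (\<psi> i)) mid' @ B) (map \<phi> (gins G))"
    have "mset (concat (map outs (verts ?H))) = mset (concat (map outs (verts H)))"
      "mset (concat (map ins (verts ?H))) = mset (concat (map ins (verts H)))"
      unfolding H' dgraph.sel map_append concat_append mset_append
      by (simp_all only: rename_concat(1)[OF m(1)] rename_concat(2)[OF m(2)])
    then have "wired ?H" using w by (subst wired_mset_cong[where G' = H]) (simp_all add: H')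
    moreover have "\<forall>j<length (Gs[i := K mid']). map \<phi> (outs (verts G ! j)) = map (\<psi> j) (gouts (Gs[i := K mid'] ! j)) \<and>
           map \<phi> (ins (verts G ! j)) = map (\<psi> j) (gins (Gs[i := K mid'] ! j))"
      using eq assms(2,3) by (auto simp: nth_list_update K_def)
    ultimately show "substitutes G (Gs[i := DGraph gos (vs @ mid' @ ws) gis]) ?H"
      unfolding substitutes_def K_def[symmetric] using len split[of mid'] by (auto intro!: exI[of _ \<phi>] exI[of _ \<psi>])
  qed
qed

lemma rename_vert_comp: "rename_vert f (rename_vert g v) = rename_vert (f \<circ> g) v"
  by (cases v) simp

text \<open>A renaming inside an inserted graph is absorbed by composing its naming
  \<open>\<psi> i\<close> with a left inverse.\<close>

lemma substitutes_rename:
  assumes "substitutes G Gs H" "i < length Gs" "inj f"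
  shows "substitutes G (Gs[i := rename_wires f (Gs ! i)]) H"
proof -
  obtain \<phi> \<psi> where len: "length Gs = length (verts G)" and w: "wired H"
    and eq: "\<forall>i<length Gs. map \<phi> (outs (verts G ! i)) = map (\<psi> i) (gouts (Gs ! i)) \<and>
           map \<phi> (ins (verts G ! i)) = map (\<psi> i) (gins (Gs ! i))"
    and H: "H = DGraph (map \<phi> (gouts G))
               (concat (map (\<lambda>i. map (rename_vert (\<psi> i)) (verts (Gs ! i))) [0..<length Gs]))
               (map \<phi> (gins G))"
    using assms(1) unfolding substitutes_def by blast
  define g where "g = inv_into UNIV f"
  have gf: "g \<circ> f = id" using assms(3) by (auto simp: g_def fun_eq_iff inv_f_f)
  define \<psi>' where "\<psi>' = \<psi>(i := \<psi> i \<circ> g)"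
  have c: "\<psi> i \<circ> g \<circ> f = \<psi> i" using gf by (simp add: comp_assoc)
  have e: "map (rename_vert (\<psi>' j)) (verts (Gs[i := rename_wires f (Gs ! i)] ! j)) = map (rename_vert (\<psi> j)) (verts (Gs ! j))"
    if "j < length Gs" for j
    using that assms(2) c by (cases "j = i") (auto simp: \<psi>'_def rename_vert_comp)
  have "\<forall>j<length (Gs[i := rename_wires f (Gs ! i)]). map \<phi> (outs (verts G ! j)) = map (\<psi>' j) (gouts (Gs[i := rename_wires f (Gs ! i)] ! j)) \<and>
           map \<phi> (ins (verts G ! j)) = map (\<psi>' j) (gins (Gs[i := rename_wires f (Gs ! i)] ! j))"
    using eq c by (auto simp: nth_list_update \<psi>'_def comp_assoc)
  moreover have "map (\<lambda>j. map (rename_vert (\<psi>' j)) (verts (Gs[i := rename_wires f (Gs ! i)] ! j))) [0..<length Gs] =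
      map (\<lambda>j. map (rename_vert (\<psi> j)) (verts (Gs ! j))) [0..<length Gs]"
    by (rule map_cong[OF HOL.refl]) (use e in auto)
  ultimately have "H = DGraph (map \<phi> (gouts G))
      (concat (map (\<lambda>j. map (rename_vert (\<psi>' j)) (verts (Gs[i := rename_wires f (Gs ! i)] ! j)))
        [0..<length (Gs[i := rename_wires f (Gs ! i)])])) (map \<phi> (gins G))"
    and "\<forall>j<length (Gs[i := rename_wires f (Gs ! i)]). map \<phi> (outs (verts G ! j)) = map (\<psi>' j) (gouts (Gs[i := rename_wires f (Gs ! i)] ! j)) \<and>
           map \<phi> (ins (verts G ! j)) = map (\<psi>' j) (gins (Gs[i := rename_wires f (Gs ! i)] ! j))"
    using H by (simp_all only: length_list_update)
  moreover have "length (Gs[i := rename_wires f (Gs ! i)]) = length (verts G)" using len by simp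
  ultimately show ?thesis
    unfolding substitutes_def using w by blast
qed

text \<open>Uniqueness up to renaming, so that modulo the relations the choice in
  \<open>substitution\<close> does not matter.\<close>

definition determinate :: "'b dgraph \<Rightarrow> 'a dgraph list \<Rightarrow> bool" where
  "determinate G Gs \<longleftrightarrow> (\<forall>H H'. composable G Gs \<longrightarrow> substitutes G Gs H \<longrightarrow> substitutes G Gs H' \<longrightarrow>
     (\<exists>f. inj f \<and> H' = rename_wires f H))"

lemma determinate_null:
  assumes "determinate G Gs" "composable G Gs" "\<And>i. i < length Gs \<Longrightarrow> Gs ! i \<in> flow_graphs s"
    "substitutes G Gs H"
  shows "gen (substitution G Gs) - gen H \<in> null s" "H \<in> flow_graphs s"
proof -
  interpret composable G Gs by (rule assms(2))
  have fl: "substitution G Gs \<in> flow_graphs s"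
    by (rule substitution_flow_graph[OF assms(3) substitutes_substitution])
  show H: "H \<in> flow_graphs s" by (rule substitution_flow_graph[OF assms(3,4)])
  obtain f where "inj f" "substitution G Gs = rename_wires f H"
    using assms(1,2,4) substitutes_substitution unfolding determinate_def by blast
  then show "gen (substitution G Gs) - gen H \<in> null s"
    using graph_rels.rename[OF H, of f] rel_null by metis
qed

text \<open>A relation among inserted graphs becomes the same relation among the results, once the
  chosen substitutions are exchanged for ones with common names; \<open>determinate\<close> permits
  the exchange.\<close>

lemma slot_null:
  fixes G :: "'b dgraph" and Gs :: "(nat \<Rightarrow>\<^sub>0 'k::field) dgraph list"
  assumes det: "\<And>g. determinate G (Gs[i := g])" and comp: "composable G Gs" and i: "i < length Gs"
    and fl: "\<And>j. j < length Gs \<Longrightarrow> Gs ! j \<in> flow_graphs s"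
    and r: "r \<in> null s"
    and keys: "\<And>g. g \<in> Poly_Mapping.keys r \<Longrightarrow> g \<in> flow_graphs s \<and>
      length (gouts g) = length (gouts (Gs ! i)) \<and> length (gins g) = length (gins (Gs ! i))"
  shows "lin_ext (\<lambda>g. gen (substitution G (Gs[i := g]))) r \<in> null s"
proof -
  define lens where "lens g \<longleftrightarrow> length (gouts g) = length (gouts (Gs ! i)) \<and> length (gins g) = length (gins (Gs ! i))"
    for g :: "(nat \<Rightarrow>\<^sub>0 'k) dgraph"
  \<comment> \<open>A null element may combine relations of all arities. The cutoff
    \<open>lens\<close> discards graphs that do not fit the vertex and leaves the map unchanged on
    \<open>r\<close>.\<close>
  define K where "K g = (if lens g then gen (substitution G (Gs[i := g])) else (0 :: _ \<Rightarrow>\<^sub>0 'k))" for g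
  have comp': "composable G (Gs[i := g])" if "g \<in> flow_graphs s" "lens g" for g
  proof -
    interpret composable G Gs by (rule comp)
    show ?thesis
      by unfold_locales
        (use wired_G conn_G len wired_Gs flow_Gs gouts_Gs gins_Gs that i in
          \<open>auto simp: graphs_model lens_def nth_list_update\<close>)
  qed
  have fl': "Gs[i := g] ! j \<in> flow_graphs s" if "g \<in> flow_graphs s" "j < length (Gs[i := g])" for g j
    using that fl i by (cases "j = i") simp_all
  have main: "K g - gen H \<in> null s" "H \<in> flow_graphs s"
    if "g \<in> flow_graphs s" "lens g" "substitutes G (Gs[i := g]) H" for g H
    using determinate_null[OF det comp'[OF that(1,2)] fl'[OF that(1)] that(3)] that(2) by (simp_all add: K_def)
  have ex: "substitutes G (Gs[i := g]) (substitution G (Gs[i := g]))" if "g \<in> flow_graphs s" "lens g" for g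
    using composable.substitutes_substitution[OF comp'[OF that]] .
  have dec: "elt v \<in> slot_space s (length (outs v)) (length (ins v)) (vdeg v)"
    if "DGraph gos (vs @ v # ws) gis \<in> flow_graphs s" for gos vs v ws and gis
    using that by (auto simp: graphs_model decorated_def)
  have mod: "\<exists>\<psi> A B go gi. substitutes G (Gs[i := DGraph gos (vs @ mid @ ws) gis]) (DGraph go (A @ map (rename_vert \<psi>) mid @ B) gi) \<and>
    (\<forall>mid'. mset (concat (map outs mid')) = mset (concat (map outs mid)) \<longrightarrow>
       mset (concat (map ins mid')) = mset (concat (map ins mid)) \<longrightarrow>
       substitutes G (Gs[i := DGraph gos (vs @ mid' @ ws) gis]) (DGraph go (A @ map (rename_vert \<psi>) mid' @ B) gi))"
    if "DGraph gos (vs @ mid @ ws) gis \<in> flow_graphs s" "lens (DGraph gos (vs @ mid @ ws) gis)" for gos vs mid ws gis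
  proof -
    have "i < length (Gs[i := DGraph gos (vs @ mid @ ws) gis])"
      "Gs[i := DGraph gos (vs @ mid @ ws) gis] ! i = DGraph gos (vs @ mid @ ws) gis" using i by auto
    from substitutes_modify[OF ex[OF that] this] show ?thesis by (simp only: list_update_overwrite) blast
  qed
  have mod1: "\<exists>\<psi> A B go gi. \<forall>z os' is'. mset os' = mset os \<longrightarrow> mset is' = mset is \<longrightarrow>
      substitutes G (Gs[i := DGraph gos (vs @ Vert z d l os' is' # ws) gis]) (DGraph go (A @ Vert z d l (map \<psi> os') (map \<psi> is') # B) gi)"
    if g: "DGraph gos (vs @ Vert x d l os is # ws) gis \<in> flow_graphs s" "lens (DGraph gos (vs @ Vert x d l os is # ws) gis)"
    for gos vs ws gis x d l os "is"
  proof -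
    obtain \<psi> A B go gi where m: "\<forall>mid'. mset (concat (map outs mid')) = mset (concat (map outs [Vert x d l os is])) \<longrightarrow>
       mset (concat (map ins mid')) = mset (concat (map ins [Vert x d l os is])) \<longrightarrow>
       substitutes G (Gs[i := DGraph gos (vs @ mid' @ ws) gis]) (DGraph go (A @ map (rename_vert \<psi>) mid' @ B) gi)"
      using mod[of gos vs "[Vert x d l os is]" ws gis] g by auto
    show ?thesis
    proof (intro exI allI impI)
      fix z os' is' assume "mset os' = mset os" "mset is' = mset is"
      then show "substitutes G (Gs[i := DGraph gos (vs @ Vert z d l os' is' # ws) gis]) (DGraph go (A @ Vert z d l (map \<psi> os') (map \<psi> is') # B) gi)"
        using spec[OF m, of "[Vert z d l os' is']"] by simp
    qed
  qed
  have rels: "lin_ext K x \<in> null s" if "x \<in> graph_rels (\<lambda>_. model s) flow" for x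
    using that
  proof cases
    case (add gos vs x d l os "is" ws gis y)
    let ?g = "\<lambda>x. DGraph gos (vs @ Vert x d l os is # ws) gis"
    have e: "lin_ext K (gen (?g (x + y)) - gen (?g x) - gen (?g y)) = K (?g (x + y)) - K (?g x) - K (?g y)"
      by (simp add: lin_ext_diff)
    show ?thesis
    proof (cases "lens (?g x)")
      case False
      then show ?thesis unfolding add(1) using e zero_null by (auto simp: K_def lens_def)
    next
      case True
      have lens: "lens (?g z)" for z using True by (simp add: lens_def)
      obtain \<psi> A B go gi where H: "\<And>z. substitutes G (Gs[i := ?g z]) (DGraph go (A @ Vert z d l (map \<psi> os) (map \<psi> is) # B) gi)"
        using mod1[OF add(2) True] by blast
      let ?H = "\<lambda>z. DGraph go (A @ Vert z d l (map \<psi> os) (map \<psi> is) # B) gi"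
      have gxy: "?g (x + y) \<in> flow_graphs s"
        using graphs_modify[OF stable_flow add(2)] dec[OF add(2)] dec[OF add(3)] by (simp add: slot_space_closed)
      have "gen (?H (x + y)) - gen (?H x) - gen (?H y) \<in> null s"
        using graph_rels.add[OF main(2)[OF add(2) lens H] main(2)[OF add(3) lens H]] by (auto intro: rel_null)
      then have "K (?g (x + y)) - K (?g x) - K (?g y) \<in> null s"
        by (rule null_transfer3[OF main(1)[OF gxy lens H] main(1)[OF add(2) lens H] main(1)[OF add(3) lens H]])
      then show ?thesis using e unfolding add(1) by simp
    qed
  next
    case (smult gos vs x d l os "is" ws gis c)
    let ?g = "\<lambda>x. DGraph gos (vs @ Vert x d l os is # ws) gis"
    have e: "lin_ext K (gen (?g (fscale c x)) - fscale c (gen (?g x))) = K (?g (fscale c x)) - fscale c (K (?g x))"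
      by (simp add: lin_ext_diff)
    show ?thesis
    proof (cases "lens (?g x)")
      case False
      then show ?thesis unfolding smult(1) using e zero_null by (auto simp: K_def lens_def)
    next
      case True
      have lens: "lens (?g z)" for z using True by (simp add: lens_def)
      obtain \<psi> A B go gi where H: "\<And>z. substitutes G (Gs[i := ?g z]) (DGraph go (A @ Vert z d l (map \<psi> os) (map \<psi> is) # B) gi)"
        using mod1[OF smult(2) True] by blast
      let ?H = "\<lambda>z. DGraph go (A @ Vert z d l (map \<psi> os) (map \<psi> is) # B) gi"
      have gc: "?g (fscale c x) \<in> flow_graphs s"
        using graphs_modify[OF stable_flow smult(2)] dec[OF smult(2)] by (simp add: slot_space_closed)
      have "gen (?H (fscale c x)) - fscale c (gen (?H x)) \<in> null s"
        using graph_rels.smult[OF main(2)[OF smult(2) lens H], of c] by (auto intro: rel_null)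
      then have "K (?g (fscale c x)) - fscale c (K (?g x)) \<in> null s"
        by (rule null_transfer[OF main(1)[OF gc lens H] main(1)[OF smult(2) lens H]])
      then show ?thesis using e unfolding smult(1) by simp
    qed
  next
    case (lact gos vs x d l os "is" ws gis \<sigma>)
    let ?g = "\<lambda>os. DGraph gos (vs @ Vert x d l os is # ws) gis"
    have g2: "?g (permute_list \<sigma> os) \<in> flow_graphs s"
      using graphs_modify[OF stable_flow lact(2) mset_permute_list[OF lact(3)] HOL.refl] dec[OF lact(2)] by simp
    show ?thesis
    proof (cases "lens (?g os)")
      case False
      then show ?thesis unfolding lact(1) using zero_null by (auto simp: K_def lens_def lin_ext_diff)
    next
      case True
      have lens: "lens (?g z)" for z using True by (simp add: lens_def)
      obtain \<psi> A B go gi where H0: "substitutes G (Gs[i := ?g os]) (DGraph go (A @ Vert x d l (map \<psi> os) (map \<psi> is) # B) gi)"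
        and H1: "substitutes G (Gs[i := ?g (permute_list \<sigma> os)]) (DGraph go (A @ Vert x d l (map \<psi> (permute_list \<sigma> os)) (map \<psi> is) # B) gi)"
        using mod1[OF lact(2) True] mset_permute_list[OF lact(3)] by blast
      let ?H = "\<lambda>os. DGraph go (A @ Vert x d l os (map \<psi> is) # B) gi"
      have "gen (?H (map \<psi> os)) - gen (?H (permute_list \<sigma> (map \<psi> os))) \<in> null s"
        using graph_rels.lact[OF main(2)[OF lact(2) lens H0], of \<sigma>] lact(3) by (auto intro: rel_null)
      then have "gen (?H (map \<psi> os)) - gen (?H (map \<psi> (permute_list \<sigma> os))) \<in> null s"
        unfolding permute_list_map[OF lact(3)] .
      then have "K (?g os) - K (?g (permute_list \<sigma> os)) \<in> null s"
        by (rule null_transfer2[OF main(1)[OF lact(2) lens H0] main(1)[OF g2 lens H1]])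
      then show ?thesis unfolding lact(1) by (simp add: lin_ext_diff)
    qed
  next
    case (ract gos vs x d l os "is" ws gis \<tau>)
    let ?g = "\<lambda>is. DGraph gos (vs @ Vert x d l os is # ws) gis"
    have g2: "?g (permute_list \<tau> is) \<in> flow_graphs s"
      using graphs_modify[OF stable_flow ract(2) HOL.refl mset_permute_list[OF ract(3)]] dec[OF ract(2)] by simp
    show ?thesis
    proof (cases "lens (?g is)")
      case False
      then show ?thesis unfolding ract(1) using zero_null by (auto simp: K_def lens_def lin_ext_diff)
    next
      case True
      have lens: "lens (?g z)" for z using True by (simp add: lens_def)
      obtain \<psi> A B go gi where H0: "substitutes G (Gs[i := ?g is]) (DGraph go (A @ Vert x d l (map \<psi> os) (map \<psi> is) # B) gi)"
        and H1: "substitutes G (Gs[i := ?g (permute_list \<tau> is)]) (DGraph go (A @ Vert x d l (map \<psi> os) (map \<psi> (permute_list \<tau> is)) # B) gi)"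
        using mod1[OF ract(2) True] mset_permute_list[OF ract(3)] by blast
      let ?H = "\<lambda>is. DGraph go (A @ Vert x d l (map \<psi> os) is # B) gi"
      have "gen (?H (permute_list \<tau> (map \<psi> is))) - gen (?H (map \<psi> is)) \<in> null s"
        using graph_rels.ract[OF main(2)[OF ract(2) lens H0], of \<tau>] ract(3) by (auto intro: rel_null)
      then have "gen (?H (map \<psi> (permute_list \<tau> is))) - gen (?H (map \<psi> is)) \<in> null s"
        unfolding permute_list_map[OF ract(3)] .
      then have "K (?g (permute_list \<tau> is)) - K (?g is) \<in> null s"
        by (rule null_transfer2[OF main(1)[OF g2 lens H1] main(1)[OF ract(2) lens H0]])
      then show ?thesis unfolding ract(1) by (simp add: lin_ext_diff)
    qed
  next
    case (rename g f)
    have g2: "rename_wires f g \<in> flow_graphs s" using graphs_rename[OF stable_flow rename(2,3)] .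
    show ?thesis
    proof (cases "lens g")
      case False
      then show ?thesis unfolding rename(1) using zero_null by (auto simp: K_def lens_def lin_ext_diff)
    next
      case True
      have lens: "lens (rename_wires f g)" using True by (simp add: lens_def)
      let ?H = "substitution G (Gs[i := g])"
      note H = ex[OF rename(2) True]
      \<comment> \<open>The same result serves for both graphs, so uniqueness settles the
        case.\<close>
      have "substitutes G (Gs[i := rename_wires f g]) ?H"
        using substitutes_rename[OF H, of i f] rename(3) i by simp
      then have "K (rename_wires f g) - K g \<in> null s"
        by (rule null_transfer2[OF main(1)[OF g2 lens] main(1)[OF rename(2) True H]]) (simp add: zero_null)
      then show ?thesis unfolding rename(1) by (simp add: lin_ext_diff)
    qed
  next
    case (swap gos vs v w ws gis)
    let ?g = "\<lambda>v w. DGraph gos (vs @ v # w # ws) gis"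
    let ?c = "sgn_deg (vdeg v * vdeg w) :: 'k"
    have g2: "?g w v \<in> flow_graphs s" using graphs_swap[OF stable_flow swap(2)] .
    show ?thesis
    proof (cases "lens (?g v w)")
      case False
      then show ?thesis unfolding swap(1) using zero_null by (auto simp: K_def lens_def lin_ext_diff)
    next
      case True
      have lens: "lens (?g w v)" using True by (simp add: lens_def)
      obtain \<psi> A B go gi where H0: "substitutes G (Gs[i := ?g v w]) (DGraph go (A @ rename_vert \<psi> v # rename_vert \<psi> w # B) gi)"
        and H1: "substitutes G (Gs[i := ?g w v]) (DGraph go (A @ rename_vert \<psi> w # rename_vert \<psi> v # B) gi)"
      proof -
        have "mset (concat (map outs [w, v])) = mset (concat (map outs [v, w]))" "mset (concat (map ins [w, v])) = mset (concat (map ins [v, w]))"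
          by simp_all
        then show thesis using that mod[of gos vs "[v, w]" ws gis] swap(2) True by fastforce
      qed
      let ?H = "\<lambda>v w. DGraph go (A @ rename_vert \<psi> v # rename_vert \<psi> w # B) gi"
      have "gen (?H v w) - fscale ?c (gen (?H w v)) \<in> null s"
        using graph_rels.swap[OF main(2)[OF swap(2) True H0]] by (auto intro: rel_null)
      then have "K (?g v w) - fscale ?c (K (?g w v)) \<in> null s"
        by (rule null_transfer[OF main(1)[OF swap(2) True H0] main(1)[OF g2 lens H1]])
      then show ?thesis unfolding swap(1) by (simp add: lin_ext_diff)
    qed
  qed
  have "lin_ext K r \<in> null s"
    using r unfolding graph_null_def
    by (rule lin_ext_in_span) (use rels in \<open>simp add: graph_null_def\<close>)
  moreover have "lin_ext K r = lin_ext (\<lambda>g. gen (substitution G (Gs[i := g]))) r"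
    by (rule lin_ext_cong) (use keys in \<open>auto simp: K_def lens_def\<close>)
  ultimately show ?thesis by simp
qed

section \<open>Gluing along two edges\<close>

definition double_edge :: "'b \<Rightarrow> int \<Rightarrow> 'b \<Rightarrow> int \<Rightarrow> 'b dgraph" where
  "double_edge X d Y e = DGraph [] [Vert X d 1 [0, 1] [], Vert Y e 2 [] [0, 1]] []"

lemma double_edge_conn2: "wired (double_edge X d Y e)" "conn2 (double_edge X d Y e)"
proof -
  show w: "wired (double_edge X d Y e)" by (auto simp: double_edge_def wired_def)
  have "rigid (double_edge X d Y e)"
    unfolding rigid_def
  proof (intro allI impI ballI)
    fix \<kappa> :: "nat \<Rightarrow> bool" and x y
    assume k: "\<forall>v\<in>set (verts (double_edge X d Y e)). \<forall>x\<in>wires v. \<forall>y\<in>wires v. \<kappa> x = \<kappa> y"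
      and xy: "x \<in> wire_set (double_edge X d Y e)" "y \<in> wire_set (double_edge X d Y e)"
    have "\<kappa> 0 = \<kappa> 1"
      by (rule k[rule_format, of "Vert X d 1 [0, 1] []"]) (simp_all add: double_edge_def wires_def)
    moreover have "x = 0 \<or> x = 1" "y = 0 \<or> y = 1" using xy by (auto simp: wire_set_def wires_def double_edge_def)
    ultimately show "\<kappa> x = \<kappa> y" by metis
  qed
  moreover have "\<forall>v\<in>set (verts (double_edge X d Y e)). wires v \<noteq> {}"
    by (simp add: double_edge_def wires_def)
  ultimately have "connected_graph (double_edge X d Y e)"
    using connected_iff[OF w] by (simp add: connected_graph_def) (simp add: double_edge_def)
  then show "conn2 (double_edge X d Y e)" by (auto simp: conn2_def two_levelled_def double_edge_def)
qed

text \<open>The explicit form of \<open>substitutes\<close> for \<open>double_edge\<close>. As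
  \<open>g\<close> has no inputs and \<open>h\<close> no outputs, the result is closed.\<close>

definition glued :: "'a dgraph \<Rightarrow> 'a dgraph \<Rightarrow> (nat \<Rightarrow> nat) \<Rightarrow> (nat \<Rightarrow> nat) \<Rightarrow> 'a dgraph \<Rightarrow> bool" where
  "glued g h \<psi> \<chi> H \<longleftrightarrow> wired g \<and> wired h \<and> gins g = [] \<and> gouts h = [] \<and> length (gouts g) = 2 \<and>
     map \<psi> (gouts g) = map \<chi> (gins h) \<and> wired H \<and>
     H = DGraph [] (map (rename_vert \<psi>) (verts g) @ map (rename_vert \<chi>) (verts h)) []"

lemma substitutes_double_edge:
  assumes "wired g" "wired h" "length (gouts g) = 2" "length (gins h) = 2" "gins g = []" "gouts h = []"
  shows "substitutes (double_edge X d Y e) [g, h] H \<longleftrightarrow> (\<exists>\<psi> \<chi>. glued g h \<psi> \<chi> H)"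
proof
  assume "substitutes (double_edge X d Y e) [g, h] H"
  then obtain \<phi> \<psi> where w: "wired H"
    and eq: "\<forall>i<2. map \<phi> (outs (verts (double_edge X d Y e) ! i)) = map (\<psi> i) (gouts ([g, h] ! i)) \<and>
           map \<phi> (ins (verts (double_edge X d Y e) ! i)) = map (\<psi> i) (gins ([g, h] ! i))"
    and H: "H = DGraph [] (concat (map (\<lambda>i. map (rename_vert (\<psi> i)) (verts ([g, h] ! i))) [0..<2])) []"
    unfolding substitutes_def by (auto simp: double_edge_def numeral_2_eq_2)
  have "glued g h (\<psi> 0) (\<psi> 1) H"
    using assms w H spec[OF eq, of 0] spec[OF eq, of 1]
    by (simp add: glued_def double_edge_def numeral_2_eq_2)
  then show "\<exists>\<psi> \<chi>. glued g h \<psi> \<chi> H" by blast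
next
  assume "\<exists>\<psi> \<chi>. glued g h \<psi> \<chi> H"
  then obtain \<psi> \<chi> where gl: "glued g h \<psi> \<chi> H" by blast
  obtain a b where ab: "gouts g = [a, b]" using assms(3) by (auto simp: length_Suc_conv numeral_2_eq_2)
  obtain p q where pq: "gins h = [p, q]" using assms(4) by (auto simp: length_Suc_conv numeral_2_eq_2)
  show "substitutes (double_edge X d Y e) [g, h] H"
    unfolding substitutes_def
    by (intro conjI exI[of _ "\<lambda>w. if w = 0 then \<psi> a else \<psi> b"] exI[of _ "\<lambda>i. if i = 0 then \<psi> else \<chi>"])
      (use gl ab pq assms in \<open>auto simp: glued_def double_edge_def less_Suc_eq upt_rec\<close>)
qed

text \<open>Every wire of \<open>g\<close> leaves a vertex of \<open>g\<close>, and every wire of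
  \<open>h\<close> enters a vertex of \<open>h\<close>. Sources and targets in \<open>H\<close> are
  unique, so names can coincide only at the glued legs.\<close>

lemma glued_facts:
  assumes "glued g h \<psi> \<chi> H"
  shows "inj_on \<psi> (wire_set g)" "inj_on \<chi> (wire_set h)"
    "z \<in> wire_set g \<Longrightarrow> y \<in> wire_set h \<Longrightarrow> \<psi> z = \<chi> y \<Longrightarrow> \<exists>k<2. z = gouts g ! k \<and> y = gins h ! k"
proof -
  have g: "wired g" "gins g = []" and h: "wired h" "gouts h = []" and len: "length (gouts g) = 2"
    and leg: "map \<psi> (gouts g) = map \<chi> (gins h)" and w: "wired H"
    and H: "H = DGraph [] (map (rename_vert \<psi>) (verts g) @ map (rename_vert \<chi>) (verts h)) []"
    using assms by (auto simp: glued_def)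
  let ?Og = "concat (map outs (verts g))" let ?Oh = "concat (map outs (verts h))"
  let ?Ig = "concat (map ins (verts g))" let ?Ih = "concat (map ins (verts h))"
  have dO: "distinct (map \<psi> ?Og @ map \<chi> ?Oh)" and dI: "distinct (map \<psi> ?Ig @ map \<chi> ?Ih)"
    using wired_distinct(1,2)[OF w] unfolding H dgraph.sel map_append concat_append map_map concat_map_rename .
  have Wg: "wire_set g = set ?Og" using wired_source(3)[OF g(1)] g(2) by (auto simp: wire_set_def wires_def)
  have Wh: "wire_set h = set ?Ih" using wired_source(4)[OF h(1)] h(2) by (auto simp: wire_set_def wires_def)
  show i1: "inj_on \<psi> (wire_set g)" unfolding Wg using dO by (simp only: distinct_append distinct_map)
  show "inj_on \<chi> (wire_set h)" unfolding Wh using dI by (simp only: distinct_append distinct_map)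
  assume z: "z \<in> wire_set g" and y: "y \<in> wire_set h" and e: "\<psi> z = \<chi> y"
  have "y \<notin> set ?Oh"
  proof
    assume "y \<in> set ?Oh"
    then have "\<chi> y \<in> set (map \<chi> ?Oh)" "\<chi> y \<in> set (map \<psi> ?Og)" using z e unfolding Wg by force+
    then show False using dO by auto
  qed
  then have yg: "y \<in> set (gins h)" using y wired_source(3)[OF h(1)] unfolding Wh by auto
  have "z \<notin> set ?Ig"
  proof
    assume "z \<in> set ?Ig"
    then have "\<psi> z \<in> set (map \<psi> ?Ig)" "\<psi> z \<in> set (map \<chi> ?Ih)" using y e unfolding Wh by force+
    then show False using dI by auto
  qed
  then have zg: "z \<in> set (gouts g)" using z wired_source(4)[OF g(1)] unfolding Wg by auto
  have len2: "length (gins h) = 2" using leg len by (metis length_map)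
  obtain k where k: "k < 2" "y = gins h ! k" using yg len2 by (metis in_set_conv_nth)
  have "\<psi> (gouts g ! k) = \<chi> (gins h ! k)" using arg_cong[OF leg, of "\<lambda>xs. xs ! k"] k(1) len len2 by simp
  moreover have "gouts g ! k \<in> wire_set g"
    using wired_source(1)[OF g(1), of "gouts g ! k"] g(2) k(1) len by (auto simp: wire_set_def wires_def)
  ultimately have "z = gouts g ! k" using i1 z e k(2) by (metis inj_onD)
  then show "\<exists>k<2. z = gouts g ! k \<and> y = gins h ! k" using k by blast
qed

lemma inj_extension:
  fixes f :: "nat \<Rightarrow> nat"
  assumes "finite A" "inj_on f A"
  shows "\<exists>g. inj g \<and> (\<forall>x\<in>A. g x = f x)"
proof -
  obtain n where n: "\<forall>y\<in>f ` A. y < n" using assms(1) finite_nat_set_iff_bounded by (metis finite_imageI)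
  \<comment> \<open>Outside \<open>A\<close> the shift by \<open>n\<close> goes beyond all values on
    \<open>A\<close>.\<close>
  define g where "g x = (if x \<in> A then f x else x + n)" for x
  have "inj g"
  proof (rule injI)
    fix x y assume "g x = g y"
    then show "x = y" using n assms(2) by (fastforce simp: g_def inj_on_def split: if_splits)
  qed
  moreover have "\<forall>x\<in>A. g x = f x" by (simp add: g_def)
  ultimately show ?thesis by blast
qed

text \<open>Both results identify exactly the glued legs, so their names correspond bijectively; the
  correspondence is extended to an injection of all names, as the relation \<open>rename\<close>
  requires.\<close>

lemma glued_unique:
  assumes gl: "glued g h \<psi> \<chi> H" and gl': "glued g h \<psi>' \<chi>' H'"
  shows "\<exists>f. inj f \<and> H' = rename_wires f H"
proof -
  note f1 = glued_facts[OF gl] and f2 = glued_facts[OF gl']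
  have leg: "map \<psi> (gouts g) = map \<chi> (gins h)" "map \<psi>' (gouts g) = map \<chi>' (gins h)" "length (gouts g) = 2"
    using gl gl' by (auto simp: glued_def)
  have legk: "\<psi> (gouts g ! k) = \<chi> (gins h ! k)" "\<psi>' (gouts g ! k) = \<chi>' (gins h ! k)" if "k < 2" for k
    using arg_cong[OF leg(1), of "\<lambda>xs. xs ! k"] arg_cong[OF leg(2), of "\<lambda>xs. xs ! k"] that leg
    by (metis length_map nth_map)+
  define f where "f x = (if x \<in> \<psi> ` wire_set g then \<psi>' (inv_into (wire_set g) \<psi> x) else \<chi>' (inv_into (wire_set h) \<chi> x))" for x
  have fg: "f (\<psi> z) = \<psi>' z" if "z \<in> wire_set g" for z
    using that f1(1) by (simp add: f_def inv_into_f_f)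
  have fh: "f (\<chi> y) = \<chi>' y" if y: "y \<in> wire_set h" for y
  proof (cases "\<chi> y \<in> \<psi> ` wire_set g")
    case True
    then obtain z where z: "z \<in> wire_set g" "\<psi> z = \<chi> y" by auto
    then obtain k where "k < 2" "z = gouts g ! k" "y = gins h ! k" using f1(3)[OF z(1) y] by blast
    then show ?thesis using fg[OF z(1)] z(2) legk(2) by metis
  next
    case False
    then show ?thesis using f1(2) y by (simp add: f_def inv_into_f_f)
  qed
  let ?A = "\<psi> ` wire_set g \<union> \<chi> ` wire_set h"
  have cross: "\<psi> z = \<chi> y" if "z \<in> wire_set g" "y \<in> wire_set h" "\<psi>' z = \<chi>' y" for z y
    using f2(3)[OF that] legk(1) by blast
  have inj: "inj_on f ?A"
  proof (rule inj_onI)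
    fix x y assume "x \<in> ?A" "y \<in> ?A" and e: "f x = f y"
    then consider z z' where "x = \<psi> z" "y = \<psi> z'" "z \<in> wire_set g" "z' \<in> wire_set g"
      | z z' where "x = \<psi> z" "y = \<chi> z'" "z \<in> wire_set g" "z' \<in> wire_set h"
      | z z' where "x = \<chi> z'" "y = \<psi> z" "z \<in> wire_set g" "z' \<in> wire_set h"
      | z z' where "x = \<chi> z" "y = \<chi> z'" "z \<in> wire_set h" "z' \<in> wire_set h" by blast
    then show "x = y"
    proof cases
      case 1 then show ?thesis using e fg f2(1) by (metis inj_onD)
    next
      case 2 then show ?thesis using e fg fh cross by metis
    next
      case 3 then show ?thesis using e fg fh cross by metis
    next
      case 4 then show ?thesis using e fh f2(2) by (metis inj_onD)
    qed
  qed
  have fin: "finite ?A" by (simp add: wire_set_def wires_def)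
  obtain k where k: "inj k" "\<forall>x\<in>?A. k x = f x" using inj_extension[OF fin inj] by (elim exE conjE)
  have kg: "k (\<psi> z) = \<psi>' z" if "z \<in> wire_set g" for z using bspec[OF k(2), of "\<psi> z"] fg[OF that] that by simp
  have kh: "k (\<chi> z) = \<chi>' z" if "z \<in> wire_set h" for z using bspec[OF k(2), of "\<chi> z"] fh[OF that] that by simp
  have "rename_vert (k \<circ> \<psi>) v = rename_vert \<psi>' v" if "v \<in> set (verts g)" for v
    using kg that by (cases v) (force simp: wire_set_def wires_def)
  moreover have "rename_vert (k \<circ> \<chi>) v = rename_vert \<chi>' v" if "v \<in> set (verts h)" for v
    using kh that by (cases v) (force simp: wire_set_def wires_def)
  ultimately have "H' = rename_wires k H"
    using gl gl' by (simp add: glued_def rename_vert_comp)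
  then show ?thesis using k(1) by blast
qed

lemma composable_double_edge:
  assumes "g \<in> flow_graphs s" "h \<in> flow_graphs s" "length (gouts g) = 2" "length (gins h) = 2" "gins g = []" "gouts h = []"
  shows "composable (double_edge X d Y e) [g, h]"
proof
  show "wired (double_edge X d Y e)" "conn2 (double_edge X d Y e)" by (rule double_edge_conn2)+
qed (use assms in \<open>auto simp: double_edge_def graphs_model less_Suc_eq\<close>)

lemma determinate_double_edge: "determinate (double_edge X d Y e) [g, h]"
  unfolding determinate_def
proof (intro allI impI)
  fix H H' assume c: "composable (double_edge X d Y e) [g, h]"
    and s: "substitutes (double_edge X d Y e) [g, h] H" "substitutes (double_edge X d Y e) [g, h] H'"
  interpret composable "double_edge X d Y e" "[g, h]" by (rule c)
  have "wired g" "wired h" "length (gouts g) = 2" "length (gins h) = 2" "gins g = []" "gouts h = []"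
    using wired_Gs[of 0] wired_Gs[of 1] gouts_Gs[of 0] gouts_Gs[of 1] gins_Gs[of 0] gins_Gs[of 1]
    by (auto simp: double_edge_def)
  then show "\<exists>f. inj f \<and> H' = rename_wires f H"
    using s glued_unique by (metis substitutes_double_edge)
qed

abbreviation source_span :: "bool \<Rightarrow> int \<Rightarrow> ((nat \<Rightarrow>\<^sub>0 'k::field) dgraph \<Rightarrow>\<^sub>0 'k) set" where
  "source_span s d \<equiv> formal.span (gen ` {G \<in> flow_graphs s. has_type 2 0 d G})"

abbreviation target_span :: "bool \<Rightarrow> int \<Rightarrow> ((nat \<Rightarrow>\<^sub>0 'k::field) dgraph \<Rightarrow>\<^sub>0 'k) set" where
  "target_span s d \<equiv> formal.span (gen ` {G \<in> flow_graphs s. has_type 0 2 d G})"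

lemma compose_sum_pair:
  "compose_sum G [x, y] = lin_ext (\<lambda>g. lin_ext (\<lambda>h. gen (substitution G [g, h])) y) x"
proof -
  have "listset (map Poly_Mapping.keys [x, y]) = (\<lambda>(a, b). [a, b]) ` (Poly_Mapping.keys x \<times> Poly_Mapping.keys y)"
    by (auto simp: set_Cons_def)
  moreover have "inj_on (\<lambda>(a, b). [a, b]) (Poly_Mapping.keys x \<times> Poly_Mapping.keys y)" by (auto simp: inj_on_def)
  ultimately have "compose_sum G [x, y] = (\<Sum>(g, h)\<in>Poly_Mapping.keys x \<times> Poly_Mapping.keys y.
      fscale (Poly_Mapping.lookup x g * Poly_Mapping.lookup y h) (gen (substitution G [g, h])))"
    by (simp only: compose_sum_def sum.reindex) (simp add: case_prod_unfold)
  also have "\<dots> = (\<Sum>g\<in>Poly_Mapping.keys x. fscale (Poly_Mapping.lookup x g) (\<Sum>h\<in>Poly_Mapping.keys y.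
      fscale (Poly_Mapping.lookup y h) (gen (substitution G [g, h]))))"
    by (simp add: formal.scale_sum_right sum.cartesian_product)
  finally show ?thesis by (simp add: lin_ext_def)
qed

lemma lin_ext_swap: "lin_ext (\<lambda>g. lin_ext (\<lambda>h. F g h) y) x = lin_ext (\<lambda>h. lin_ext (\<lambda>g. F g h) x) y"
proof -
  have "(\<Sum>g\<in>Poly_Mapping.keys x. fscale (Poly_Mapping.lookup x g) (\<Sum>h\<in>Poly_Mapping.keys y. fscale (Poly_Mapping.lookup y h) (F g h)))
    = (\<Sum>g\<in>Poly_Mapping.keys x. \<Sum>h\<in>Poly_Mapping.keys y. fscale (Poly_Mapping.lookup x g * Poly_Mapping.lookup y h) (F g h))"
    by (simp add: formal.scale_sum_right)
  also have "\<dots> = (\<Sum>h\<in>Poly_Mapping.keys y. \<Sum>g\<in>Poly_Mapping.keys x. fscale (Poly_Mapping.lookup y h * Poly_Mapping.lookup x g) (F g h))"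
    by (subst sum.swap) (simp add: mult.commute)
  finally show ?thesis by (simp add: lin_ext_def formal.scale_sum_right)
qed

lemma lin_ext_fun_diff: "lin_ext (\<lambda>g. f g - f' g) x = lin_ext f x - lin_ext f' x"
  by (rule poly_mapping_eqI)
    (simp add: lookup_lin_ext lookup_minus lin_form_def algebra_simps sum_subtractf)

lemma lin_ext_null:
  assumes "\<And>g. g \<in> Poly_Mapping.keys x \<Longrightarrow> f g \<in> null s"
  shows "lin_ext f x \<in> null s"
  unfolding lin_ext_def graph_null_def
  by (intro formal.span_sum formal.span_scale) (use assms in \<open>auto simp: graph_null_def\<close>)

text \<open>One factor is exchanged at a time, through the composite of \<open>x'\<close> and
  \<open>y\<close>.\<close>

lemma compose_sum_cong:
  assumes x: "x \<in> source_span s d" "x' \<in> source_span s d" "x - x' \<in> null s"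
    and y: "y \<in> target_span s e" "y' \<in> target_span s e" "y - y' \<in> null s"
  shows "compose_sum (double_edge X a Y b) [x, y] - compose_sum (double_edge X a Y b) [x', y'] \<in> null s"
proof -
  let ?G = "double_edge X a Y b"
  let ?F = "\<lambda>g h. gen (substitution ?G [g, h])"
  have kx: "g \<in> flow_graphs s \<and> has_type 2 0 d g" if "g \<in> Poly_Mapping.keys (x - x') \<or> g \<in> Poly_Mapping.keys x'" for g
    using keys_span_gen[OF formal.span_diff[OF x(1,2)]] keys_span_gen[OF x(2)] that by blast
  have ky: "h \<in> flow_graphs s \<and> has_type 0 2 e h" if "h \<in> Poly_Mapping.keys (y - y') \<or> h \<in> Poly_Mapping.keys y" for h
    using keys_span_gen[OF formal.span_diff[OF y(1,2)]] keys_span_gen[OF y(1)] that by blast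
  have 1: "lin_ext (\<lambda>g. ?F g h) (x - x') \<in> null s" if h: "h \<in> Poly_Mapping.keys y" for h
  proof (cases "x - x' = 0")
    case False
    \<comment> \<open>\<open>g0\<close> merely fixes the arity against which
      \<open>slot_null\<close> compares.\<close>
    then obtain g0 where g0: "g0 \<in> Poly_Mapping.keys (x - x')" by (metis all_not_in_conv keys_eq_empty)
    have "lin_ext (\<lambda>g. gen (substitution ?G ([g0, h][0 := g]))) (x - x') \<in> null s"
    proof (rule slot_null[OF _ _ _ _ x(3)])
      show "determinate ?G ([g0, h][0 := g])" for g by (simp add: determinate_double_edge)
      show "composable ?G [g0, h]"
        by (rule composable_double_edge[of _ s]) (use kx g0 ky h in auto)
      show "[g0, h] ! j \<in> flow_graphs s" if "j < length [g0, h]" for j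
        using that kx g0 ky h by (auto simp: less_Suc_eq)
      show "g \<in> flow_graphs s \<and> length (gouts g) = length (gouts ([g0, h] ! 0)) \<and> length (gins g) = length (gins ([g0, h] ! 0))"
        if "g \<in> Poly_Mapping.keys (x - x')" for g
        using kx[of g] kx[of g0] g0 that by auto
    qed simp
    then show ?thesis by simp
  qed (simp add: zero_null)
  have 2: "lin_ext (\<lambda>h. ?F g h) (y - y') \<in> null s" if g: "g \<in> Poly_Mapping.keys x'" for g
  proof (cases "y - y' = 0")
    case False
    then obtain h0 where h0: "h0 \<in> Poly_Mapping.keys (y - y')" by (metis all_not_in_conv keys_eq_empty)
    have "lin_ext (\<lambda>h. gen (substitution ?G ([g, h0][1 := h]))) (y - y') \<in> null s"
    proof (rule slot_null[OF _ _ _ _ y(3)])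
      show "determinate ?G ([g, h0][1 := h])" for h by (simp add: determinate_double_edge)
      show "composable ?G [g, h0]"
        by (rule composable_double_edge[of _ s]) (use kx g ky h0 in auto)
      show "[g, h0] ! j \<in> flow_graphs s" if "j < length [g, h0]" for j
        using that kx g ky h0 by (auto simp: less_Suc_eq)
      show "h \<in> flow_graphs s \<and> length (gouts h) = length (gouts ([g, h0] ! 1)) \<and> length (gins h) = length (gins ([g, h0] ! 1))"
        if "h \<in> Poly_Mapping.keys (y - y')" for h
        using ky[of h] ky[of h0] h0 that by auto
    qed simp
    then show ?thesis by simp
  qed (simp add: zero_null)
  have "compose_sum ?G [x, y] - compose_sum ?G [x', y'] =
    lin_ext (\<lambda>h. lin_ext (\<lambda>g. ?F g h) (x - x')) y + lin_ext (\<lambda>g. lin_ext (\<lambda>h. ?F g h) (y - y')) x'"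
  proof -
    have "lin_ext (\<lambda>g. lin_ext (\<lambda>h. ?F g h) (y - y')) x' = compose_sum ?G [x', y] - compose_sum ?G [x', y']"
      by (simp only: compose_sum_pair lin_ext_diff lin_ext_fun_diff)
    moreover have "lin_ext (\<lambda>h. lin_ext (\<lambda>g. ?F g h) (x - x')) y = lin_ext (\<lambda>g. lin_ext (\<lambda>h. ?F g h) y) (x - x')"
      by (rule lin_ext_swap)
    moreover have "\<dots> = compose_sum ?G [x, y] - compose_sum ?G [x', y]"
      by (simp only: compose_sum_pair lin_ext_diff)
    ultimately show ?thesis by simp
  qed
  then show ?thesis using null_closed(1)[OF lin_ext_null[OF 1] lin_ext_null[OF 2]] by simp
qed

section \<open>The cycle vanishing in the enveloping properad of the larger dioperad\<close>

lemma singleton_plus: "{x} + {y} = {x + y}"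
  by (auto simp: set_plus_def)

lemma class_add: "(graph_null B S + {x}) + (graph_null B S + {y}) = graph_null B S + {x + y}"
proof -
  have "(graph_null B S + {x}) + (graph_null B S + {y}) = (graph_null B S + graph_null B S) + ({x} + {y})"
    by (simp only: ac_simps)
  then show ?thesis by (simp only: null_add singleton_plus)
qed

lemma class_scale: "graph_null B S + fscale c ` (graph_null B S + {x}) = graph_null B S + {fscale c x}"
proof (intro equalityI subsetI)
  fix z assume "z \<in> graph_null B S + fscale c ` (graph_null B S + {x})"
  then obtain m n where "m \<in> graph_null B S" "n \<in> graph_null B S" "z = m + fscale c (n + x)" by (auto simp: set_plus_def)
  moreover from this have "m + fscale c n \<in> graph_null B S" by (intro null_closed(1) null_scale)
  ultimately show "z \<in> graph_null B S + {fscale c x}" by (force simp: set_plus_def fscale_algebra(3) add.assoc)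
next
  fix z assume "z \<in> graph_null B S + {fscale c x}"
  then obtain m where "m \<in> graph_null B S" "z = m + fscale c (0 + x)" by (auto simp: set_plus_def)
  then show "z \<in> graph_null B S + fscale c ` (graph_null B S + {x})"
    using zero_null[of B S] by (force simp: set_plus_def)
qed

lemma class_eq:
  assumes "x - y \<in> graph_null B S" shows "graph_null B S + {x} = graph_null B S + {y}"
proof -
  have "graph_null B S + {x} = (graph_null B S + {x - y}) + (graph_null B S + {y})" by (simp add: class_add)
  also have "graph_null B S + {x - y} = graph_null B S"
  proof (intro equalityI subsetI)
    fix z assume "z \<in> graph_null B S"
    then have "z - (x - y) \<in> graph_null B S" using assms by (rule null_closed(2))
    then show "z \<in> graph_null B S + {x - y}" by (force simp: set_plus_def)
  qed (use assms in \<open>auto simp: set_plus_def intro: null_closed(1)\<close>)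
  finally show ?thesis by (simp add: null_absorb)
qed

lemma class_mem: "r \<in> graph_null B S + {x} \<Longrightarrow> r - x \<in> graph_null B S"
  by (auto simp: set_plus_def)

lemma ideal_add:
  assumes "graph_null (\<lambda>_. P) flow + {x} \<in> enveloping_ideal P" "graph_null (\<lambda>_. P) flow + {y} \<in> enveloping_ideal P"
  shows "graph_null (\<lambda>_. P) flow + {x + y} \<in> enveloping_ideal P"
  using properadic_ideal.add[OF assms[unfolded enveloping_ideal_def]] by (simp add: enveloping_ideal_def class_add)

lemma ideal_scale:
  assumes "graph_null (\<lambda>_. P) flow + {x} \<in> enveloping_ideal P"
  shows "graph_null (\<lambda>_. P) flow + {fscale c x} \<in> enveloping_ideal P"
  using properadic_ideal.smult[OF assms[unfolded enveloping_ideal_def], of c]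
  by (simp add: enveloping_ideal_def class_scale)

lemma ideal_minus:
  "graph_null (\<lambda>_. P) flow + {x} \<in> enveloping_ideal P \<Longrightarrow> graph_null (\<lambda>_. P) flow + {- x} \<in> enveloping_ideal P"
  using ideal_scale[of P x "- 1"] by (simp add: fscale_minus_one)

text \<open>The representatives chosen by \<open>free_compose\<close> may differ from
  \<open>x\<close> and \<open>y\<close>; \<open>compose_sum_cong\<close> absorbs the
  difference.\<close>

lemma ideal_double_edge:
  assumes x: "x \<in> source_span s d" and y: "y \<in> target_span s e"
    and J: "null s + {x} \<in> enveloping_ideal (model s) \<or> null s + {y} \<in> enveloping_ideal (model s)"
  shows "null s + {compose_sum (double_edge (null s + {x}) d (null s + {y}) e) [x, y]} \<in> enveloping_ideal (model s)"
proof -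
  let ?G = "double_edge (null s + {x}) d (null s + {y}) e"
  have px: "null s + {x} \<in> part (free_properad (model s)) 2 0 d" using x by auto
  have py: "null s + {y} \<in> part (free_properad (model s)) 0 2 e" using y by auto
  have G: "?G \<in> graphs (\<lambda>_. free_properad (model s)) conn2"
    using double_edge_conn2[of "null s + {x}" d "null s + {y}" e] px py
    by (simp add: graphs_def del: free_properad_simps) (simp add: double_edge_def numeral_2_eq_2)
  let ?v = "Vert (null s + {x}) d 1 [0, 1] []" let ?w = "Vert (null s + {y}) e 2 [] [0, 1]"
  have vs: "verts ?G = [?v, ?w]" by (simp add: double_edge_def)
  let ?r = "rep (graph_span (\<lambda>_. model s) flow)"
  have pv: "elt ?v \<in> part (free_properad (model s)) (length (outs ?v)) (length (ins ?v)) (vdeg ?v)"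
    and pw: "elt ?w \<in> part (free_properad (model s)) (length (outs ?w)) (length (ins ?w)) (vdeg ?w)"
    using px py by (simp_all add: numeral_2_eq_2 del: free_properad_simps)
  have rv: "?r ?v \<in> null s + {x}" "?r ?v \<in> source_span s d" and rw: "?r ?w \<in> null s + {y}" "?r ?w \<in> target_span s e"
    using rep_free[OF pv] rep_free[OF pw] by (simp_all add: numeral_2_eq_2)
  have "compose_sum ?G [?r ?v, ?r ?w] - compose_sum ?G [x, y] \<in> null s"
    by (rule compose_sum_cong[where d = d and e = e])
      (use rv rw x y class_mem in auto)
  then have "free_compose (model s) ?G = null s + {compose_sum ?G [x, y]}"
    unfolding free_compose_sum by (intro class_eq) (simp add: vs)
  moreover have "free_compose (model s) ?G \<in> enveloping_ideal (model s)"
  proof -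
    have "\<exists>v\<in>set (verts ?G). elt v \<in> enveloping_ideal (model s)" using J by (auto simp: vs)
    then show ?thesis
      using properadic_ideal.compose[OF G] unfolding enveloping_ideal_def by auto
  qed
  ultimately show ?thesis by simp
qed

lemma compose_sum_glued:
  assumes "g \<in> flow_graphs s" "h \<in> flow_graphs s" "length (gouts g) = 2" "length (gins h) = 2" "glued g h \<psi> \<chi> H"
  shows "compose_sum (double_edge X d Y e) [gen g, gen h] - gen H \<in> null s"
proof -
  have io: "gins g = []" "gouts h = []" and w: "wired g" "wired h" using assms(5) by (auto simp: glued_def)
  have sub: "substitutes (double_edge X d Y e) [g, h] H"
    by (rule substitutes_double_edge[OF w assms(3,4) io, THEN iffD2, OF exI, OF exI, OF assms(5)])
  have "gen (substitution (double_edge X d Y e) [g, h]) - gen H \<in> null s"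
    by (rule determinate_null(1)[OF determinate_double_edge composable_double_edge[OF assms(1-4) io] _ sub])
      (use assms(1,2) in \<open>auto simp: less_Suc_eq\<close>)
  then show ?thesis by (simp add: compose_sum_pair)
qed

text \<open>This is the relation \<open>smult\<close> with scalar 0.\<close>

lemma zero_decoration_null:
  assumes "DGraph gos (vs @ Vert 0 d l os is # ws) gis \<in> flow_graphs s"
  shows "gen (DGraph gos (vs @ Vert 0 d l os is # ws) gis) \<in> null s"
  using rel_null[OF graph_rels.smult[OF assms, of 0]] by simp

text \<open>The same vector is the unit in degree 0, \<open>m\<close> in degree -2 and
  \<open>n\<close> in degree -4, so \<open>unit_elt\<close> decorates all three kinds of vertices
  below.\<close>

definition unit_elt :: "nat \<Rightarrow>\<^sub>0 'k::field" where "unit_elt = gen 0"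
definition q_elt :: "nat \<Rightarrow>\<^sub>0 'k::field" where "q_elt = gen 1"
definition b_elt :: "nat \<Rightarrow>\<^sub>0 'k::field" where "b_elt = gen 2"

lemma elts_in:
  "unit_elt \<in> slot_space s 1 1 0" "unit_elt \<in> slot_space s 2 0 (-2)" "unit_elt \<in> slot_space s 0 2 (-4)"
  "b_elt \<in> slot_space s 1 1 (-2)" "q_elt \<in> slot_space True 2 0 0"
  unfolding unit_elt_def b_elt_def q_elt_def by (simp_all add: slot_space_def slot_def del: single_one)

lemma coef_elts: "coef unit_elt = 1" "coef b_elt = 1" "coef q_elt = 1"
  unfolding unit_elt_def b_elt_def q_elt_def by (simp_all add: coef_def lookup_single del: single_one)

abbreviation "pair_graph \<equiv> DGraph [] [Vert unit_elt (-2) 0 [0, 1] [], Vert unit_elt (-4) 0 [] [0, 1]] []"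

text \<open>\<open>b\<close> on the first output of \<open>q\<close>, with composite
  \<open>m\<close>. A unit on the second output completes level 2; it comes last in the list, as
  \<open>enveloping_relations\<close> asks.\<close>

definition left_tree :: "(nat \<Rightarrow>\<^sub>0 'k::field) dgraph" where
  "left_tree = DGraph [0, 1] [Vert q_elt 0 1 [2, 3] [], Vert b_elt (-2) 2 [0] [2], Vert unit_elt 0 2 [1] [3]] []"

text \<open>\<open>b\<close> on the first input of \<open>n\<close>, completed by a unit on level 1.
  In arity (0,2) there is no slot of degree -6, so the composite is zero.\<close>

definition right_tree :: "(nat \<Rightarrow>\<^sub>0 'k::field) dgraph" where
  "right_tree = DGraph [] [Vert b_elt (-2) 1 [0] [2], Vert unit_elt (-4) 2 [] [0, 1], Vert unit_elt 0 1 [1] [3]] [2, 3]"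

text \<open>Filtering the list lets the two unions be computed by rewriting for a concrete
  graph.\<close>

lemma two_levelled_filter:
  "two_levelled G \<longleftrightarrow> (\<forall>v\<in>set (verts G). level v = 1 \<or> level v = 2) \<and>
     set (gins G) = (\<Union>v\<in>set (filter (\<lambda>v. level v = 1) (verts G)). set (ins v)) \<and>
     set (gouts G) = (\<Union>v\<in>set (filter (\<lambda>v. level v = 2) (verts G)). set (outs v))"
  by (simp add: two_levelled_def)

text \<open>Comparing each wire with one hub replaces the comparison of all pairs.\<close>

lemma hub_rigid:
  assumes "\<And>\<kappa> :: nat \<Rightarrow> bool. (\<And>v x y. v \<in> set (verts G) \<Longrightarrow> x \<in> wires v \<Longrightarrow> y \<in> wires v \<Longrightarrow> \<kappa> x = \<kappa> y) \<Longrightarrow>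
    (\<forall>x\<in>wire_set G. \<kappa> x = \<kappa> h)"
  shows "rigid G"
  unfolding rigid_def
proof (intro allI impI ballI)
  fix \<kappa> :: "nat \<Rightarrow> bool" and x y
  assume k: "\<forall>v\<in>set (verts G). \<forall>x\<in>wires v. \<forall>y\<in>wires v. \<kappa> x = \<kappa> y" and xy: "x \<in> wire_set G" "y \<in> wire_set G"
  have "\<forall>x\<in>wire_set G. \<kappa> x = \<kappa> h" by (rule assms) (use k in blast)
  then show "\<kappa> x = \<kappa> y" using xy by metis
qed

lemma left_tree_in: "left_tree \<in> graphs (\<lambda>_. model True) tree2"
proof -
  let ?G = "left_tree :: (nat \<Rightarrow>\<^sub>0 'a) dgraph"
  have w: "wired ?G" by (auto simp: wired_def left_tree_def)
  have W: "wire_set ?G = {0, 1, 2, 3}" by (auto simp: wire_set_def wires_def left_tree_def)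
  have "rigid ?G"
  proof (rule hub_rigid[where h = 2])
    fix \<kappa> :: "nat \<Rightarrow> bool"
    assume k: "\<And>v x y. v \<in> set (verts ?G) \<Longrightarrow> x \<in> wires v \<Longrightarrow> y \<in> wires v \<Longrightarrow> \<kappa> x = \<kappa> y"
    have "\<kappa> 3 = \<kappa> 2" by (rule k[of "Vert q_elt 0 1 [2, 3] []"]) (simp_all add: left_tree_def wires_def)
    moreover have "\<kappa> 0 = \<kappa> 2" by (rule k[of "Vert b_elt (-2) 2 [0] [2]"]) (simp_all add: left_tree_def wires_def)
    moreover have "\<kappa> 1 = \<kappa> 3" by (rule k[of "Vert unit_elt 0 2 [1] [3]"]) (simp_all add: left_tree_def wires_def)
    ultimately show "\<forall>x\<in>wire_set ?G. \<kappa> x = \<kappa> 2" unfolding W by (metis empty_iff insert_iff)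
  qed
  moreover have "\<forall>v\<in>set (verts ?G). wires v \<noteq> {}" by (simp add: left_tree_def wires_def)
  ultimately have "connected_graph ?G"
    using connected_iff[OF w] by (simp add: connected_graph_def) (simp add: left_tree_def)
  moreover have "inner_wires ?G = {2, 3}" by (auto simp: inner_wires_def left_tree_def)
  then have "genus ?G = 0" by (simp add: genus_def) (simp add: left_tree_def)
  moreover have "two_levelled ?G" unfolding two_levelled_filter left_tree_def by (simp add: insert_commute)
  moreover have "\<forall>v\<in>set (verts ?G). decorated True v"
    using elts_in(1-4)[of True] elts_in(5) by (simp add: decorated_def left_tree_def numeral_2_eq_2)
  ultimately show ?thesis using w by (simp add: graphs_model tree2_def)
qed

lemma right_tree_in: "right_tree \<in> graphs (\<lambda>_. model True) tree2"
proof -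
  let ?G = "right_tree :: (nat \<Rightarrow>\<^sub>0 'a) dgraph"
  have w: "wired ?G" by (auto simp: wired_def right_tree_def)
  have W: "wire_set ?G = {0, 1, 2, 3}" by (auto simp: wire_set_def wires_def right_tree_def)
  have "rigid ?G"
  proof (rule hub_rigid[where h = 0])
    fix \<kappa> :: "nat \<Rightarrow> bool"
    assume k: "\<And>v x y. v \<in> set (verts ?G) \<Longrightarrow> x \<in> wires v \<Longrightarrow> y \<in> wires v \<Longrightarrow> \<kappa> x = \<kappa> y"
    have "\<kappa> 1 = \<kappa> 0" by (rule k[of "Vert unit_elt (-4) 2 [] [0, 1]"]) (simp_all add: right_tree_def wires_def)
    moreover have "\<kappa> 2 = \<kappa> 0" by (rule k[of "Vert b_elt (-2) 1 [0] [2]"]) (simp_all add: right_tree_def wires_def)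
    moreover have "\<kappa> 3 = \<kappa> 1" by (rule k[of "Vert unit_elt 0 1 [1] [3]"]) (simp_all add: right_tree_def wires_def)
    ultimately show "\<forall>x\<in>wire_set ?G. \<kappa> x = \<kappa> 0" unfolding W by (metis empty_iff insert_iff)
  qed
  moreover have "\<forall>v\<in>set (verts ?G). wires v \<noteq> {}" by (simp add: right_tree_def wires_def)
  ultimately have "connected_graph ?G"
    using connected_iff[OF w] by (simp add: connected_graph_def) (simp add: right_tree_def)
  moreover have "inner_wires ?G = {0, 1}" by (auto simp: inner_wires_def right_tree_def)
  then have "genus ?G = 0" by (simp add: genus_def) (simp add: right_tree_def)
  moreover have "two_levelled ?G" unfolding two_levelled_filter right_tree_def by (simp add: insert_commute)
  moreover have "\<forall>v\<in>set (verts ?G). decorated True v"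
    using elts_in(1-4)[of True] elts_in(5) by (simp add: decorated_def right_tree_def numeral_2_eq_2)
  ultimately show ?thesis using w by (simp add: graphs_model tree2_def)
qed

lemma relation_in_ideal:
  assumes "G \<in> graphs (\<lambda>_. P) tree2" "verts G = v # w # vs" "\<forall>u\<in>set vs. elt u = ident P \<and> vdeg u = 0"
  shows "graph_null (\<lambda>_. P) flow + {gen (corolla (compose P G) (gdeg G) (length (gouts G)) (length (gins G)))
           - gen (forget_levels G)} \<in> enveloping_ideal P"
  unfolding enveloping_ideal_def
  by (rule properadic_ideal.base) (use assms in \<open>auto simp: enveloping_relations_def graph_class_plus\<close>)

lemma corolla_simps:
  "corolla x d 2 0 = DGraph [0, 1] [Vert x d 0 [0, 1] []] []"
  "corolla x d 0 2 = DGraph [] [Vert x d 0 [] [0, 1]] [0, 1]"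
  by (simp_all add: corolla_def upt_rec)

lemma span_single: "G \<in> flow_graphs s \<Longrightarrow> has_type m n d G \<Longrightarrow> gen G \<in> formal.span (gen ` {G \<in> flow_graphs s. has_type m n d G})"
  by (rule formal.span_base) auto

text \<open>One graph arises in two ways, up to the order of its vertices: gluing \<open>b q\<close>
  to \<open>n\<close> gives \<open>U\<close>, and gluing \<open>q\<close> to \<open>n b\<close>
  gives \<open>U'\<close>. The first is congruent to \<open>pair_graph\<close>, the second to a
  graph with a zero decoration.\<close>

lemma pair_graph_in_ideal: "null True + {gen pair_graph :: _ \<Rightarrow>\<^sub>0 'k::field} \<in> enveloping_ideal (model True)"
proof -
  let ?J = "enveloping_ideal (model True :: ('k, nat \<Rightarrow>\<^sub>0 'k) properad)"
  let ?u = "unit_elt :: nat \<Rightarrow>\<^sub>0 'k" and ?q = "q_elt :: nat \<Rightarrow>\<^sub>0 'k" and ?b = "b_elt :: nat \<Rightarrow>\<^sub>0 'k"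
  let ?N = "null True :: ((nat \<Rightarrow>\<^sub>0 'k) dgraph \<Rightarrow>\<^sub>0 'k) set"
  define lt where "lt = forget_levels (left_tree :: (nat \<Rightarrow>\<^sub>0 'k) dgraph)"
  define rt where "rt = forget_levels (right_tree :: (nat \<Rightarrow>\<^sub>0 'k) dgraph)"
  have lt: "lt = DGraph [0, 1] [Vert ?q 0 0 [2, 3] [], Vert ?b (-2) 0 [0] [2], Vert ?u 0 0 [1] [3]] []"
    by (simp add: lt_def forget_levels_def left_tree_def)
  have rt: "rt = DGraph [] [Vert ?b (-2) 0 [0] [2], Vert ?u (-4) 0 [] [0, 1], Vert ?u 0 0 [1] [3]] [2, 3]"
    by (simp add: rt_def forget_levels_def right_tree_def)
  have ltf: "lt \<in> flow_graphs True" and rtf: "rt \<in> flow_graphs True"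
    unfolding lt_def rt_def by (rule forget_levels_flow, rule left_tree_in right_tree_in)+
  have ltt: "has_type 2 0 (-2) lt" and rtt: "has_type 0 2 (-6) rt" by (simp_all add: lt rt gdeg_def)
  let ?m = "corolla ?u (-2) 2 0" and ?n = "corolla ?u (-4) 0 2" and ?qc = "corolla ?q 0 2 0"
    and ?z = "corolla (0 :: nat \<Rightarrow>\<^sub>0 'k) (-6) 0 2"
  have cf: "?m \<in> flow_graphs True" "?n \<in> flow_graphs True" "?qc \<in> flow_graphs True" "?z \<in> flow_graphs True"
    by (rule corolla_flow; simp add: elts_in slot_space_closed)+
  have ct: "has_type 2 0 (-2) ?m" "has_type 0 2 (-4) ?n" "has_type 2 0 0 ?qc" "has_type 0 2 (-6) ?z"
    by (simp_all add: corolla_simps gdeg_def)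
  have wf: "wired g" if "g \<in> flow_graphs True" for g :: "(nat \<Rightarrow>\<^sub>0 'k) dgraph" using that by (simp add: graphs_model)
  have L: "?N + {gen ?m - gen lt} \<in> ?J"
  proof -
    have "model_compose True left_tree = ?u"
      by (simp add: model_compose_def left_tree_def gdeg_def coef_elts slot_elt_def slot_def)
        (simp add: unit_elt_def)
    moreover have "gdeg (left_tree :: (nat \<Rightarrow>\<^sub>0 'k) dgraph) = -2" "length (gouts (left_tree :: (nat \<Rightarrow>\<^sub>0 'k) dgraph)) = 2"
      "length (gins (left_tree :: (nat \<Rightarrow>\<^sub>0 'k) dgraph)) = 0" by (simp_all add: left_tree_def gdeg_def)
    moreover have "verts (left_tree :: (nat \<Rightarrow>\<^sub>0 'k) dgraph) = Vert q_elt 0 1 [2, 3] [] # Vert b_elt (-2) 2 [0] [2] # [Vert unit_elt 0 2 [1] [3]]"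
      by (simp add: left_tree_def)
    note relation_in_ideal[OF left_tree_in this]
    moreover have "\<forall>u\<in>set [Vert unit_elt 0 2 [1] [3]]. elt u = ident (model True :: ('k, nat \<Rightarrow>\<^sub>0 'k) properad) \<and> vdeg u = 0"
      by (simp add: unit_elt_def del: single_one)
    ultimately show ?thesis by (simp only: model_simps lt_def)
  qed
  have R: "?N + {gen ?z - gen rt} \<in> ?J"
  proof -
    have "model_compose True right_tree = (0 :: nat \<Rightarrow>\<^sub>0 'k)"
      by (simp add: model_compose_def right_tree_def gdeg_def slot_elt_def slot_def)
    moreover have "gdeg (right_tree :: (nat \<Rightarrow>\<^sub>0 'k) dgraph) = -6" "length (gouts (right_tree :: (nat \<Rightarrow>\<^sub>0 'k) dgraph)) = 0"
      "length (gins (right_tree :: (nat \<Rightarrow>\<^sub>0 'k) dgraph)) = 2" by (simp_all add: right_tree_def gdeg_def)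
    moreover have "verts (right_tree :: (nat \<Rightarrow>\<^sub>0 'k) dgraph) = Vert b_elt (-2) 1 [0] [2] # Vert unit_elt (-4) 2 [] [0, 1] # [Vert unit_elt 0 1 [1] [3]]"
      by (simp add: right_tree_def)
    note relation_in_ideal[OF right_tree_in this]
    moreover have "\<forall>u\<in>set [Vert unit_elt 0 1 [1] [3]]. elt u = ident (model True :: ('k, nat \<Rightarrow>\<^sub>0 'k) properad) \<and> vdeg u = 0"
      by (simp add: unit_elt_def del: single_one)
    ultimately show ?thesis by (simp only: model_simps rt_def)
  qed
  define T where "T = (pair_graph :: (nat \<Rightarrow>\<^sub>0 'k) dgraph)"
  define U where "U = DGraph [] [Vert ?q 0 0 [2, 3] [], Vert ?b (-2) 0 [0] [2], Vert ?u 0 0 [1] [3], Vert ?u (-4) 0 [] [0, 1]] []"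
  define U' where "U' = DGraph [] [Vert ?q 0 0 [2, 3] [], Vert ?b (-2) 0 [0] [2], Vert ?u (-4) 0 [] [0, 1], Vert ?u 0 0 [1] [3]] []"
  define T0 where "T0 = DGraph [] [Vert ?q 0 0 [0, 1] [], Vert (0 :: nat \<Rightarrow>\<^sub>0 'k) (-6) 0 [] [0, 1]] []"
  have w: "wired T" "wired U" "wired U'" "wired T0" by (auto simp: wired_def T_def U_def U'_def T0_def)
  \<comment> \<open>In the last gluing the wires 0 and 1 of the corolla of \<open>q\<close> move to
    2 and 3, the inputs of \<open>rt\<close>.\<close>
  have gl: "glued ?m ?n id id T" "glued lt ?n id id U" "glued ?qc ?z id id T0"
    "glued ?qc rt (\<lambda>x. x + 2) id U'"
    unfolding glued_def using w wf[OF cf(1)] wf[OF cf(2)] wf[OF cf(3)] wf[OF cf(4)] wf[OF ltf] wf[OF rtf]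
    by (simp_all add: corolla_simps lt rt T_def U_def U'_def T0_def)
  have UF: "U \<in> flow_graphs True" and TF: "T0 \<in> flow_graphs True"
  proof -
    have "H \<in> flow_graphs True" if "g \<in> flow_graphs True" "h \<in> flow_graphs True" "length (gouts g) = 2" "length (gins h) = 2"
      "glued g h \<psi> \<chi> H" for g h H :: "(nat \<Rightarrow>\<^sub>0 'k) dgraph" and \<psi> \<chi>
    proof -
      have io: "gins g = []" "gouts h = []" using that(5) by (auto simp: glued_def)
      \<comment> \<open>\<open>substitutes\<close> does not see the decorations of the outer graph,
        so dummies serve.\<close>
      have sub: "substitutes (double_edge () 0 () 0) [g, h] H"
        by (rule substitutes_double_edge[OF wf[OF that(1)] wf[OF that(2)] that(3,4) io, THEN iffD2, OF exI, OF exI, OF that(5)])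
      show ?thesis
        by (rule determinate_null(2)[OF determinate_double_edge composable_double_edge[OF that(1-4) io] _ sub])
          (use that(1,2) in \<open>auto simp: less_Suc_eq\<close>)
    qed
    then show "U \<in> flow_graphs True" "T0 \<in> flow_graphs True"
      using gl(2,3) ltf cf ltt ct by blast+
  qed
  have A: "?N + {gen T - gen U} \<in> ?J"
  proof -
    let ?G = "double_edge (?N + {gen ?m - gen lt}) (-2) (?N + {gen ?n}) (-4)"
    have m: "?N + {compose_sum ?G [gen ?m - gen lt, gen ?n]} \<in> ?J"
      by (rule ideal_double_edge) (use L span_single[OF cf(1) ct(1)] span_single[OF ltf ltt] span_single[OF cf(2) ct(2)] in
        \<open>auto intro: formal.span_diff\<close>)
    have e: "compose_sum ?G [gen ?m - gen lt, gen ?n] - (gen T - gen U) \<in> ?N"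
    proof -
      have "compose_sum ?G [gen ?m, gen ?n] - gen T \<in> ?N" "compose_sum ?G [gen lt, gen ?n] - gen U \<in> ?N"
        using compose_sum_glued[OF cf(1,2) _ _ gl(1)] compose_sum_glued[OF ltf cf(2) _ _ gl(2)] ct ltt by auto
      from null_closed(2)[OF this] show ?thesis by (simp add: compose_sum_pair lin_ext_diff algebra_simps)
    qed
    show ?thesis by (rule subst[OF class_eq[OF e], of "\<lambda>X. X \<in> ?J", OF m])
  qed
  have B: "?N + {gen T0 - gen U'} \<in> ?J"
  proof -
    let ?G = "double_edge (?N + {gen ?qc}) 0 (?N + {gen ?z - gen rt}) (-6)"
    have m: "?N + {compose_sum ?G [gen ?qc, gen ?z - gen rt]} \<in> ?J"
      by (rule ideal_double_edge) (use R span_single[OF cf(3) ct(3)] span_single[OF rtf rtt] span_single[OF cf(4) ct(4)] in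
        \<open>auto intro: formal.span_diff\<close>)
    have e: "compose_sum ?G [gen ?qc, gen ?z - gen rt] - (gen T0 - gen U') \<in> ?N"
    proof -
      have "compose_sum ?G [gen ?qc, gen ?z] - gen T0 \<in> ?N" "compose_sum ?G [gen ?qc, gen rt] - gen U' \<in> ?N"
        using compose_sum_glued[OF cf(3,4) _ _ gl(3)] compose_sum_glued[OF cf(3) rtf _ _ gl(4)] ct rtt by auto
      from null_closed(2)[OF this] show ?thesis by (simp add: compose_sum_pair lin_ext_diff algebra_simps)
    qed
    show ?thesis by (rule subst[OF class_eq[OF e], of "\<lambda>X. X \<in> ?J", OF m])
  qed
  \<comment> \<open>The unit and \<open>n\<close> have even degree, so reordering them has sign
    1.\<close>
  have S: "gen U - gen U' \<in> ?N"
    using rel_null[OF graph_rels.swap[of "[]" "[Vert ?q 0 0 [2, 3] [], Vert ?b (-2) 0 [0] [2]]" "Vert ?u 0 0 [1] [3]" "Vert ?u (-4) 0 [] [0, 1]" "[]" "[]"]] UF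
    by (simp add: U_def U'_def sgn_deg_def)
  have Z: "gen T0 \<in> ?N"
    using zero_decoration_null[of "[]" "[Vert ?q 0 0 [0, 1] []]" "-6" 0 "[]" "[0, 1]" "[]" "[]" True] TF
    by (simp add: T0_def)
  have m: "?N + {(gen T - gen U) + - (gen T0 - gen U')} \<in> ?J" by (rule ideal_add[OF A ideal_minus[OF B]])
  have e: "(gen T - gen U) + - (gen T0 - gen U') - gen T \<in> ?N"
    using null_closed(3)[OF null_closed(1)[OF S Z]] by (simp add: algebra_simps)
  have "?N + {gen T} \<in> ?J" by (rule subst[OF class_eq[OF e], of "\<lambda>X. X \<in> ?J", OF m])
  then show ?thesis by (simp add: T_def)
qed

section \<open>The enveloping functor is not exact\<close>

lemma quot_properad_simps:
  "zero (quot_properad P N) = N"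
  "part (quot_properad P N) m n d = (\<lambda>x. N +>\<^bsub>P\<^esub> x) ` part P m n d"
  "diff (quot_properad P N) X = coset_map P N (diff P) X"
  "add (quot_properad P N) = (<+>\<^bsub>P\<^esub>)"
  unfolding quot_properad_def extend_simps by (simp_all add: quot_sbimod_def)

lemma enveloping_simps:
  "zero (enveloping D) = enveloping_ideal D"
  "part (enveloping D) m n d = (\<lambda>X. enveloping_ideal D + {X}) ` part (free_properad D) m n d"
  "diff (enveloping D) Y = enveloping_ideal D + diff (free_properad D) ` Y"
  "add (enveloping D) = (+)"
  by (simp_all add: enveloping_def quot_properad_simps a_coset_plus coset_map_plus set_add_plus fun_eq_iff
      del: free_properad_simps(3-))

text \<open>Without \<open>q\<close> every differentiated vertex carries a zero decoration.\<close>

lemma graph_diff_False_null: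
  assumes "G \<in> flow_graphs False"
  shows "graph_diff (\<lambda>_. model False) G \<in> null False"
proof -
  have "gen (DGraph (gouts G) ((verts G)[i := diff_vert (verts G ! i)]) (gins G)) \<in> null False" if i: "i < length (verts G)" for i
  proof -
    let ?v = "verts G ! i"
    have "decorated False ?v" using assms i by (auto simp: graphs_model)
    then have z: "diff_vert ?v = Vert 0 (vdeg ?v - 1) (level ?v) (outs ?v) (ins ?v)"
      by (simp add: diff_vert_def decorated_def model_diff_slot)
    have "G = DGraph (gouts G) (take i (verts G) @ Vert (elt ?v) (vdeg ?v) (level ?v) (outs ?v) (ins ?v) # drop (Suc i) (verts G)) (gins G)"
      using id_take_nth_drop[OF i] by (cases G) simp
    then have "DGraph (gouts G) (take i (verts G) @ Vert (elt ?v) (vdeg ?v) (level ?v) (outs ?v) (ins ?v) # drop (Suc i) (verts G)) (gins G)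
      \<in> flow_graphs False" using assms by simp
    from graphs_modify[OF stable_flow this HOL.refl HOL.refl slot_space_closed(1)]
    have "gen (DGraph (gouts G) (take i (verts G) @ Vert 0 (vdeg ?v - 1) (level ?v) (outs ?v) (ins ?v) # drop (Suc i) (verts G)) (gins G)) \<in> null False"
      by (rule zero_decoration_null)
    then show ?thesis using i by (simp add: z upd_conv_take_nth_drop)
  qed
  then show ?thesis unfolding graph_diff_model graph_null_def
    by (intro formal.span_sum formal.span_scale) simp
qed

lemma diff_flow_span_null:
  assumes "x \<in> flow_span False"
  shows "lin_ext (graph_diff (\<lambda>_. model False)) x \<in> null False"
  unfolding graph_null_def
  by (rule lin_ext_in_span[OF assms]) (use graph_diff_False_null in \<open>auto simp: graph_null_def\<close>)

text \<open>Elements are cosets of cosets here. Each member of the outer coset is a union of cosets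
  on which the differential has null values; adding the ideal gives the zero of the quotient, which
  is the ideal itself.\<close>

lemma diff_enveloping_False:
  fixes x :: "(nat \<Rightarrow>\<^sub>0 'k::field) dgraph \<Rightarrow>\<^sub>0 'k"
  assumes "x \<in> flow_span False"
  shows "diff (enveloping (model False)) (enveloping_ideal (model False) + {null False + {x}}) = enveloping_ideal (model False)"
proof -
  let ?J = "enveloping_ideal (model False :: ('k, nat \<Rightarrow>\<^sub>0 'k) properad)"
  let ?N = "null False :: ((nat \<Rightarrow>\<^sub>0 'k) dgraph \<Rightarrow>\<^sub>0 'k) set"
  have NJ: "?N \<in> ?J" using properadic_ideal.zero[of "free_properad (model False)"] by (simp add: enveloping_ideal_def)
  have d: "diff (free_properad (model False)) X = ?N" if X: "X \<in> ?J + {?N + {x}}" for X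
  proof -
    from X obtain j where "j \<in> ?J" "X = j + (?N + {x})" by (elim set_plus_elim) simp
    then have cl: "coset_like False X"
      using killed_ideal[of j] coset_like_singleton[OF assms] by (simp add: killed_def coset_like_add)
    then have "lin_ext (graph_diff (\<lambda>_. model False)) ` X \<subseteq> ?N" using diff_flow_span_null by (auto simp: coset_like_def)
    moreover have "X \<noteq> {}" using cl by (simp add: coset_like_def)
    ultimately have "?N + lin_ext (graph_diff (\<lambda>_. model False)) ` X = ?N"
    proof (intro equalityI subsetI)
      fix z assume a: "lin_ext (graph_diff (\<lambda>_. model False)) ` X \<subseteq> ?N" "X \<noteq> {}" "z \<in> ?N"
      then obtain y where y: "y \<in> lin_ext (graph_diff (\<lambda>_. model False)) ` X" by blast
      then have "z - y \<in> ?N" using a by (intro null_closed(2)) auto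
      then have "(z - y) + y \<in> ?N + lin_ext (graph_diff (\<lambda>_. model False)) ` X" using y by (rule set_plus_intro)
      then show "z \<in> ?N + lin_ext (graph_diff (\<lambda>_. model False)) ` X" by simp
    qed (auto elim!: set_plus_elim intro: null_closed(1))
    then show ?thesis by simp
  qed
  have "?J + {?N + {x}} \<noteq> {}" using NJ by (auto simp: set_plus_def)
  then have "diff (free_properad (model False)) ` (?J + {?N + {x}}) = {?N}" using d by (force simp del: free_properad_simps)
  moreover have "?J + {?N} = ?J"
  proof -
    have "j + ?N = j" if "j \<in> ?J" for j
      using killed_ideal[OF that] by (simp add: killed_def coset_like_def add.commute)
    then show ?thesis by (force simp: set_plus_def)
  qed
  ultimately show ?thesis by (simp add: enveloping_simps del: free_properad_simps)
qed

lemma null_mono_model: "null False \<subseteq> null True"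
proof -
  have g: "G \<in> flow_graphs True" if "G \<in> flow_graphs False" for G :: "(nat \<Rightarrow>\<^sub>0 'a) dgraph"
    using that slot_space_False unfolding graphs_model decorated_def by blast
  have "x \<in> graph_rels (\<lambda>_. model True) flow" if "x \<in> graph_rels (\<lambda>_. model False) flow" for x :: "(nat \<Rightarrow>\<^sub>0 'a) dgraph \<Rightarrow>\<^sub>0 'a"
    using that
  proof induction
    case add show ?case using graph_rels.add[OF add[THEN g]] by simp
  next
    case smult show ?case using graph_rels.smult[OF smult[THEN g]] by simp
  next
    case lact show ?case using graph_rels.lact[OF lact(1)[THEN g] lact(2)] by simp
  next
    case ract show ?case using graph_rels.ract[OF ract(1)[THEN g] ract(2)] by simp
  next
    case rename show ?case using graph_rels.rename[OF rename(1)[THEN g] rename(2)] by simp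
  next
    case swap show ?case using graph_rels.swap[OF swap[THEN g]] by simp
  qed
  then show ?thesis unfolding graph_null_def by (intro formal.span_mono) blast
qed

lemma null_False_True: "null True + null False = null True"
  using null_mono_model zero_null[of "\<lambda>_. model False" flow]
  by (auto elim!: set_plus_elim intro: null_closed(1)) (force simp: set_plus_def)

lemma pair_graph_flow: "pair_graph \<in> flow_graphs False"
proof -
  let ?G = "pair_graph :: (nat \<Rightarrow>\<^sub>0 'a) dgraph"
  have w: "wired ?G" by (auto simp: wired_def)
  have "rigid ?G"
  proof (rule hub_rigid[where h = 0])
    fix \<kappa> :: "nat \<Rightarrow> bool"
    assume k: "\<And>v x y. v \<in> set (verts ?G) \<Longrightarrow> x \<in> wires v \<Longrightarrow> y \<in> wires v \<Longrightarrow> \<kappa> x = \<kappa> y"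
    have "\<kappa> 1 = \<kappa> 0" by (rule k[of "Vert unit_elt (-2) 0 [0, 1] []"]) (simp_all add: wires_def)
    moreover have "wire_set ?G = {0, 1}" by (auto simp: wire_set_def wires_def)
    ultimately show "\<forall>x\<in>wire_set ?G. \<kappa> x = \<kappa> 0" by (metis empty_iff insert_iff)
  qed
  moreover have "ranked ?G" by (auto simp: ranked_def)
  moreover have "\<forall>v\<in>set (verts ?G). wires v \<noteq> {}" by (simp add: wires_def)
  ultimately have "flow ?G" unfolding flow_iff[OF w] by simp
  then show ?thesis using w elts_in(2,3)[of False] by (simp add: graphs_model decorated_def numeral_2_eq_2)
qed

lemma image_translate:
  assumes "\<And>a. a \<in> A \<Longrightarrow> f (a + c) = f a + e"
  shows "f ` (A + {c}) = f ` A + {e}"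
  using assms by (force simp: set_plus_def)

text \<open>Rests on \<open>pair_graph_in_ideal\<close>. The arbitrary summand \<open>A\<close>
  takes up the copies of the ideal that homology classes carry.\<close>

lemma enveloping_map_pair_graph:
  fixes A :: "((nat \<Rightarrow>\<^sub>0 'k::field) dgraph \<Rightarrow>\<^sub>0 'k) set set"
  shows "enveloping_map (model True) id (A + {null False + {gen pair_graph}}) = enveloping_map (model True) id (A + {null False + {0}})"
proof -
  let ?J = "enveloping_ideal (model True :: ('k, nat \<Rightarrow>\<^sub>0 'k) properad)"
  let ?N = "null True :: ((nat \<Rightarrow>\<^sub>0 'k) dgraph \<Rightarrow>\<^sub>0 'k) set"
  let ?T = "gen pair_graph :: (nat \<Rightarrow>\<^sub>0 'k) dgraph \<Rightarrow>\<^sub>0 'k"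
  have em: "enveloping_map (model True) id W = ?J + (\<lambda>X. ?N + X) ` W" for W :: "((nat \<Rightarrow>\<^sub>0 'k) dgraph \<Rightarrow>\<^sub>0 'k) set set"
    by (simp add: enveloping_map_def coset_map_plus dgraph.map_id image_image)
  have tr: "(\<lambda>X. ?N + X) ` (A + {null False + {x}}) = (\<lambda>X. ?N + X) ` A + {?N + {x}}" for x
  proof (rule image_translate)
    fix a
    have "?N + (a + (null False + {x})) = (?N + null False) + (a + {x})" by (simp only: ac_simps)
    also have "\<dots> = (?N + ?N) + (a + {x})" by (simp only: null_False_True null_add)
    also have "\<dots> = ?N + a + (?N + {x})" by (simp only: ac_simps)
    finally show "?N + (a + (null False + {x})) = ?N + a + (?N + {x})" .
  qed
  have sub: "?J + ((\<lambda>X. ?N + X) ` A + {?N + {x}}) \<subseteq> ?J + ((\<lambda>X. ?N + X) ` A + {?N + {y}})"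
    if "?N + {x - y} \<in> ?J" for x y
  proof
    fix Z assume "Z \<in> ?J + ((\<lambda>X. ?N + X) ` A + {?N + {x}})"
    then obtain j a where ja: "j \<in> ?J" "a \<in> A" "Z = j + ((?N + a) + (?N + {x}))" by (auto simp: set_plus_def)
    have "?N + {x} = (?N + {x - y}) + (?N + {y})" by (simp add: class_add)
    then have "Z = (j + (?N + {x - y})) + ((?N + a) + (?N + {y}))" using ja(3) by (simp only: ac_simps)
    moreover have "j + (?N + {x - y}) \<in> ?J"
      using properadic_ideal.add[OF ja(1)[unfolded enveloping_ideal_def] that[unfolded enveloping_ideal_def]]
      by (simp add: enveloping_ideal_def)
    ultimately show "Z \<in> ?J + ((\<lambda>X. ?N + X) ` A + {?N + {y}})" using ja(2) by (blast intro: set_plus_intro)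
  qed
  have "?N + {?T - 0} \<in> ?J" "?N + {0 - ?T} \<in> ?J"
    using pair_graph_in_ideal ideal_minus[OF pair_graph_in_ideal] by simp_all
  from sub[OF this(1)] sub[OF this(2)] show ?thesis unfolding em tr by blast
qed

theorem theorem47:
  shows "\<not> (\<forall>(D :: ('k::field_char_0, nat \<Rightarrow>\<^sub>0 'k) properad)
             (E :: ('k, nat \<Rightarrow>\<^sub>0 'k) properad) f.
           dioperad D \<and> dioperad E \<and> dioperad_hom D E f \<and> quasi_iso D E f \<longrightarrow>
           quasi_iso (enveloping D) (enveloping E) (enveloping_map E f))"
proof
  assume all: "\<forall>(D :: ('k, nat \<Rightarrow>\<^sub>0 'k) properad) (E :: ('k, nat \<Rightarrow>\<^sub>0 'k) properad) f.
           dioperad D \<and> dioperad E \<and> dioperad_hom D E f \<and> quasi_iso D E f \<longrightarrow>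
           quasi_iso (enveloping D) (enveloping E) (enveloping_map E f)"
  let ?D = "model False :: ('k, nat \<Rightarrow>\<^sub>0 'k) properad" and ?E = "model True :: ('k, nat \<Rightarrow>\<^sub>0 'k) properad"
  let ?J = "enveloping_ideal ?D" and ?N = "null False :: ((nat \<Rightarrow>\<^sub>0 'k) dgraph \<Rightarrow>\<^sub>0 'k) set"
  let ?T = "gen pair_graph :: (nat \<Rightarrow>\<^sub>0 'k) dgraph \<Rightarrow>\<^sub>0 'k"
  have "quasi_iso (enveloping ?D) (enveloping ?E) (enveloping_map ?E id)"
    using all dioperad_model inclusion_hom inclusion_quasi_iso by blast
  \<comment> \<open>(0,0,-6) is the type of \<open>pair_graph\<close>.\<close>
  then have inj: "inj_on (coset_map (enveloping ?E) (boundaries (enveloping ?E) 0 0 (-6)) (enveloping_map ?E id))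
      (homology (enveloping ?D) 0 0 (-6))"
    unfolding quasi_iso_def by (meson bij_betw_imp_inj_on)
  \<comment> \<open>\<open>Y x\<close> is the class of \<open>x\<close> in the enveloping properad
    and \<open>Z x\<close> its homology class, the only boundary being the zero class
    \<open>?J\<close>.\<close>
  define Y where "Y x = ?J + {?N + {x}}" for x
  define Z where "Z x = {?J} + {Y x}" for x
  have part: "Y x \<in> part (enveloping ?D) m n d"
    if "x \<in> formal.span (gen ` {G \<in> flow_graphs False. has_type m n d G})" for x m n d
    unfolding enveloping_simps Y_def using that by simp
  have span: "x \<in> flow_span False" if "x \<in> formal.span (gen ` {G \<in> flow_graphs False. has_type m n d G})"
    for x :: "(nat \<Rightarrow>\<^sub>0 'k) dgraph \<Rightarrow>\<^sub>0 'k" and m n d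
    using that formal.span_mono[of "gen ` {G \<in> flow_graphs False. has_type m n d G}" "gen ` flow_graphs False"] by blast
  have bd: "boundaries (enveloping ?D) 0 0 (-6) = {?J}"
  proof -
    have "diff (enveloping ?D) X = ?J" if X: "X \<in> part (enveloping ?D) 0 0 (-6 + 1)" for X
    proof -
      from X obtain x where x: "x \<in> formal.span (gen ` {G \<in> flow_graphs False. has_type 0 0 (-6 + 1) G})"
        "X = ?J + {?N + {x}}"
        unfolding enveloping_simps(2) free_properad_simps graph_span_simps by blast
      show ?thesis unfolding x(2) by (rule diff_enveloping_False[OF span[OF x(1)]])
    qed
    \<comment> \<open>A member of the component ensures that the set of boundaries is not
      empty.\<close>
    moreover have "Y 0 \<in> part (enveloping ?D) 0 0 (-6 + 1)" by (rule part) (rule formal.span_zero)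
    ultimately show ?thesis unfolding boundaries_def by blast
  qed
  have hom: "Z x \<in> homology (enveloping ?D) 0 0 (-6)"
    if x: "x \<in> formal.span (gen ` {G \<in> flow_graphs False. has_type 0 0 (-6) G})" for x
  proof -
    have "Y x \<in> cycles (enveloping ?D) 0 0 (-6)"
      using part[OF x] diff_enveloping_False[OF span[OF x]] by (simp add: cycles_def enveloping_simps(1) Y_def)
    moreover have "boundaries (enveloping ?D) 0 0 (-6) +>\<^bsub>enveloping ?D\<^esub> Y x = Z x"
      unfolding bd Z_def by (rule a_coset_plus) (rule enveloping_simps)
    ultimately show ?thesis unfolding homology_def by blast
  qed
  have typed: "?T \<in> formal.span (gen ` {G \<in> flow_graphs False. has_type 0 0 (-6) G})"
    by (rule span_single[OF pair_graph_flow]) (simp add: gdeg_def)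
  have "enveloping_map ?E id (?J + Y ?T) = enveloping_map ?E id (?J + Y 0)"
    unfolding Y_def add.assoc[symmetric] by (rule enveloping_map_pair_graph)
  then have "coset_map (enveloping ?E) (boundaries (enveloping ?E) 0 0 (-6)) (enveloping_map ?E id) (Z ?T) =
      coset_map (enveloping ?E) (boundaries (enveloping ?E) 0 0 (-6)) (enveloping_map ?E id) (Z 0)"
    unfolding coset_map_plus[OF enveloping_simps(4)] Z_def singleton_plus by simp
  then have "Z ?T = Z 0"
    by (rule inj_onD[OF inj _ hom[OF typed] hom[OF formal.span_zero]])
  then have eq: "?J + Y ?T = ?J + Y 0" by (simp add: Z_def singleton_plus)
  have NJ: "?N \<in> ?J" using properadic_ideal.zero[of "free_properad ?D"] by (simp add: enveloping_ideal_def)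
  have "?N + (?N + (?N + {?T})) \<in> ?J + Y ?T" unfolding Y_def using NJ by (intro set_plus_intro) auto
  then have "?N + {?T} \<in> ?J + Y 0" unfolding eq null_absorb .
  then obtain i j where ij: "i \<in> ?J" "j \<in> ?J" "?N + {?T} = i + (j + (?N + {0}))"
    unfolding Y_def by (auto simp: set_plus_def)
  \<comment> \<open>The class of \<open>?T\<close> has been written as a sum of killed sets, so the
    functional would vanish on \<open>?T\<close>.\<close>
  have "killed (?N + {0})" by (rule killed_singleton) (simp_all add: formal.span_zero)
  then have "killed (i + (j + (?N + {0})))"
    by (rule killed_add[OF killed_ideal[OF ij(1)] killed_add[OF killed_ideal[OF ij(2)]]])
  moreover have "?T \<in> i + (j + (?N + {0}))"
    unfolding ij(3)[symmetric] using zero_null[of "\<lambda>_. ?D" flow] by (force simp: set_plus_def)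
  moreover have "good 0 0 (-6)" by (simp add: good_def)
  ultimately have "lin_form (lam 0 0 (-6)) ?T = 0" by (intro killed_lam)
  moreover have "lin_form (lam 0 0 (-6)) ?T = 1"
    by (simp add: lam_eq gdeg_def coef0_def unit_elt_def lookup_one)
  ultimately show False by simp
qed

end
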